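(* Let $\phi\colon U_S\to W$ be a representation over a field $\Bbbk$ of a matroid $\mathbf M$ on a finite set $S$. For any subset $A\subseteq S$ the dimension of the multiplicity space $S_A(\phi)$ is an invariant of the restricted matroid $\mathbf M|A$, and does not depend on the representation map $\phi$. In particular, the length of the T-complex $T_\bullet(\phi)$ and the dimensions of its components $T_n(\phi)$ are invariants of the matroid $\mathbf M$, and do not depend on the representation map $\phi$.
   Context: $U_S$ is the $\Bbbk$-vector space with basis $\{e_a: a\in S\}$, $W$ is a $\Bbbk$-vector space, $\phi$ is linear; for $I\subseteq S$, $U_I$ is the span of $\{e_a:a\in I\}$ and $V_I=\phi(U_I)$. $\phi$ is a representation of $\mathbf M$ if $A\subseteq S$ is independent in $\mathbf M$ iff $\dim V_A=|A|$. $r_A$ is the rank and $\ell_A=|A|-r_A-1$ the level of $A$. A T-flat of $\mathbf M$ is a subset $A\subseteq S$ such that $S\setminus A$ is a proper flat of the dual matroid $\mathbf M^*$ (equivalently, $A$ is a nonempty union of circuits). For $n\ge0$, $\mathcal T_n(\mathbf M)$ is the set of T-flats of level $n$. Multiplicity spaces. If $I\subseteq S$ is not a T-flat, $S_I(\phi)=0$. For a T-flat $I$ of level $n$, $C(I)$ is the set of chains $\mathbb I=(I^{(0)}\subsetneq\dots\subsetneq I^{(n)}=I)$ with $I^{(i)}\in\mathcal T_i(\mathbf M)$; $V(\mathbb I)=\Bbbk=S_0W$ if $n=0$, and $V(\mathbb I)=\prod_{i=1}^n\bigl(V_{I^{(i)}\setminus I^{(i-1)}}\cap V_{I^{(i-1)}}\bigr)\subseteq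 S_nW$ (product of subspaces in the symmetric algebra of $W$) if $n\ge1$; and $S_I(\phi)=\sum_{\mathbb I\in C(I)}V(\mathbb I)$. T-complex components. $T_I(\phi)=S_I(\phi)^*\otimes\wedge^{|I|}U_I\otimes\wedge^{r_I}V_I^*$ for a T-flat $I$, and the component of $T_\bullet(\phi)$ in homological degree $n\ge0$ is $T_n(\phi)=\bigoplus_{I\in\mathcal T_n(\mathbf M)}T_I(\phi)$; the length of $T_\bullet(\phi)$ is the largest $n$ with $T_n(\phi)\ne0$. "Invariant of $\mathbf M|A$, independent of $\phi$" means: if $\phi$, $\phi'$ are representations (possibly over different fields) of matroids $\mathbf M$, $\mathbf M'$ on $S$, $S'$, and $A\subseteq S$, $A'\subseteq S'$ are such that $\mathbf M|A\cong\mathbf M'|A'$, then $\dim S_A(\phi)=\dim S_{A'}(\phi')$; and similarly for the length and component dimensions of the T-complexes of representations of isomorphic matroids. *)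

theory Defs
  imports
    "HOL-Algebra.QuotRing"
    "HOL-Library.Multiset"
    "Jordan_Normal_Form.Missing_VectorSpace"
begin

section \<open>Matroids\<close>

record 's matroid =
  ground :: "'s set"
  indep :: "'s set \<Rightarrow> bool"

definition is_matroid :: "'s matroid \<Rightarrow> bool" where
  "is_matroid M \<longleftrightarrow>
     finite (ground M) \<and>
     (\<forall>X. indep M X \<longrightarrow> X \<subseteq> ground M) \<and>
     indep M {} \<and>
     (\<forall>X Y. indep M Y \<and> X \<subseteq> Y \<longrightarrow> indep M X) \<and>
     (\<forall>X Y. indep M X \<and> indep M Y \<and> card X < card Y \<longrightarrow> (\<exists>y\<in>Y - X. indep M (insert y X)))"

definition matroid_rank :: "'s matroid \<Rightarrow> 's set \<Rightarrow> nat" where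
  "matroid_rank M A = Max (card ` {X. X \<subseteq> A \<and> indep M X})"

definition matroid_base :: "'s matroid \<Rightarrow> 's set \<Rightarrow> bool" where
  "matroid_base M B \<longleftrightarrow> indep M B \<and> (\<forall>X. indep M X \<and> B \<subseteq> X \<longrightarrow> X = B)"

definition matroid_flat :: "'s matroid \<Rightarrow> 's set \<Rightarrow> bool" where
  "matroid_flat M F \<longleftrightarrow>
     F \<subseteq> ground M \<and> (\<forall>x\<in>ground M - F. matroid_rank M F < matroid_rank M (insert x F))"

text \<open>The bases of the dual are the complements of the bases; its independent sets are
  their subsets.\<close>

definition dual_matroid :: "'s matroid \<Rightarrow> 's matroid" where
  "dual_matroid M =
     \<lparr>ground = ground M,
      indep = (\<lambda>X. X \<subseteq> ground M \<and> (\<exists>B. matroid_base M B \<and> X \<inter> B = {}))\<rparr>"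

definition restrict_matroid :: "'s matroid \<Rightarrow> 's set \<Rightarrow> 's matroid" where
  "restrict_matroid M A = \<lparr>ground = A, indep = (\<lambda>X. X \<subseteq> A \<and> indep M X)\<rparr>"

definition matroid_isomorphic :: "'s matroid \<Rightarrow> 't matroid \<Rightarrow> bool" where
  "matroid_isomorphic M N \<longleftrightarrow>
     (\<exists>f. bij_betw f (ground M) (ground N) \<and> (\<forall>X\<subseteq>ground M. indep M X \<longleftrightarrow> indep N (f ` X)))"

text \<open>An independent set has level \<open>-1\<close>, hence the type \<open>int\<close>.\<close>

definition level :: "'s matroid \<Rightarrow> 's set \<Rightarrow> int" where
  "level M A = int (card A) - int (matroid_rank M A) - 1"

definition T_flat :: "'s matroid \<Rightarrow> 's set \<Rightarrow> bool" where
  "T_flat M A \<longleftrightarrow>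
     A \<subseteq> ground M \<and> matroid_flat (dual_matroid M) (ground M - A) \<and> ground M - A \<noteq> ground M"

definition T_flats :: "'s matroid \<Rightarrow> nat \<Rightarrow> 's set set" where
  "T_flats M n = {A. T_flat M A \<and> level M A = int n}"


section \<open>Constructions on vector spaces\<close>

subsection \<open>Free vector spaces, quotients, direct sums, duals\<close>

text \<open>The fields \<open>mult\<close> and \<open>one\<close> of a \<open>module\<close> record are irrelevant unless the
  record is used as an algebra.\<close>

definition free_vs :: "('k, 'm) ring_scheme \<Rightarrow> 'x set \<Rightarrow> ('k, 'x \<Rightarrow> 'k) module" where
  "free_vs K X =
     (ring.func_space K X)\<lparr>carrier := {f \<in> X \<rightarrow>\<^sub>E carrier K. finite {x \<in> X. f x \<noteq> \<zero>\<^bsub>K\<^esub>}}\<rparr>"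

definition basis_vec :: "('k, 'm) ring_scheme \<Rightarrow> 'x set \<Rightarrow> 'x \<Rightarrow> 'x \<Rightarrow> 'k" where
  "basis_vec K X x = restrict (\<lambda>y. if y = x then \<one>\<^bsub>K\<^esub> else \<zero>\<^bsub>K\<^esub>) X"

text \<open>The quotient of a module by a submodule, or of an algebra by an ideal: the quotient
  ring record of \<open>HOL-Algebra\<close> with the induced scalar multiplication.\<close>

definition quot_mod :: "('k, 'v, 'm) module_scheme \<Rightarrow> 'v set \<Rightarrow> ('k, 'v set) module" where
  "quot_mod V N =
     ring.extend (V Quot N) (module.fields (\<lambda>c X. \<Union>x\<in>X. N +>\<^bsub>V\<^esub> (c \<odot>\<^bsub>V\<^esub> x)))"

definition direct_sum_vs ::
    "'i set \<Rightarrow> ('i \<Rightarrow> ('k, 'v, 'm) module_scheme) \<Rightarrow> ('k, 'i \<Rightarrow> 'v) module" where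
  "direct_sum_vs J V =
     \<lparr>carrier = {f \<in> (\<Pi>\<^sub>E i\<in>J. carrier (V i)). finite {i \<in> J. f i \<noteq> \<zero>\<^bsub>V i\<^esub>}},
      mult = (\<lambda>f g. restrict (\<lambda>i. \<zero>\<^bsub>V i\<^esub>) J),
      one = restrict (\<lambda>i. \<zero>\<^bsub>V i\<^esub>) J,
      zero = restrict (\<lambda>i. \<zero>\<^bsub>V i\<^esub>) J,
      add = (\<lambda>f g. restrict (\<lambda>i. f i \<oplus>\<^bsub>V i\<^esub> g i) J),
      smult = (\<lambda>c f. restrict (\<lambda>i. c \<odot>\<^bsub>V i\<^esub> f i) J)\<rparr>"

definition dual_vs ::
    "('k, 'm) ring_scheme \<Rightarrow> ('k, 'v, 'n) module_scheme \<Rightarrow> ('k, 'v \<Rightarrow> 'k) module" where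
  "dual_vs K V =
     (ring.func_space K (carrier V))\<lparr>carrier :=
        {f \<in> carrier V \<rightarrow>\<^sub>E carrier K.
           (\<forall>u\<in>carrier V. \<forall>v\<in>carrier V. f (u \<oplus>\<^bsub>V\<^esub> v) = f u \<oplus>\<^bsub>K\<^esub> f v) \<and>
           (\<forall>c\<in>carrier K. \<forall>v\<in>carrier V. f (c \<odot>\<^bsub>V\<^esub> v) = c \<otimes>\<^bsub>K\<^esub> f v)}\<rparr>"


subsection \<open>Tensor products and exterior powers\<close>

definition tensor_rels ::
    "('k, 'm) ring_scheme \<Rightarrow> ('k, 'v, 'n) module_scheme \<Rightarrow> ('k, 'w, 'p) module_scheme
      \<Rightarrow> ('v \<times> 'w \<Rightarrow> 'k) set" where
  "tensor_rels K V W =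
     (let F = free_vs K (carrier V \<times> carrier W); e = basis_vec K (carrier V \<times> carrier W) in
        {e (u \<oplus>\<^bsub>V\<^esub> v, w) \<ominus>\<^bsub>F\<^esub> (e (u, w) \<oplus>\<^bsub>F\<^esub> e (v, w)) | u v w.
           u \<in> carrier V \<and> v \<in> carrier V \<and> w \<in> carrier W} \<union>
        {e (v, w \<oplus>\<^bsub>W\<^esub> x) \<ominus>\<^bsub>F\<^esub> (e (v, w) \<oplus>\<^bsub>F\<^esub> e (v, x)) | v w x.
           v \<in> carrier V \<and> w \<in> carrier W \<and> x \<in> carrier W} \<union>
        {e (c \<odot>\<^bsub>V\<^esub> v, w) \<ominus>\<^bsub>F\<^esub> (c \<odot>\<^bsub>F\<^esub> e (v, w)) | c v w.
           c \<in> carrier K \<and> v \<in> carrier V \<and> w \<in> carrier W} \<union>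
        {e (v, c \<odot>\<^bsub>W\<^esub> w) \<ominus>\<^bsub>F\<^esub> (c \<odot>\<^bsub>F\<^esub> e (v, w)) | c v w.
           c \<in> carrier K \<and> v \<in> carrier V \<and> w \<in> carrier W})"

definition tensor_vs ::
    "('k, 'm) ring_scheme \<Rightarrow> ('k, 'v, 'n) module_scheme \<Rightarrow> ('k, 'w, 'p) module_scheme
      \<Rightarrow> ('k, ('v \<times> 'w \<Rightarrow> 'k) set) module" where
  "tensor_vs K V W =
     (let F = free_vs K (carrier V \<times> carrier W) in
        quot_mod F (module.span K F (tensor_rels K V W)))"

text \<open>The \<open>n\<close>-th exterior power is the free vector space on \<open>n\<close>-tuples of vectors modulo
  multilinearity and the vanishing of tuples with a repeated entry.\<close>

definition tuples :: "('k, 'v, 'n) module_scheme \<Rightarrow> nat \<Rightarrow> 'v list set" where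
  "tuples V n = {xs. set xs \<subseteq> carrier V \<and> length xs = n}"

definition ext_rels ::
    "('k, 'm) ring_scheme \<Rightarrow> nat \<Rightarrow> ('k, 'v, 'n) module_scheme \<Rightarrow> ('v list \<Rightarrow> 'k) set" where
  "ext_rels K n V =
     (let F = free_vs K (tuples V n); e = basis_vec K (tuples V n) in
        {e (xs[i := u \<oplus>\<^bsub>V\<^esub> v]) \<ominus>\<^bsub>F\<^esub> (e (xs[i := u]) \<oplus>\<^bsub>F\<^esub> e (xs[i := v])) | xs i u v.
           xs \<in> tuples V n \<and> i < n \<and> u \<in> carrier V \<and> v \<in> carrier V} \<union>
        {e (xs[i := c \<odot>\<^bsub>V\<^esub> u]) \<ominus>\<^bsub>F\<^esub> (c \<odot>\<^bsub>F\<^esub> e (xs[i := u])) | xs i c u.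
           xs \<in> tuples V n \<and> i < n \<and> c \<in> carrier K \<and> u \<in> carrier V} \<union>
        {e xs | xs. xs \<in> tuples V n \<and> (\<exists>i j. i < j \<and> j < n \<and> xs ! i = xs ! j)})"

definition ext_power ::
    "('k, 'm) ring_scheme \<Rightarrow> nat \<Rightarrow> ('k, 'v, 'n) module_scheme
      \<Rightarrow> ('k, ('v list \<Rightarrow> 'k) set) module" where
  "ext_power K n V =
     (let F = free_vs K (tuples V n) in quot_mod F (module.span K F (ext_rels K n V)))"


subsection \<open>The symmetric algebra\<close>

text \<open>\<open>poly_alg K W\<close> is the commutative polynomial algebra with one variable for each
  element of \<open>W\<close>, a monomial being a multiset of elements of \<open>W\<close>. The symmetric algebra
  is its quotient by the ideal that makes the map sending \<open>w\<close> to its variable linear.\<close>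

definition monomials :: "('k, 'w, 'n) module_scheme \<Rightarrow> 'w multiset set" where
  "monomials W = {m. set_mset m \<subseteq> carrier W}"

definition poly_alg ::
    "('k, 'm) ring_scheme \<Rightarrow> ('k, 'w, 'n) module_scheme \<Rightarrow> ('k, 'w multiset \<Rightarrow> 'k) module" where
  "poly_alg K W =
     (free_vs K (monomials W))
       \<lparr>mult := (\<lambda>f g. restrict (\<lambda>m. \<Oplus>\<^bsub>K\<^esub>d\<in>{d. d \<subseteq># m}. f d \<otimes>\<^bsub>K\<^esub> g (m - d)) (monomials W)),
        one := basis_vec K (monomials W) {#}\<rparr>"

definition sym_ideal ::
    "('k, 'm) ring_scheme \<Rightarrow> ('k, 'w, 'n) module_scheme \<Rightarrow> ('w multiset \<Rightarrow> 'k) set" where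
  "sym_ideal K W =
     (let P = poly_alg K W; x = (\<lambda>w. basis_vec K (monomials W) {#w#}) in
        Idl\<^bsub>P\<^esub> ({x (u \<oplus>\<^bsub>W\<^esub> v) \<ominus>\<^bsub>P\<^esub> (x u \<oplus>\<^bsub>P\<^esub> x v) | u v. u \<in> carrier W \<and> v \<in> carrier W} \<union>
              {x (c \<odot>\<^bsub>W\<^esub> u) \<ominus>\<^bsub>P\<^esub> (c \<odot>\<^bsub>P\<^esub> x u) | c u. c \<in> carrier K \<and> u \<in> carrier W}))"

definition sym_alg ::
    "('k, 'm) ring_scheme \<Rightarrow> ('k, 'w, 'n) module_scheme
      \<Rightarrow> ('k, ('w multiset \<Rightarrow> 'k) set) module" where
  "sym_alg K W = quot_mod (poly_alg K W) (sym_ideal K W)"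

definition sym_incl ::
    "('k, 'm) ring_scheme \<Rightarrow> ('k, 'w, 'n) module_scheme \<Rightarrow> 'w \<Rightarrow> ('w multiset \<Rightarrow> 'k) set" where
  "sym_incl K W w = sym_ideal K W +>\<^bsub>poly_alg K W\<^esub> basis_vec K (monomials W) {#w#}"

definition subspace_prod ::
    "('k, 'm) ring_scheme \<Rightarrow> ('k, 'v, 'n) module_scheme \<Rightarrow> 'v set \<Rightarrow> 'v set \<Rightarrow> 'v set" where
  "subspace_prod K A X Y = module.span K A {x \<otimes>\<^bsub>A\<^esub> y | x y. x \<in> X \<and> y \<in> Y}"

text \<open>The empty product is the line spanned by the unit, that is, \<open>S\<^sub>0\<close> inside the symmetric
  algebra.\<close>

definition subspace_prod_list ::
    "('k, 'm) ring_scheme \<Rightarrow> ('k, 'v, 'n) module_scheme \<Rightarrow> 'v set list \<Rightarrow> 'v set" where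
  "subspace_prod_list K A Xs = foldr (subspace_prod K A) Xs (module.span K A {\<one>\<^bsub>A\<^esub>})"


section \<open>Representations, multiplicity spaces and the T-complex\<close>

definition U_space ::
    "('k, 'm) ring_scheme \<Rightarrow> 's set \<Rightarrow> 's set \<Rightarrow> ('s \<Rightarrow> 'k) set" where
  "U_space K S I = module.span K (free_vs K S) (basis_vec K S ` I)"

definition V_space ::
    "('k, 'm) ring_scheme \<Rightarrow> 's matroid \<Rightarrow> (('s \<Rightarrow> 'k) \<Rightarrow> 'w) \<Rightarrow> 's set \<Rightarrow> 'w set" where
  "V_space K M \<phi> I = \<phi> ` U_space K (ground M) I"

definition representation ::
    "('k, 'm) ring_scheme \<Rightarrow> ('k, 'w, 'n) module_scheme \<Rightarrow> 's matroid
      \<Rightarrow> (('s \<Rightarrow> 'k) \<Rightarrow> 'w) \<Rightarrow> bool" where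
  "representation K W M \<phi> \<longleftrightarrow>
     is_matroid M \<and>
     linear_map K (free_vs K (ground M)) W \<phi> \<and>
     (\<forall>A\<subseteq>ground M.
        indep M A \<longleftrightarrow> vectorspace.dim K (W\<lparr>carrier := V_space K M \<phi> A\<rparr>) = card A)"

definition T_chains :: "'s matroid \<Rightarrow> nat \<Rightarrow> 's set \<Rightarrow> 's set list set" where
  "T_chains M n I =
     {Is. length Is = Suc n \<and> Is ! n = I \<and>
          (\<forall>i\<le>n. Is ! i \<in> T_flats M i) \<and> (\<forall>i<n. Is ! i \<subset> Is ! Suc i)}"

definition chain_space ::
    "('k, 'm) ring_scheme \<Rightarrow> ('k, 'w, 'n) module_scheme \<Rightarrow> 's matroid
      \<Rightarrow> (('s \<Rightarrow> 'k) \<Rightarrow> 'w) \<Rightarrow> 's set list \<Rightarrow> ('w multiset \<Rightarrow> 'k) set set" where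
  "chain_space K W M \<phi> Is =
     subspace_prod_list K (sym_alg K W)
       (map (\<lambda>i. sym_incl K W `
               (V_space K M \<phi> (Is ! i - Is ! (i - 1)) \<inter> V_space K M \<phi> (Is ! (i - 1))))
            [1..<length Is])"

definition mult_space ::
    "('k, 'm) ring_scheme \<Rightarrow> ('k, 'w, 'n) module_scheme \<Rightarrow> 's matroid
      \<Rightarrow> (('s \<Rightarrow> 'k) \<Rightarrow> 'w) \<Rightarrow> 's set \<Rightarrow> ('w multiset \<Rightarrow> 'k) set set" where
  "mult_space K W M \<phi> I =
     (if T_flat M I
      then module.span K (sym_alg K W)
             (\<Union>Is\<in>T_chains M (nat (level M I)) I. chain_space K W M \<phi> Is)
      else {\<zero>\<^bsub>sym_alg K W\<^esub>})"

definition mult_vs ::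
    "('k, 'm) ring_scheme \<Rightarrow> ('k, 'w, 'n) module_scheme \<Rightarrow> 's matroid
      \<Rightarrow> (('s \<Rightarrow> 'k) \<Rightarrow> 'w) \<Rightarrow> 's set \<Rightarrow> ('k, ('w multiset \<Rightarrow> 'k) set) module" where
  "mult_vs K W M \<phi> I = (sym_alg K W)\<lparr>carrier := mult_space K W M \<phi> I\<rparr>"

definition T_component_at ::
    "('k, 'm) ring_scheme \<Rightarrow> ('k, 'w, 'n) module_scheme \<Rightarrow> 's matroid
      \<Rightarrow> (('s \<Rightarrow> 'k) \<Rightarrow> 'w) \<Rightarrow> 's set \<Rightarrow> _" where
  "T_component_at K W M \<phi> I =
     tensor_vs K
       (tensor_vs K
         (dual_vs K (mult_vs K W M \<phi> I))
         (ext_power K (card I)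
           ((free_vs K (ground M))\<lparr>carrier := U_space K (ground M) I\<rparr>)))
       (ext_power K (matroid_rank M I)
         (dual_vs K (W\<lparr>carrier := V_space K M \<phi> I\<rparr>)))"

definition T_component ::
    "('k, 'm) ring_scheme \<Rightarrow> ('k, 'w, 'n) module_scheme \<Rightarrow> 's matroid
      \<Rightarrow> (('s \<Rightarrow> 'k) \<Rightarrow> 'w) \<Rightarrow> nat \<Rightarrow> _" where
  "T_component K W M \<phi> n = direct_sum_vs (T_flats M n) (T_component_at K W M \<phi>)"

text \<open>The length is \<open>None\<close> when all components vanish (a matroid without circuits).\<close>

definition T_length ::
    "('k, 'm) ring_scheme \<Rightarrow> ('k, 'w, 'n) module_scheme \<Rightarrow> 's matroid
      \<Rightarrow> (('s \<Rightarrow> 'k) \<Rightarrow> 'w) \<Rightarrow> nat option" where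
  "T_length K W M \<phi> =
     (let N = {n. carrier (T_component K W M \<phi> n) \<noteq> {\<zero>\<^bsub>T_component K W M \<phi> n\<^esub>}} in
        if N = {} then None else Some (Max N))"

end

theory Submission
  imports Defs "HOL-Combinatorics.Permutations"
begin

text \<open>The spaces \<open>S\<^sub>A\<close> are sums over chains, which is no direct handle on their dimension. Inside the
  symmetric algebra of \<open>W\<close>, however, \<open>S\<^sub>A\<close> consists of the forms of degree \<open>|A| - r\<^sub>A - 1\<close> that,
  for every proper subset \<open>Y\<close> of \<open>A\<close>, vanish to order \<open>|Y| - r\<^sub>Y\<close> on the annihilator of \<open>V\<^sub>Y\<close>.
  Let \<open>x\<^sub>e\<close> be the image of the basis vector of an element \<open>e\<close> of \<open>A\<close>. Multiplication by \<open>x\<^sub>e\<close> maps the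
  space of \<open>A - e\<close> into that of \<open>A\<close>, and reduction modulo \<open>x\<^sub>e\<close> maps the space of \<open>A\<close> into that of
  the contraction \<open>A / e\<close>. With chains one sees that the second map is onto; with vanishing
  conditions, that its kernel is the image of the first. By induction on \<open>|A|\<close> the two descriptions
  agree, and the dimension satisfies the deletion-contraction recursion of the beta invariant of
  the dual of \<open>M|A\<close>. The exterior powers in the components of the T-complex are lines, so the
  dimensions of these components are sums of the dimensions of the \<open>S\<^sub>I\<close>.\<close>

section \<open>Linear algebra over record fields\<close>

text \<open>A sum of chain products that vanishes modulo \<open>x e\<close> does not visibly come
  from chains in \<open>A - {e}\<close>, and a form with vanishing conditions does not visibly lift
  from the contraction. The induction hypothesis fills both gaps, since one inclusion,
  \<open>mult_sp x A \<subseteq> van_sp x A\<close>, holds outright. Vanishing conditions are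
  tractable because in a basis adapted to the span of \<open>Y\<close> and to \<open>x e\<close>
  they restrict the monomials of a form one by one, so that division by \<open>x e\<close> is a
  shift of exponents. The induction runs over configurations of vectors in one fixed space:
  contraction is a projection of that space along \<open>x e\<close>, so the symmetric algebra never
  changes. A step needs \<open>x e\<close> nonzero and \<open>e\<close> no coloop. With a coloop, or
  a loop among other elements, a single vanishing condition already forces zero, and a lone loop
  gives the scalars. Nullity 0 would mean degree -1, hence the separate clause for it in
  \<open>van_sp\<close>. The beta invariant is computed from the ranks of the subsets of
  \<open>A\<close>, so the field and the vectors drop out of the dimension.\<close>

context vectorspace
begin

lemma subspaceI:
  assumes "N \<subseteq> carrier V" "\<zero>\<^bsub>V\<^esub> \<in> N"
    and "\<And>u v. u \<in> N \<Longrightarrow> v \<in> N \<Longrightarrow> u \<oplus>\<^bsub>V\<^esub> v \<in> N"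
    and "\<And>c v. c \<in> carrier K \<Longrightarrow> v \<in> N \<Longrightarrow> c \<odot>\<^bsub>V\<^esub> v \<in> N"
  shows "subspace K N V"
  using assms by (intro subspace.intro submodule.intro vectorspace_axioms module_axioms) auto

lemma subspaceD:
  assumes "subspace K N V"
  shows "N \<subseteq> carrier V" "\<zero>\<^bsub>V\<^esub> \<in> N"
    and "\<And>u v. u \<in> N \<Longrightarrow> v \<in> N \<Longrightarrow> u \<oplus>\<^bsub>V\<^esub> v \<in> N"
    and "\<And>c v. c \<in> carrier K \<Longrightarrow> v \<in> N \<Longrightarrow> c \<odot>\<^bsub>V\<^esub> v \<in> N"
    and "\<And>u v. u \<in> N \<Longrightarrow> v \<in> N \<Longrightarrow> u \<ominus>\<^bsub>V\<^esub> v \<in> N"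
proof -
  have s: "submodule K N V"
    using assms by (rule is_module)
  show N: "N \<subseteq> carrier V" "\<zero>\<^bsub>V\<^esub> \<in> N"
    and add: "\<And>u v. u \<in> N \<Longrightarrow> v \<in> N \<Longrightarrow> u \<oplus>\<^bsub>V\<^esub> v \<in> N"
    and sm: "\<And>c v. c \<in> carrier K \<Longrightarrow> v \<in> N \<Longrightarrow> c \<odot>\<^bsub>V\<^esub> v \<in> N"
    using s by (auto simp: submodule_def)
  fix u v assume uv: "u \<in> N" "v \<in> N"
  have "u \<ominus>\<^bsub>V\<^esub> v = u \<oplus>\<^bsub>V\<^esub> (\<ominus>\<^bsub>K\<^esub> \<one>\<^bsub>K\<^esub>) \<odot>\<^bsub>V\<^esub> v"
    using uv N by (subst smult_minus_1) (auto simp: a_minus_def)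
  then show "u \<ominus>\<^bsub>V\<^esub> v \<in> N"
    using uv add sm by simp
qed

lemma span_subspace: "S \<subseteq> carrier V \<Longrightarrow> subspace K (span S) V"
  by (rule span_is_subspace)

lemma span_minimal: "subspace K N V \<Longrightarrow> S \<subseteq> N \<Longrightarrow> span S \<subseteq> N"
  by (rule span_is_subset) auto

lemma span_least_eq:
  assumes "S \<subseteq> span T" "T \<subseteq> span S" "S \<subseteq> carrier V" "T \<subseteq> carrier V"
  shows "span S = span T"
  using assms span_minimal span_subspace by (metis subset_antisym)

lemma subspace_carrier: "subspace K (carrier V) V"
  by (rule subspaceI) auto

lemma subspace_zero: "subspace K {\<zero>\<^bsub>V\<^esub>} V"
  by (rule subspaceI) auto

text \<open>Zorn's lemma, because \<open>W\<close> may be infinite-dimensional. A dependence uses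
  finitely many vectors, and these lie in a single member of a chain, so unions of chains stay
  independent.\<close>

lemma exists_basis_extending:
  assumes "L \<subseteq> carrier V" "lin_indpt L"
  shows "\<exists>B. L \<subseteq> B \<and> basis B"
proof -
  let ?\<A> = "{S. L \<subseteq> S \<and> S \<subseteq> carrier V \<and> lin_indpt S}"
  have "\<exists>M\<in>?\<A>. \<forall>X\<in>?\<A>. M \<subseteq> X \<longrightarrow> X = M"
  proof (rule subset_Zorn_nonempty)
    show "?\<A> \<noteq> {}"
      using assms by blast
    fix \<C> assume ne: "\<C> \<noteq> {}" and ch: "subset.chain ?\<A> \<C>"
    have sub: "S \<in> \<C> \<Longrightarrow> L \<subseteq> S \<and> S \<subseteq> carrier V \<and> lin_indpt S" for S
      using ch by (auto simp: subset.chain_def)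
    have "lin_indpt (\<Union>\<C>)"
    proof
      assume "lin_dep (\<Union>\<C>)"
      then obtain A a v where A: "finite A" "A \<subseteq> \<Union>\<C>" "a \<in> A \<rightarrow> carrier K"
        "lincomb a A = \<zero>\<^bsub>V\<^esub>" "v \<in> A" "a v \<noteq> \<zero>\<^bsub>K\<^esub>"
        unfolding lin_dep_def by blast
      obtain S where "S \<in> \<C>" "A \<subseteq> S"
        using finite_subset_Union_chain[OF A(1,2) ne ch] by blast
      then show False
        using A sub unfolding lin_dep_def by blast
    qed
    then show "\<Union>\<C> \<in> ?\<A>"
      using sub ne by blast
  qed
  then obtain M where M0: "M \<in> ?\<A>" "\<forall>X\<in>?\<A>. M \<subseteq> X \<longrightarrow> X = M"
    by (rule bexE)
  then have M: "L \<subseteq> M" "M \<subseteq> carrier V" "lin_indpt M"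
    by simp_all
  have "X = M" if "M \<subseteq> X" "X \<subseteq> carrier V" "lin_indpt X" for X
    using that M0(2) subset_trans[OF M(1) that(1)] by simp
  then have "maximal M (\<lambda>S. S \<subseteq> carrier V \<and> lin_indpt S)"
    using M(2,3) by (simp add: maximal_def)
  then show ?thesis
    using M max_li_is_basis by blast
qed

text \<open>Independent sets in \<open>N\<close> are independent in \<open>N'\<close> and hence
  bounded in size, so a maximal one exists and is a finite basis of \<open>N\<close>.\<close>

lemma subspace_dim_le:
  assumes "subspace K N V" "subspace K N' V" "N \<subseteq> N'" "vectorspace.fin_dim K (vs N')"
  shows "vectorspace.fin_dim K (vs N)"
    and "vectorspace.dim K (vs N) \<le> vectorspace.dim K (vs N')"
proof -
  interpret N: vectorspace K "vs N"
    using assms by (simp add: subspace_is_vs)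
  interpret N': vectorspace K "vs N'"
    using assms by (simp add: subspace_is_vs)
  have li: "N'.lin_indpt A" "A \<subseteq> N'" if "A \<subseteq> N" "N.lin_indpt A" for A
    using that assms span_li_not_depend(2)[of A N] span_li_not_depend(2)[of A N'] by auto
  have li_card: "finite A" "card A \<le> N'.dim" if "A \<subseteq> N" "N.lin_indpt A" for A
    using N'.li_le_dim[OF assms(4), of A] li[OF that] by auto
  have "N.lin_indpt {}"
    by (auto simp: N.lin_dep_def)
  then obtain A where A: "finite A" "maximal A (\<lambda>S. S \<subseteq> N \<and> N.lin_indpt S)"
    using maximal_exists[of "\<lambda>S. S \<subseteq> N \<and> N.lin_indpt S" "N'.dim" "{}"] li_card by auto
  then have bas: "N.basis A"
    using N.max_li_is_basis by simp
  then show fd: "N.fin_dim"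
    using A unfolding N.fin_dim_def N.basis_def by blast
  have d: "N.dim = card A"
    using N.dim_basis A bas by blast
  have A': "A \<subseteq> N" "N.lin_indpt A"
    using bas unfolding N.basis_def by auto
  then show "N.dim \<le> N'.dim"
    using li_card d by simp
qed

lemma fin_dim_span:
  assumes "finite S" "S \<subseteq> carrier V"
  shows "vectorspace.fin_dim K (vs (span S))" "vectorspace.dim K (vs (span S)) \<le> card S"
proof -
  interpret N: vectorspace K "vs (span S)"
    using assms by (simp add: subspace_is_vs span_subspace)
  have S: "S \<subseteq> span S"
    using assms in_own_span by blast
  have "N.span S = span S"
    using span_li_not_depend(1)[OF S] assms span_is_submodule by blast
  then show "N.fin_dim" "N.dim \<le> card S"
    using assms S N.gen_ge_dim[of S] unfolding N.fin_dim_def by auto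
qed

end

lemma linear_mapI:
  assumes "vectorspace K V" "vectorspace K W"
    and "\<And>v. v \<in> carrier V \<Longrightarrow> T v \<in> carrier W"
    and "\<And>u v. u \<in> carrier V \<Longrightarrow> v \<in> carrier V \<Longrightarrow> T (u \<oplus>\<^bsub>V\<^esub> v) = T u \<oplus>\<^bsub>W\<^esub> T v"
    and "\<And>c v. c \<in> carrier K \<Longrightarrow> v \<in> carrier V \<Longrightarrow> T (c \<odot>\<^bsub>V\<^esub> v) = c \<odot>\<^bsub>W\<^esub> T v"
  shows "linear_map K V W T"
  using assms by (intro linear_map.intro mod_hom.intro mod_hom_axioms.intro)
    (auto simp: vectorspace_def module_hom_def)

lemma linear_map_compose:
  assumes "linear_map K U V S" "linear_map K V W T"
  shows "linear_map K U W (\<lambda>x. T (S x))"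
proof -
  interpret S: linear_map K U V S by fact
  interpret T: linear_map K V W T by fact
  show ?thesis
    by (rule linear_mapI) (auto intro: S.V.vectorspace_axioms T.W.vectorspace_axioms)
qed

context linear_map
begin

lemma kernel_subspace: "subspace K {v \<in> carrier V. T v = \<zero>\<^bsub>W\<^esub>} V"
  using kerT_is_subspace by (simp add: ker_def)

lemma image_subspace:
  assumes "subspace K N V"
  shows "subspace K (T ` N) W"
proof (rule W.subspaceI)
  note N = V.subspaceD[OF assms]
  show "T ` N \<subseteq> carrier W"
    using N(1) by auto
  show "\<zero>\<^bsub>W\<^esub> \<in> T ` N"
    using N(2) f0_is_0 by (metis image_eqI)
  fix u v assume uv: "u \<in> T ` N" "v \<in> T ` N"
  then obtain a b where ab: "a \<in> N" "b \<in> N" "u = T a" "v = T b"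
    by blast
  then have "T (a \<oplus>\<^bsub>V\<^esub> b) = u \<oplus>\<^bsub>W\<^esub> v"
    using N(1) by (auto simp: subset_iff)
  then show "u \<oplus>\<^bsub>W\<^esub> v \<in> T ` N"
    using N(3) ab by (metis image_eqI)
next
  note N = V.subspaceD[OF assms]
  fix c v assume c: "c \<in> carrier K" and "v \<in> T ` N"
  then obtain a where a: "a \<in> N" "v = T a"
    by blast
  then have "T (c \<odot>\<^bsub>V\<^esub> a) = c \<odot>\<^bsub>W\<^esub> v"
    using N(1) c by auto
  then show "c \<odot>\<^bsub>W\<^esub> v \<in> T ` N"
    using N(4) a c by (metis image_eqI)
qed

lemma preimage_subspace:
  assumes "subspace K N W"
  shows "subspace K {v \<in> carrier V. T v \<in> N} V"
  using W.subspaceD[OF assms] by (intro V.subspaceI) auto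

lemma image_span:
  assumes "S \<subseteq> carrier V"
  shows "T ` V.module.span S = W.module.span (T ` S)"
proof
  have TS: "T ` S \<subseteq> carrier W"
    using assms by auto
  have "S \<subseteq> {v \<in> carrier V. T v \<in> W.module.span (T ` S)}"
    using assms TS W.module.in_own_span by blast
  then have "V.module.span S \<subseteq> {v \<in> carrier V. T v \<in> W.module.span (T ` S)}"
    by (intro V.span_minimal preimage_subspace W.span_subspace TS)
  then show "T ` V.module.span S \<subseteq> W.module.span (T ` S)"
    by blast
  show "W.module.span (T ` S) \<subseteq> T ` V.module.span S"
    using assms V.module.in_own_span by (intro W.span_minimal image_subspace V.span_subspace) blast+
qed

lemma restrict_linear:
  assumes "subspace K N V" "subspace K N' W" "T ` N \<subseteq> N'"
  shows "linear_map K (V\<lparr>carrier := N\<rparr>) (W\<lparr>carrier := N'\<rparr>) T"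
  using assms V.subspaceD(1)[OF assms(1)]
  by (intro linear_mapI V.subspace_is_vs W.subspace_is_vs) (auto simp: subset_iff)

lemma inj_onI_kernel:
  assumes "\<And>v. v \<in> carrier V \<Longrightarrow> T v = \<zero>\<^bsub>W\<^esub> \<Longrightarrow> v = \<zero>\<^bsub>V\<^esub>"
  shows "inj_on T (carrier V)"
proof (rule inj_onI)
  fix x y assume xy: "x \<in> carrier V" "y \<in> carrier V" "T x = T y"
  then have "T (x \<ominus>\<^bsub>V\<^esub> y) = \<zero>\<^bsub>W\<^esub>"
    by simp
  then have "x \<ominus>\<^bsub>V\<^esub> y = \<zero>\<^bsub>V\<^esub>"
    using assms xy by blast
  then show "x = y"
    using xy by simp
qed

lemma inv_linear:
  assumes "bij_betw T (carrier V) (carrier W)"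
  shows "linear_map K W V (inv_into (carrier V) T)"
proof (rule linear_mapI)
  let ?I = "inv_into (carrier V) T"
  have inj: "inj_on T (carrier V)" and im: "T ` carrier V = carrier W"
    using assms by (auto simp: bij_betw_def)
  show c: "?I w \<in> carrier V" if "w \<in> carrier W" for w
    using that im by (auto intro: inv_into_into)
  have TI: "T (?I w) = w" if "w \<in> carrier W" for w
    using that im by (simp add: f_inv_into_f)
  have IT: "?I (T v) = v" if "v \<in> carrier V" for v
    using that inj by simp
  show "?I (u \<oplus>\<^bsub>W\<^esub> v) = ?I u \<oplus>\<^bsub>V\<^esub> ?I v" if "u \<in> carrier W" "v \<in> carrier W" for u v
    using that IT[of "?I u \<oplus>\<^bsub>V\<^esub> ?I v"] c TI by simp
  show "?I (k \<odot>\<^bsub>W\<^esub> v) = k \<odot>\<^bsub>V\<^esub> ?I v" if "k \<in> carrier K" "v \<in> carrier W" for k v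
    using that IT[of "k \<odot>\<^bsub>V\<^esub> ?I v"] c TI by simp
qed (rule W.vectorspace_axioms V.vectorspace_axioms)+

lemma bij_fin_dim:
  assumes "bij_betw T (carrier V) (carrier W)" "V.fin_dim"
  shows "W.fin_dim" "W.dim = V.dim"
  using assms surj_fin_dim dim_eq by (auto simp: bij_betw_def)

lemma bij_fin_dim':
  assumes "bij_betw T (carrier V) (carrier W)" "W.fin_dim"
  shows "V.fin_dim" "V.dim = W.dim"
proof -
  interpret I: linear_map K W V "inv_into (carrier V) T"
    by (rule inv_linear) fact
  show "V.fin_dim" "V.dim = W.dim"
    using I.bij_fin_dim bij_betw_inv_into[OF assms(1)] assms(2) by auto
qed

lemma subspace_image_dim:
  assumes "inj_on T (carrier V)" "subspace K N V" "vectorspace.fin_dim K (V.vs N)"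
  shows "vectorspace.fin_dim K (W.vs (T ` N))"
    and "vectorspace.dim K (W.vs (T ` N)) = vectorspace.dim K (V.vs N)"
proof -
  interpret N: linear_map K "V.vs N" "W.vs (T ` N)" T
    using assms image_subspace restrict_linear by blast
  have "bij_betw T N (T ` N)"
    using assms V.subspaceD(1)[OF assms(2)] by (meson inj_on_imp_bij_betw inj_on_subset)
  then show "vectorspace.fin_dim K (W.vs (T ` N))"
    "vectorspace.dim K (W.vs (T ` N)) = vectorspace.dim K (V.vs N)"
    using N.bij_fin_dim assms(3) by simp_all
qed

text \<open>Rank-nullity with finite dimension of the source as a conclusion: generators of the
  kernel together with lifts of generators of the image generate. This is the form needed for a
  space known only through an exact sequence.\<close>

lemma dim_extension:
  assumes ker: "vectorspace.fin_dim K (V.vs {v \<in> carrier V. T v = \<zero>\<^bsub>W\<^esub>})"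
    and im: "vectorspace.fin_dim K (W.vs (T ` carrier V))"
  shows "V.fin_dim"
    and "V.dim = vectorspace.dim K (V.vs {v \<in> carrier V. T v = \<zero>\<^bsub>W\<^esub>}) +
      vectorspace.dim K (W.vs (T ` carrier V))"
proof -
  let ?N = "{v \<in> carrier V. T v = \<zero>\<^bsub>W\<^esub>}"
  have subI: "subspace K (T ` carrier V) W"
    by (rule image_subspace) (rule V.subspace_carrier)
  interpret N: vectorspace K "V.vs ?N"
    using kernel_subspace by (simp add: V.subspace_is_vs)
  interpret I: vectorspace K "W.vs (T ` carrier V)"
    using subI by (simp add: W.subspace_is_vs)
  obtain A where A: "finite A" "A \<subseteq> ?N" "N.span A = ?N"
    using ker unfolding N.fin_dim_def by auto
  obtain C where C: "finite C" "C \<subseteq> T ` carrier V" "I.span C = T ` carrier V"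
    using im unfolding I.fin_dim_def by auto
  obtain C' where C': "C' \<subseteq> carrier V" "finite C'" "C = T ` C'"
    using C by (meson finite_subset_image)
  have A': "V.module.span A = ?N"
    using V.module.span_li_not_depend(1)[OF A(2)] kernel_subspace A(3) by auto
  have imC: "T ` V.module.span C' = T ` carrier V"
    using W.module.span_li_not_depend(1)[OF C(2)] subI C(3) image_span[OF C'(1)] C' by auto
  have AC: "A \<union> C' \<subseteq> carrier V"
    using A C' by auto
  have "V.module.span (A \<union> C') = carrier V"
  proof
    show "V.module.span (A \<union> C') \<subseteq> carrier V"
      by (rule V.module.span_is_subset2) (rule AC)
    show "carrier V \<subseteq> V.module.span (A \<union> C')"
    proof
      fix v assume v: "v \<in> carrier V"
      then obtain s where s: "s \<in> V.module.span C'" "T v = T s"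
        using imC by (metis image_iff)
      have sc: "s \<in> carrier V"
        using s C' by auto
      have "v \<ominus>\<^bsub>V\<^esub> s \<in> V.module.span A"
        unfolding A' using v sc s by simp
      then have "v \<ominus>\<^bsub>V\<^esub> s \<in> V.module.span (A \<union> C')" "s \<in> V.module.span (A \<union> C')"
        using V.module.span_is_monotone[of A "A \<union> C'"] V.module.span_is_monotone[of C' "A \<union> C'"] s by auto
      then have "(v \<ominus>\<^bsub>V\<^esub> s) \<oplus>\<^bsub>V\<^esub> s \<in> V.module.span (A \<union> C')"
        using AC V.span_add1 by blast
      then show "v \<in> V.module.span (A \<union> C')"
        using v sc by (simp add: a_minus_def V.module.M.a_assoc V.module.M.l_neg)
    qed
  qed
  then show fd: "V.fin_dim"
    unfolding V.fin_dim_def using A(1) C'(2) AC by blast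
  show "V.dim = N.dim + I.dim"
    using rank_nullity[OF fd] unfolding ker_def im_def by simp
qed

end

subsection \<open>Free vector spaces\<close>

text \<open>The universal map out of a free vector space, sending the basis vector of
  \<open>x\<close> to \<open>g x\<close>. Summing over the support of \<open>f\<close> keeps the sum
  finite when \<open>X\<close> is infinite.\<close>

definition free_ext ::
    "('k, 'm) ring_scheme \<Rightarrow> ('k, 'v, 'n) module_scheme \<Rightarrow> 'x set \<Rightarrow> ('x \<Rightarrow> 'v) \<Rightarrow> ('x \<Rightarrow> 'k) \<Rightarrow> 'v" where
  "free_ext K V X g f = (\<Oplus>\<^bsub>V\<^esub>x\<in>{x \<in> X. f x \<noteq> \<zero>\<^bsub>K\<^esub>}. f x \<odot>\<^bsub>V\<^esub> g x)"

context field
begin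

lemma free_vs_carrier:
    "carrier (free_vs R X) = {f \<in> X \<rightarrow>\<^sub>E carrier R. finite {x \<in> X. f x \<noteq> \<zero>}}"
  and free_vs_zero: "\<zero>\<^bsub>free_vs R X\<^esub> = (\<lambda>x\<in>X. \<zero>)"
  and free_vs_add: "f \<oplus>\<^bsub>free_vs R X\<^esub> g = (\<lambda>x\<in>X. f x \<oplus> g x)"
  and free_vs_smult: "c \<odot>\<^bsub>free_vs R X\<^esub> f = (\<lambda>x\<in>X. c \<otimes> f x)"
  by (simp_all add: free_vs_def func_space_def)

lemma free_vs_vectorspace: "vectorspace R (free_vs R X)"
proof -
  have "vectorspace R (func_space X)"
  proof (rule vectorspace.intro)
    show "module R (func_space X)"
      by (rule func_space_is_module)
  qed (rule field_axioms)
  then interpret F: vectorspace R "func_space X" .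
  have "subspace R {f \<in> X \<rightarrow>\<^sub>E carrier R. finite {x \<in> X. f x \<noteq> \<zero>}} (func_space X)"
  proof (rule F.subspaceI)
    fix f g assume fg: "f \<in> {f \<in> X \<rightarrow>\<^sub>E carrier R. finite {x \<in> X. f x \<noteq> \<zero>}}"
      "g \<in> {f \<in> X \<rightarrow>\<^sub>E carrier R. finite {x \<in> X. f x \<noteq> \<zero>}}"
    then have "finite ({x \<in> X. f x \<noteq> \<zero>} \<union> {x \<in> X. g x \<noteq> \<zero>})"
      by simp
    then have "finite {x \<in> X. (f \<oplus>\<^bsub>func_space X\<^esub> g) x \<noteq> \<zero>}"
      by (rule finite_subset[rotated]) (auto simp: func_space_def)
    then show "f \<oplus>\<^bsub>func_space X\<^esub> g \<in> {f \<in> X \<rightarrow>\<^sub>E carrier R. finite {x \<in> X. f x \<noteq> \<zero>}}"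
      using fg by (auto simp: func_space_def)
  next
    fix c f assume fg: "c \<in> carrier R" "f \<in> {f \<in> X \<rightarrow>\<^sub>E carrier R. finite {x \<in> X. f x \<noteq> \<zero>}}"
    have "finite {x \<in> X. (c \<odot>\<^bsub>func_space X\<^esub> f) x \<noteq> \<zero>}"
      by (rule finite_subset[of _ "{x \<in> X. f x \<noteq> \<zero>}"]) (use fg in \<open>auto simp: func_space_def\<close>)
    then show "c \<odot>\<^bsub>func_space X\<^esub> f \<in> {f \<in> X \<rightarrow>\<^sub>E carrier R. finite {x \<in> X. f x \<noteq> \<zero>}}"
      using fg by (auto simp: func_space_def)
  qed (auto simp: func_space_def)
  then show ?thesis
    unfolding free_vs_def by (rule F.subspace_is_vs)
qed

lemma free_vs_ext:
  assumes "f \<in> carrier (free_vs R X)" "g \<in> carrier (free_vs R X)" "\<And>x. x \<in> X \<Longrightarrow> f x = g x"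
  shows "f = g"
  using assms by (intro PiE_ext[of f X "\<lambda>_. carrier R" g]) (auto simp: free_vs_carrier)

lemma free_vs_apply_closed: "f \<in> carrier (free_vs R X) \<Longrightarrow> x \<in> X \<Longrightarrow> f x \<in> carrier R"
  by (auto simp: free_vs_carrier)

lemma basis_vec_closed: "x \<in> X \<Longrightarrow> basis_vec R X x \<in> carrier (free_vs R X)"
  by (auto simp: free_vs_carrier basis_vec_def)

lemma basis_vec_apply: "y \<in> X \<Longrightarrow> basis_vec R X x y = (if y = x then \<one> else \<zero>)"
  by (simp add: basis_vec_def)

lemma basis_vec_inj: "x \<in> X \<Longrightarrow> basis_vec R X x = basis_vec R X y \<Longrightarrow> x = y"
  using basis_vec_apply[of x X x] basis_vec_apply[of x X y] by (simp split: if_splits)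

lemma free_vs_finsum_apply:
  assumes "finite A" "g \<in> A \<rightarrow> carrier (free_vs R X)" "x \<in> X"
  shows "(\<Oplus>\<^bsub>free_vs R X\<^esub>a\<in>A. g a) x = (\<Oplus>a\<in>A. g a x)"
proof -
  interpret F: vectorspace R "free_vs R X"
    by (rule free_vs_vectorspace)
  show ?thesis
    using assms(1,2)
  proof (induction A)
    case (insert a A)
    then have "(\<lambda>a. g a x) \<in> insert a A \<rightarrow> carrier R"
      by (intro funcsetI free_vs_apply_closed[OF _ assms(3)]) auto
    with insert show ?case
      using assms(3) by (simp add: free_vs_add Pi_iff)
  qed (use assms in \<open>simp add: free_vs_zero\<close>)
qed

lemma free_vs_lincomb_basis:
  assumes "finite A" "A \<subseteq> X" "c \<in> A \<rightarrow> carrier R" "x \<in> X"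
  shows "(\<Oplus>\<^bsub>free_vs R X\<^esub>a\<in>A. c a \<odot>\<^bsub>free_vs R X\<^esub> basis_vec R X a) x = (if x \<in> A then c x else \<zero>)"
proof -
  interpret F: vectorspace R "free_vs R X"
    by (rule free_vs_vectorspace)
  have cl: "(\<lambda>a. c a \<odot>\<^bsub>free_vs R X\<^esub> basis_vec R X a) \<in> A \<rightarrow> carrier (free_vs R X)"
    using assms by (auto intro!: F.smult_closed basis_vec_closed)
  have "(\<Oplus>\<^bsub>free_vs R X\<^esub>a\<in>A. c a \<odot>\<^bsub>free_vs R X\<^esub> basis_vec R X a) x
      = (\<Oplus>a\<in>A. (c a \<odot>\<^bsub>free_vs R X\<^esub> basis_vec R X a) x)"
    using assms cl by (intro free_vs_finsum_apply) auto
  also have "\<dots> = (\<Oplus>a\<in>A. if x = a then c a else \<zero>)"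
    using assms by (intro finsum_cong') (auto simp: free_vs_smult basis_vec_apply Pi_iff)
  also have "\<dots> = (if x \<in> A then c x else \<zero>)"
  proof (cases "x \<in> A")
    case True
    then show ?thesis
      using assms finsum_singleton[of x A c] by simp
  next
    case False
    then have "(\<Oplus>a\<in>A. if x = a then c a else \<zero>) = (\<Oplus>a\<in>A. \<zero>)"
      by (intro finsum_cong') auto
    then show ?thesis
      using False by simp
  qed
  finally show ?thesis .
qed

lemma free_vs_expand:
  assumes "f \<in> carrier (free_vs R X)"
  shows "f = (\<Oplus>\<^bsub>free_vs R X\<^esub>a\<in>{x \<in> X. f x \<noteq> \<zero>}. f a \<odot>\<^bsub>free_vs R X\<^esub> basis_vec R X a)"
proof -
  interpret F: vectorspace R "free_vs R X"
    by (rule free_vs_vectorspace)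
  show ?thesis
  proof (rule free_vs_ext[OF assms])
    show "(\<Oplus>\<^bsub>free_vs R X\<^esub>a\<in>{x \<in> X. f x \<noteq> \<zero>}. f a \<odot>\<^bsub>free_vs R X\<^esub> basis_vec R X a)
        \<in> carrier (free_vs R X)"
      using assms by (auto intro!: F.finsum_closed F.smult_closed basis_vec_closed
          simp: free_vs_apply_closed)
    show "f x = (\<Oplus>\<^bsub>free_vs R X\<^esub>a\<in>{x \<in> X. f x \<noteq> \<zero>}. f a \<odot>\<^bsub>free_vs R X\<^esub> basis_vec R X a) x"
      if "x \<in> X" for x
      using assms that by (subst free_vs_lincomb_basis) (auto simp: free_vs_carrier)
  qed
qed

lemma free_vs_induct [consumes 1, case_names zero basis add smult]:
  assumes "f \<in> carrier (free_vs R X)"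
    and zero: "P \<zero>\<^bsub>free_vs R X\<^esub>"
    and basis: "\<And>x. x \<in> X \<Longrightarrow> P (basis_vec R X x)"
    and add: "\<And>f g. f \<in> carrier (free_vs R X) \<Longrightarrow> g \<in> carrier (free_vs R X) \<Longrightarrow> P f \<Longrightarrow> P g
      \<Longrightarrow> P (f \<oplus>\<^bsub>free_vs R X\<^esub> g)"
    and smult: "\<And>c f. c \<in> carrier R \<Longrightarrow> f \<in> carrier (free_vs R X) \<Longrightarrow> P f
      \<Longrightarrow> P (c \<odot>\<^bsub>free_vs R X\<^esub> f)"
  shows "P f"
proof -
  interpret F: vectorspace R "free_vs R X"
    by (rule free_vs_vectorspace)
  have "P (\<Oplus>\<^bsub>free_vs R X\<^esub>a\<in>A. c a \<odot>\<^bsub>free_vs R X\<^esub> basis_vec R X a)"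
    if "finite A" "A \<subseteq> X" "c \<in> A \<rightarrow> carrier R" for A c
    using that
  proof (induction A)
    case empty
    then show ?case
      using zero by simp
  next
    case (insert a A)
    have "c a \<odot>\<^bsub>free_vs R X\<^esub> basis_vec R X a \<in> carrier (free_vs R X)"
      "(\<lambda>a. c a \<odot>\<^bsub>free_vs R X\<^esub> basis_vec R X a) \<in> A \<rightarrow> carrier (free_vs R X)"
      using insert.prems by (auto intro!: F.smult_closed basis_vec_closed)
    then show ?case
      using insert by (simp add: Pi_iff, intro add smult basis)
        (auto intro!: basis_vec_closed F.finsum_closed)
  qed
  from this[of "{x \<in> X. f x \<noteq> \<zero>}" f] show ?thesis
    using assms(1) free_vs_expand[OF assms(1)] by (auto simp: free_vs_carrier)
qed

lemma free_vs_span: "module.span R (free_vs R X) (basis_vec R X ` X) = carrier (free_vs R X)"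
proof -
  interpret F: vectorspace R "free_vs R X"
    by (rule free_vs_vectorspace)
  have sub: "basis_vec R X ` X \<subseteq> carrier (free_vs R X)"
    by (auto intro: basis_vec_closed)
  note N = F.subspaceD[OF F.span_subspace[OF sub]]
  have "f \<in> F.span (basis_vec R X ` X)" if "f \<in> carrier (free_vs R X)" for f
    using that by (induction rule: free_vs_induct) (use N F.in_own_span[OF sub] in auto)
  then show ?thesis
    using N(1) by blast
qed

lemma free_vs_indpt:
  assumes "Y \<subseteq> X"
  shows "\<not> module.lin_dep R (free_vs R X) (basis_vec R X ` Y)"
proof -
  interpret F: vectorspace R "free_vs R X"
    by (rule free_vs_vectorspace)
  show ?thesis
  proof
    assume "F.lin_dep (basis_vec R X ` Y)"
    then obtain A a v where A: "finite A" "A \<subseteq> basis_vec R X ` Y" "a \<in> A \<rightarrow> carrier R"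
      "F.lincomb a A = \<zero>\<^bsub>free_vs R X\<^esub>" "v \<in> A" "a v \<noteq> \<zero>"
      unfolding F.lin_dep_def by blast
    then obtain A' where A': "A' \<subseteq> Y" "finite A'" "A = basis_vec R X ` A'"
      by (meson finite_subset_image)
    have inj: "inj_on (basis_vec R X) A'"
      using A'(1) assms by (auto intro!: inj_onI dest: basis_vec_inj)
    obtain y where y: "y \<in> A'" "v = basis_vec R X y"
      using A(5) A'(3) by blast
    have "F.lincomb a A = (\<Oplus>\<^bsub>free_vs R X\<^esub>y\<in>A'. a (basis_vec R X y) \<odot>\<^bsub>free_vs R X\<^esub> basis_vec R X y)"
      unfolding F.lincomb_def A'(3) using A(3) A'(1,3) assms inj
      by (subst F.finsum_reindex) (auto intro!: F.smult_closed basis_vec_closed)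
    then have "(\<Oplus>\<^bsub>free_vs R X\<^esub>y\<in>A'. a (basis_vec R X y) \<odot>\<^bsub>free_vs R X\<^esub> basis_vec R X y) y = \<zero>"
      using A(4) A' y(1) assms by (auto simp: free_vs_zero)
    moreover have "(\<Oplus>\<^bsub>free_vs R X\<^esub>y\<in>A'. a (basis_vec R X y) \<odot>\<^bsub>free_vs R X\<^esub> basis_vec R X y) y = a v"
      using A(3) A' y assms by (subst free_vs_lincomb_basis) auto
    ultimately show False
      using A(6) by simp
  qed
qed

lemma free_vs_span_dim:
  assumes "Y \<subseteq> X" "finite Y"
  shows "vectorspace.dim R ((free_vs R X)\<lparr>carrier := module.span R (free_vs R X) (basis_vec R X ` Y)\<rparr>) = card Y"
    and "vectorspace.fin_dim R ((free_vs R X)\<lparr>carrier := module.span R (free_vs R X) (basis_vec R X ` Y)\<rparr>)"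
proof -
  interpret F: vectorspace R "free_vs R X"
    by (rule free_vs_vectorspace)
  let ?B = "basis_vec R X ` Y"
  have sub: "?B \<subseteq> carrier (free_vs R X)"
    using assms by (auto intro: basis_vec_closed)
  have sub': "?B \<subseteq> F.span ?B"
    by (rule F.in_own_span[OF sub])
  interpret N: vectorspace R "F.vs (F.span ?B)"
    by (rule F.subspace_is_vs[OF F.span_subspace[OF sub]])
  have "N.basis ?B"
    unfolding N.basis_def
    using F.span_li_not_depend[OF sub' F.span_is_submodule[OF sub]] free_vs_indpt[OF assms(1)] sub'
    by simp
  moreover have "inj_on (basis_vec R X) Y"
    using assms by (auto intro!: inj_onI dest: basis_vec_inj)
  ultimately show "N.dim = card Y"
    using N.dim_basis[of ?B] assms(2) by (simp add: card_image)
  show "N.fin_dim"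
    using F.fin_dim_span(1)[OF _ sub] assms(2) by simp
qed

lemma free_vs_dim:
  assumes "finite X"
  shows "vectorspace.dim R (free_vs R X) = card X" "vectorspace.fin_dim R (free_vs R X)"
  using free_vs_span_dim[of X X] assms by (simp_all add: free_vs_span)

end

context vectorspace
begin

text \<open>Two functions and their sum have different supports; additivity of
  \<open>free_ext\<close> becomes visible once all three sums run over one finite index set.\<close>

lemma free_ext_superset:
  assumes "f \<in> carrier (free_vs K X)" "g \<in> X \<rightarrow> carrier V"
    and "finite A" "{x \<in> X. f x \<noteq> \<zero>\<^bsub>K\<^esub>} \<subseteq> A" "A \<subseteq> X"
  shows "free_ext K V X g f = (\<Oplus>\<^bsub>V\<^esub>x\<in>A. f x \<odot>\<^bsub>V\<^esub> g x)"
  unfolding free_ext_def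
proof (rule M.add.finprod_mono_neutral_cong_left)
  fix i assume "i \<in> A - {x \<in> X. f x \<noteq> \<zero>\<^bsub>K\<^esub>}"
  then have "i \<in> X" "f i = \<zero>\<^bsub>K\<^esub>"
    using assms by auto
  then show "f i \<odot>\<^bsub>V\<^esub> g i = \<zero>\<^bsub>V\<^esub>"
    using assms(2) by (simp add: Pi_iff)
qed (use assms in \<open>auto simp: Pi_iff free_vs_carrier PiE_iff subset_iff\<close>)

lemma free_ext_closed:
  assumes "f \<in> carrier (free_vs K X)" "g \<in> X \<rightarrow> carrier V"
  shows "free_ext K V X g f \<in> carrier V"
  unfolding free_ext_def using assms by (auto intro!: M.finsum_closed simp: free_vs_carrier Pi_iff PiE_iff)

lemma free_ext_linear:
  assumes g: "g \<in> X \<rightarrow> carrier V"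
  shows "linear_map K (free_vs K X) V (free_ext K V X g)"
proof (rule linear_mapI)
  interpret F: vectorspace K "free_vs K X"
    by (rule free_vs_vectorspace)
  show "vectorspace K (free_vs K X)" "vectorspace K V"
    by (rule F.vectorspace_axioms vectorspace_axioms)+
  show "free_ext K V X g f \<in> carrier V" if "f \<in> carrier (free_vs K X)" for f
    using that g by (rule free_ext_closed)
  fix f h assume fh: "f \<in> carrier (free_vs K X)" "h \<in> carrier (free_vs K X)"
  let ?A = "{x \<in> X. f x \<noteq> \<zero>\<^bsub>K\<^esub>} \<union> {x \<in> X. h x \<noteq> \<zero>\<^bsub>K\<^esub>}"
  have fc: "f x \<in> carrier K" "h x \<in> carrier K" "g x \<in> carrier V" if "x \<in> X" for x
    using fh g that by (auto simp: free_vs_carrier)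
  have A: "finite ?A" "?A \<subseteq> X"
    using fh by (auto simp: free_vs_carrier)
  have "f \<oplus>\<^bsub>free_vs K X\<^esub> h \<in> carrier (free_vs K X)"
    using fh by simp
  then have "free_ext K V X g (f \<oplus>\<^bsub>free_vs K X\<^esub> h)
      = (\<Oplus>\<^bsub>V\<^esub>x\<in>?A. (f \<oplus>\<^bsub>free_vs K X\<^esub> h) x \<odot>\<^bsub>V\<^esub> g x)"
    using fc g A by (intro free_ext_superset) (assumption | auto simp: free_vs_add)+
  also have "\<dots> = (\<Oplus>\<^bsub>V\<^esub>x\<in>?A. f x \<odot>\<^bsub>V\<^esub> g x \<oplus>\<^bsub>V\<^esub> h x \<odot>\<^bsub>V\<^esub> g x)"
    using fc by (intro M.finsum_cong') (auto simp: free_vs_add smult_l_distr)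
  also have "\<dots> = (\<Oplus>\<^bsub>V\<^esub>x\<in>?A. f x \<odot>\<^bsub>V\<^esub> g x) \<oplus>\<^bsub>V\<^esub> (\<Oplus>\<^bsub>V\<^esub>x\<in>?A. h x \<odot>\<^bsub>V\<^esub> g x)"
    using fc by (intro M.finsum_addf) auto
  also have "(\<Oplus>\<^bsub>V\<^esub>x\<in>?A. f x \<odot>\<^bsub>V\<^esub> g x) = free_ext K V X g f"
    using fh g A by (intro free_ext_superset[symmetric]) auto
  also have "(\<Oplus>\<^bsub>V\<^esub>x\<in>?A. h x \<odot>\<^bsub>V\<^esub> g x) = free_ext K V X g h"
    using fh g A by (intro free_ext_superset[symmetric]) auto
  finally show "free_ext K V X g (f \<oplus>\<^bsub>free_vs K X\<^esub> h) = free_ext K V X g f \<oplus>\<^bsub>V\<^esub> free_ext K V X g h" .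
next
  interpret F: vectorspace K "free_vs K X"
    by (rule free_vs_vectorspace)
  fix c f assume c: "c \<in> carrier K" and f: "f \<in> carrier (free_vs K X)"
  let ?A = "{x \<in> X. f x \<noteq> \<zero>\<^bsub>K\<^esub>}"
  have fc: "f x \<in> carrier K" "g x \<in> carrier V" if "x \<in> X" for x
    using f g that by (auto simp: free_vs_carrier)
  have A: "finite ?A"
    using f by (auto simp: free_vs_carrier)
  have "c \<odot>\<^bsub>free_vs K X\<^esub> f \<in> carrier (free_vs K X)"
    using f c by simp
  then have "free_ext K V X g (c \<odot>\<^bsub>free_vs K X\<^esub> f) = (\<Oplus>\<^bsub>V\<^esub>x\<in>?A. (c \<odot>\<^bsub>free_vs K X\<^esub> f) x \<odot>\<^bsub>V\<^esub> g x)"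
    using c fc g A by (intro free_ext_superset) (assumption | auto simp: free_vs_smult)+
  also have "\<dots> = (\<Oplus>\<^bsub>V\<^esub>x\<in>?A. c \<odot>\<^bsub>V\<^esub> (f x \<odot>\<^bsub>V\<^esub> g x))"
    using fc c by (intro M.finsum_cong') (auto simp: free_vs_smult smult_assoc1)
  also have "\<dots> = c \<odot>\<^bsub>V\<^esub> free_ext K V X g f"
    unfolding free_ext_def using fc c A by (intro finsum_smult_ldistr[symmetric]) auto
  finally show "free_ext K V X g (c \<odot>\<^bsub>free_vs K X\<^esub> f) = c \<odot>\<^bsub>V\<^esub> free_ext K V X g f" .
qed

lemma free_ext_basis_vec:
  assumes "g \<in> X \<rightarrow> carrier V" "x \<in> X"
  shows "free_ext K V X g (basis_vec K X x) = g x"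
proof -
  have "free_ext K V X g (basis_vec K X x) = (\<Oplus>\<^bsub>V\<^esub>y\<in>{x}. basis_vec K X x y \<odot>\<^bsub>V\<^esub> g y)"
    using assms by (intro free_ext_superset basis_vec_closed) (auto simp: basis_vec_def)
  also have "\<dots> = g x"
    using assms by (simp add: basis_vec_apply Pi_iff)
  finally show ?thesis .
qed

text \<open>Injectivity is the independence of \<open>B\<close>, surjectivity is that
  \<open>B\<close> spans.\<close>

lemma free_ext_id_bij:
  assumes "basis B"
  shows "bij_betw (free_ext K V B (\<lambda>b. b)) (carrier (free_vs K B)) (carrier V)"
proof -
  have B: "lin_indpt B" "span B = carrier V" "B \<subseteq> carrier V"
    using assms by (auto simp: basis_def)
  interpret L: linear_map K "free_vs K B" V "free_ext K V B (\<lambda>b. b)"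
    using B by (intro free_ext_linear) auto
  have "inj_on (free_ext K V B (\<lambda>b. b)) (carrier (free_vs K B))"
  proof (rule L.inj_onI_kernel)
    fix f assume f: "f \<in> carrier (free_vs K B)" "free_ext K V B (\<lambda>b. b) f = \<zero>\<^bsub>V\<^esub>"
    let ?A = "{b \<in> B. f b \<noteq> \<zero>\<^bsub>K\<^esub>}"
    have "lincomb f ?A = \<zero>\<^bsub>V\<^esub>"
      using f(2) by (simp add: lincomb_def free_ext_def)
    then have "f \<in> ?A \<rightarrow> {\<zero>\<^bsub>K\<^esub>}"
      using f(1) by (intro not_lindepD[OF B(1)]) (auto simp: free_vs_carrier)
    then have "f b = \<zero>\<^bsub>K\<^esub>" if "b \<in> B" for b
      using that by auto
    then show "f = \<zero>\<^bsub>free_vs K B\<^esub>"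
      by (intro free_vs_ext[OF f(1) L.V.module.M.zero_closed]) (auto simp: free_vs_zero)
  qed
  moreover have "carrier V \<subseteq> free_ext K V B (\<lambda>b. b) ` carrier (free_vs K B)"
  proof -
    have "subspace K (free_ext K V B (\<lambda>b. b) ` carrier (free_vs K B)) V"
      by (intro L.image_subspace L.V.subspace_carrier)
    moreover have "B \<subseteq> free_ext K V B (\<lambda>b. b) ` carrier (free_vs K B)"
    proof
      fix b assume "b \<in> B"
      then have "b = free_ext K V B (\<lambda>b. b) (basis_vec K B b)"
        using B(3) by (subst free_ext_basis_vec) auto
      then show "b \<in> free_ext K V B (\<lambda>b. b) ` carrier (free_vs K B)"
        using \<open>b \<in> B\<close> by (intro image_eqI) (auto intro: basis_vec_closed)
    qed
    ultimately show ?thesis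
      using span_minimal B(2) by blast
  qed
  ultimately show ?thesis
    by (auto simp: bij_betw_def)
qed

text \<open>Coordinates with respect to \<open>B\<close>, obtained by inverting the evaluation of
  linear combinations; this covers infinite bases as well.\<close>

definition coords :: "'c set \<Rightarrow> 'c \<Rightarrow> 'c \<Rightarrow> 'a" where
  "coords B = inv_into (carrier (free_vs K B)) (free_ext K V B (\<lambda>b. b))"

lemma coords_linear:
  assumes "basis B"
  shows "linear_map K V (free_vs K B) (coords B)"
    and "bij_betw (coords B) (carrier V) (carrier (free_vs K B))"
    and "b \<in> B \<Longrightarrow> coords B b = basis_vec K B b"
    and "v \<in> carrier V \<Longrightarrow> free_ext K V B (\<lambda>b. b) (coords B v) = v"
proof -
  have B: "(\<lambda>b. b) \<in> B \<rightarrow> carrier V"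
    using assms by (auto simp: basis_def)
  interpret L: linear_map K "free_vs K B" V "free_ext K V B (\<lambda>b. b)"
    using B by (rule free_ext_linear)
  note bij = free_ext_id_bij[OF assms]
  show "linear_map K V (free_vs K B) (coords B)"
    unfolding coords_def by (rule L.inv_linear[OF bij])
  show "bij_betw (coords B) (carrier V) (carrier (free_vs K B))"
    unfolding coords_def by (rule bij_betw_inv_into[OF bij])
  show "coords B b = basis_vec K B b" if "b \<in> B"
  proof -
    have "inv_into (carrier (free_vs K B)) (free_ext K V B (\<lambda>b. b))
        (free_ext K V B (\<lambda>b. b) (basis_vec K B b)) = basis_vec K B b"
      using bij that by (intro inv_into_f_f) (auto simp: bij_betw_def intro: basis_vec_closed)
    then show ?thesis
      using that B by (simp add: coords_def free_ext_basis_vec)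
  qed
  show "free_ext K V B (\<lambda>b. b) (coords B v) = v" if "v \<in> carrier V"
    using bij that f_inv_into_f[of v "free_ext K V B (\<lambda>b. b)" "carrier (free_vs K B)"]
    by (simp add: coords_def bij_betw_def)
qed

lemma linear_eq_on_span:
  assumes "linear_map K V W S" "linear_map K V W T" "B \<subseteq> carrier V" "\<And>b. b \<in> B \<Longrightarrow> S b = T b"
    and "v \<in> span B"
  shows "S v = T v"
proof -
  interpret S: linear_map K V W S by fact
  interpret T: linear_map K V W T by fact
  have "subspace K {v \<in> carrier V. S v = T v} V"
    by (rule subspaceI) auto
  then show ?thesis
    using span_minimal[of "{v \<in> carrier V. S v = T v}" B] assms(3-5) by blast
qed

end

subsection \<open>Quotients\<close>

context vectorspace
begin

lemma quot_carrier: "carrier (quot_mod V N) = (\<lambda>x. N +>\<^bsub>V\<^esub> x) ` carrier V"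
  by (auto simp: quot_mod_def FactRing_def A_RCOSETS_def' ring.defs module.defs)

lemma quot_zero: "\<zero>\<^bsub>quot_mod V N\<^esub> = N"
  by (simp add: quot_mod_def FactRing_def ring.defs module.defs)

lemma a_r_coset_mem: "y \<in> N +>\<^bsub>V\<^esub> x \<longleftrightarrow> (\<exists>n\<in>N. y = n \<oplus>\<^bsub>V\<^esub> x)"
  by (auto simp: a_r_coset_def')

context
  fixes N
  assumes N: "subspace K N V"
begin

lemma coset_eq_iff:
  assumes "x \<in> carrier V" "y \<in> carrier V"
  shows "N +>\<^bsub>V\<^esub> x = N +>\<^bsub>V\<^esub> y \<longleftrightarrow> x \<ominus>\<^bsub>V\<^esub> y \<in> N"
proof
  note D = subspaceD[OF N]
  assume "N +>\<^bsub>V\<^esub> x = N +>\<^bsub>V\<^esub> y"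
  moreover have "x \<in> N +>\<^bsub>V\<^esub> x"
    using D(2) assms by (auto simp: a_r_coset_mem intro!: bexI[of _ "\<zero>\<^bsub>V\<^esub>"])
  ultimately obtain n where n: "n \<in> N" "x = n \<oplus>\<^bsub>V\<^esub> y"
    by (auto simp: a_r_coset_mem)
  then have "n \<in> carrier V"
    using D(1) by blast
  then have "x \<ominus>\<^bsub>V\<^esub> y = n"
    using n(2) assms by (simp add: a_minus_def M.a_assoc M.r_neg)
  then show "x \<ominus>\<^bsub>V\<^esub> y \<in> N"
    using n(1) by simp
next
  note D = subspaceD[OF N]
  have sub: "N +>\<^bsub>V\<^esub> x \<subseteq> N +>\<^bsub>V\<^esub> y" if "x \<ominus>\<^bsub>V\<^esub> y \<in> N" "x \<in> carrier V" "y \<in> carrier V" for x y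
  proof
    fix z assume "z \<in> N +>\<^bsub>V\<^esub> x"
    then obtain n where n: "n \<in> N" "z = n \<oplus>\<^bsub>V\<^esub> x"
      by (auto simp: a_r_coset_mem)
    then have nc: "n \<in> carrier V"
      using D(1) by blast
    have "z = (n \<oplus>\<^bsub>V\<^esub> (x \<ominus>\<^bsub>V\<^esub> y)) \<oplus>\<^bsub>V\<^esub> y"
      using n(2) nc that by (simp add: a_minus_def M.a_assoc M.l_neg)
    then show "z \<in> N +>\<^bsub>V\<^esub> y"
      using D(3)[OF n(1) that(1)] by (auto simp: a_r_coset_mem)
  qed
  assume xy: "x \<ominus>\<^bsub>V\<^esub> y \<in> N"
  then have "\<ominus>\<^bsub>V\<^esub> (x \<ominus>\<^bsub>V\<^esub> y) \<in> N"
    using D(5)[OF D(2) xy] assms by (simp add: a_minus_def)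
  moreover have "\<ominus>\<^bsub>V\<^esub> (x \<ominus>\<^bsub>V\<^esub> y) = y \<ominus>\<^bsub>V\<^esub> x"
    using assms by (simp add: a_minus_def M.minus_add M.a_comm)
  ultimately show "N +>\<^bsub>V\<^esub> x = N +>\<^bsub>V\<^esub> y"
    using sub xy assms by (metis subset_antisym)
qed

lemma coset_zero: "N +>\<^bsub>V\<^esub> \<zero>\<^bsub>V\<^esub> = N"
proof -
  have "n \<oplus>\<^bsub>V\<^esub> \<zero>\<^bsub>V\<^esub> = n" if "n \<in> N" for n
    using that subspaceD(1)[OF N] by (metis M.r_zero subsetD)
  then show ?thesis
    by (auto simp: a_r_coset_mem)
qed

lemma coset_eq_zero_iff: "x \<in> carrier V \<Longrightarrow> N +>\<^bsub>V\<^esub> x = N \<longleftrightarrow> x \<in> N"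
  using coset_eq_iff[of x "\<zero>\<^bsub>V\<^esub>"] coset_zero M.minus_equality[of "\<zero>\<^bsub>V\<^esub>" "\<zero>\<^bsub>V\<^esub>"]
  by (simp add: a_minus_def)

lemma quot_add:
  assumes "x \<in> carrier V" "y \<in> carrier V"
  shows "(N +>\<^bsub>V\<^esub> x) \<oplus>\<^bsub>quot_mod V N\<^esub> (N +>\<^bsub>V\<^esub> y) = N +>\<^bsub>V\<^esub> (x \<oplus>\<^bsub>V\<^esub> y)"
proof -
  note D = subspaceD[OF N]
  have e: "(n \<oplus>\<^bsub>V\<^esub> x) \<oplus>\<^bsub>V\<^esub> (m \<oplus>\<^bsub>V\<^esub> y) = (n \<oplus>\<^bsub>V\<^esub> m) \<oplus>\<^bsub>V\<^esub> (x \<oplus>\<^bsub>V\<^esub> y)" if "n \<in> N" "m \<in> N" for n m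
    using that D(1) assms by (simp add: subset_iff M.a_ac)
  have "(N +>\<^bsub>V\<^esub> x) <+>\<^bsub>V\<^esub> (N +>\<^bsub>V\<^esub> y) = N +>\<^bsub>V\<^esub> (x \<oplus>\<^bsub>V\<^esub> y)"
  proof
    show "(N +>\<^bsub>V\<^esub> x) <+>\<^bsub>V\<^esub> (N +>\<^bsub>V\<^esub> y) \<subseteq> N +>\<^bsub>V\<^esub> (x \<oplus>\<^bsub>V\<^esub> y)"
      using D(3) e by (fastforce simp: a_r_coset_def' set_add_def')
    show "N +>\<^bsub>V\<^esub> (x \<oplus>\<^bsub>V\<^esub> y) \<subseteq> (N +>\<^bsub>V\<^esub> x) <+>\<^bsub>V\<^esub> (N +>\<^bsub>V\<^esub> y)"
    proof
      fix z assume "z \<in> N +>\<^bsub>V\<^esub> (x \<oplus>\<^bsub>V\<^esub> y)"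
      then obtain n where n: "n \<in> N" "z = n \<oplus>\<^bsub>V\<^esub> (x \<oplus>\<^bsub>V\<^esub> y)"
        by (auto simp: a_r_coset_mem)
      then have "n \<in> carrier V"
        using D(1) by blast
      then have "z = (n \<oplus>\<^bsub>V\<^esub> x) \<oplus>\<^bsub>V\<^esub> (\<zero>\<^bsub>V\<^esub> \<oplus>\<^bsub>V\<^esub> y)"
        using n(2) assms by (simp add: M.a_assoc)
      then show "z \<in> (N +>\<^bsub>V\<^esub> x) <+>\<^bsub>V\<^esub> (N +>\<^bsub>V\<^esub> y)"
        using n(1) D(2) by (auto simp: a_r_coset_def' set_add_def')
    qed
  qed
  then show ?thesis
    by (simp add: quot_mod_def FactRing_def ring.defs module.defs)
qed

lemma quot_smult:
  assumes "c \<in> carrier K" "x \<in> carrier V"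
  shows "c \<odot>\<^bsub>quot_mod V N\<^esub> (N +>\<^bsub>V\<^esub> x) = N +>\<^bsub>V\<^esub> (c \<odot>\<^bsub>V\<^esub> x)"
proof -
  note D = subspaceD[OF N]
  have "N +>\<^bsub>V\<^esub> (c \<odot>\<^bsub>V\<^esub> y) = N +>\<^bsub>V\<^esub> (c \<odot>\<^bsub>V\<^esub> x)" if y: "y \<in> N +>\<^bsub>V\<^esub> x" for y
  proof -
    obtain n where n: "n \<in> N" "y = n \<oplus>\<^bsub>V\<^esub> x"
      using y by (auto simp: a_r_coset_mem)
    then have nc: "n \<in> carrier V"
      using D(1) by blast
    have "c \<odot>\<^bsub>V\<^esub> y \<ominus>\<^bsub>V\<^esub> c \<odot>\<^bsub>V\<^esub> x = c \<odot>\<^bsub>V\<^esub> n"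
      using n(2) nc assms by (simp add: smult_r_distr a_minus_def M.a_assoc M.r_neg)
    then show ?thesis
      using n nc assms D(4)[OF assms(1) n(1)] by (subst coset_eq_iff) auto
  qed
  moreover have "x \<in> N +>\<^bsub>V\<^esub> x"
    using D(2) assms by (auto simp: a_r_coset_mem intro!: bexI[of _ "\<zero>\<^bsub>V\<^esub>"])
  ultimately have "(\<Union>y\<in>N +>\<^bsub>V\<^esub> x. N +>\<^bsub>V\<^esub> (c \<odot>\<^bsub>V\<^esub> y)) = N +>\<^bsub>V\<^esub> (c \<odot>\<^bsub>V\<^esub> x)"
    by blast
  then show ?thesis
    by (simp add: quot_mod_def FactRing_def ring.defs module.defs)
qed

lemma quot_vectorspace: "vectorspace K (quot_mod V N)"
proof (rule vs_criteria)
  let ?Q = "quot_mod V N"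
  have q: "\<exists>x\<in>carrier V. X = N +>\<^bsub>V\<^esub> x" if "X \<in> carrier ?Q" for X
    using that by (auto simp: quot_carrier)
  have qc: "N +>\<^bsub>V\<^esub> x \<in> carrier ?Q" if "x \<in> carrier V" for x
    using that by (auto simp: quot_carrier)
  show "field K"
    by (rule field_axioms)
  show "\<zero>\<^bsub>?Q\<^esub> \<in> carrier ?Q"
    using qc[of "\<zero>\<^bsub>V\<^esub>"] by (simp add: coset_zero quot_zero)
  show "\<forall>v w. v \<in> carrier ?Q \<and> w \<in> carrier ?Q \<longrightarrow> v \<oplus>\<^bsub>?Q\<^esub> w \<in> carrier ?Q"
    by (auto simp: quot_carrier quot_add intro!: imageI)
  show "\<forall>v\<in>carrier ?Q. \<exists>neg_v\<in>carrier ?Q. v \<oplus>\<^bsub>?Q\<^esub> neg_v = \<zero>\<^bsub>?Q\<^esub>"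
  proof
    fix X assume "X \<in> carrier ?Q"
    then obtain x where x: "x \<in> carrier V" "X = N +>\<^bsub>V\<^esub> x"
      using q by blast
    then have "X \<oplus>\<^bsub>?Q\<^esub> (N +>\<^bsub>V\<^esub> (\<ominus>\<^bsub>V\<^esub> x)) = \<zero>\<^bsub>?Q\<^esub>"
      by (simp add: quot_add M.r_neg coset_zero quot_zero)
    then show "\<exists>neg_v\<in>carrier ?Q. X \<oplus>\<^bsub>?Q\<^esub> neg_v = \<zero>\<^bsub>?Q\<^esub>"
      using qc x by blast
  qed
  show "\<forall>c v. c \<in> carrier K \<and> v \<in> carrier ?Q \<longrightarrow> c \<odot>\<^bsub>?Q\<^esub> v \<in> carrier ?Q"
    by (auto simp: quot_carrier quot_smult intro!: imageI)
  show "\<forall>v w. v \<in> carrier ?Q \<and> w \<in> carrier ?Q \<longrightarrow> v \<oplus>\<^bsub>?Q\<^esub> w = w \<oplus>\<^bsub>?Q\<^esub> v"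
    by (auto simp: quot_carrier quot_add M.a_comm)
  show "\<forall>v w x. v \<in> carrier ?Q \<and> w \<in> carrier ?Q \<and> x \<in> carrier ?Q \<longrightarrow>
      v \<oplus>\<^bsub>?Q\<^esub> w \<oplus>\<^bsub>?Q\<^esub> x = v \<oplus>\<^bsub>?Q\<^esub> (w \<oplus>\<^bsub>?Q\<^esub> x)"
    by (auto simp: quot_carrier quot_add M.a_assoc)
  show "\<forall>v\<in>carrier ?Q. v \<oplus>\<^bsub>?Q\<^esub> \<zero>\<^bsub>?Q\<^esub> = v"
  proof
    fix X assume "X \<in> carrier ?Q"
    then obtain x where x: "x \<in> carrier V" "X = N +>\<^bsub>V\<^esub> x"
      using q by blast
    then show "X \<oplus>\<^bsub>?Q\<^esub> \<zero>\<^bsub>?Q\<^esub> = X"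
      using quot_add[of x "\<zero>\<^bsub>V\<^esub>"] by (simp add: coset_zero quot_zero)
  qed
  show "\<forall>a b v. a \<in> carrier K \<and> b \<in> carrier K \<and> v \<in> carrier ?Q \<longrightarrow>
      a \<otimes>\<^bsub>K\<^esub> b \<odot>\<^bsub>?Q\<^esub> v = a \<odot>\<^bsub>?Q\<^esub> (b \<odot>\<^bsub>?Q\<^esub> v)"
    by (auto simp: quot_carrier quot_smult smult_assoc1)
  show "\<forall>v\<in>carrier ?Q. \<one>\<^bsub>K\<^esub> \<odot>\<^bsub>?Q\<^esub> v = v"
    by (auto simp: quot_carrier quot_smult)
  show "\<forall>a b v. a \<in> carrier K \<and> b \<in> carrier K \<and> v \<in> carrier ?Q \<longrightarrow>
      (a \<oplus>\<^bsub>K\<^esub> b) \<odot>\<^bsub>?Q\<^esub> v = a \<odot>\<^bsub>?Q\<^esub> v \<oplus>\<^bsub>?Q\<^esub> b \<odot>\<^bsub>?Q\<^esub> v"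
    by (auto simp: quot_carrier quot_smult quot_add smult_l_distr)
  show "\<forall>a v w. a \<in> carrier K \<and> v \<in> carrier ?Q \<and> w \<in> carrier ?Q \<longrightarrow>
      a \<odot>\<^bsub>?Q\<^esub> (v \<oplus>\<^bsub>?Q\<^esub> w) = a \<odot>\<^bsub>?Q\<^esub> v \<oplus>\<^bsub>?Q\<^esub> a \<odot>\<^bsub>?Q\<^esub> w"
    by (auto simp: quot_carrier quot_smult quot_add smult_r_distr)
qed

lemma quot_proj_linear: "linear_map K V (quot_mod V N) (\<lambda>x. N +>\<^bsub>V\<^esub> x)"
  by (rule linear_mapI) (auto simp: vectorspace_axioms quot_vectorspace quot_carrier quot_add quot_smult)

text \<open>Identifies a quotient given by relations without describing \<open>N\<close>:
  \<open>T\<close> kills the relations, \<open>S\<close> goes back, and the composite is the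
  projection, which need only be checked on generators. If \<open>S u\<close> is zero, a preimage of
  \<open>u\<close> under \<open>T\<close> lies in \<open>N\<close>, so \<open>T\<close> sends it to
  zero.\<close>

lemma quot_bij:
  assumes T: "linear_map K V U T" "T ` carrier V = carrier U" "\<And>v. v \<in> N \<Longrightarrow> T v = \<zero>\<^bsub>U\<^esub>"
    and S: "linear_map K U (quot_mod V N) S"
    and X: "X \<subseteq> carrier V" "span X = carrier V" "\<And>x. x \<in> X \<Longrightarrow> N +>\<^bsub>V\<^esub> x = S (T x)"
  shows "bij_betw S (carrier U) (carrier (quot_mod V N))"
proof -
  interpret T: linear_map K V U T by fact
  interpret S: linear_map K U "quot_mod V N" S by fact
  have q: "N +>\<^bsub>V\<^esub> v = S (T v)" if "v \<in> carrier V" for v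
    by (rule linear_eq_on_span[OF quot_proj_linear linear_map_compose[OF T(1) S] X(1,3)])
      (simp_all add: that X(2))
  have "S ` carrier U = carrier (quot_mod V N)"
    unfolding quot_carrier T(2)[symmetric] using q by (auto simp: image_image)
  moreover have "inj_on S (carrier U)"
  proof (rule S.inj_onI_kernel)
    fix u assume u: "u \<in> carrier U" "S u = \<zero>\<^bsub>quot_mod V N\<^esub>"
    then obtain v where v: "v \<in> carrier V" "u = T v"
      using T(2) by blast
    then have "v \<in> N"
      using u(2) q[OF v(1)] by (simp add: quot_zero coset_eq_zero_iff)
    then show "u = \<zero>\<^bsub>U\<^esub>"
      using T(3) v(2) by simp
  qed
  ultimately show ?thesis
    by (simp add: bij_betw_def)
qed

end

end

subsection \<open>Duals, direct sums and tensor products with a line\<close>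

text \<open>The field as a one-dimensional space over itself, so that functionals become linear maps
  between \<open>module\<close> records.\<close>

definition self_mod :: "('k, 'm) ring_scheme \<Rightarrow> ('k, 'k) module" where
  "self_mod K = \<lparr>carrier = carrier K, mult = mult K, one = \<one>\<^bsub>K\<^esub>, zero = \<zero>\<^bsub>K\<^esub>, add = add K, smult = mult K\<rparr>"

lemma self_mod_simps [simp]:
  "carrier (self_mod K) = carrier K" "\<zero>\<^bsub>self_mod K\<^esub> = \<zero>\<^bsub>K\<^esub>" "x \<oplus>\<^bsub>self_mod K\<^esub> y = x \<oplus>\<^bsub>K\<^esub> y"
  "x \<odot>\<^bsub>self_mod K\<^esub> y = x \<otimes>\<^bsub>K\<^esub> y"
  by (simp_all add: self_mod_def)

lemma (in field) self_mod_vectorspace: "vectorspace R (self_mod R)"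
proof -
  have "\<exists>y\<in>carrier R. x \<oplus> y = \<zero>" if "x \<in> carrier R" for x
    using that r_neg by blast
  then show ?thesis
    by (intro vs_criteria field_axioms) (auto simp: a_ac m_ac l_distr r_distr)
qed

context vectorspace
begin

lemma dual_simps:
  "carrier (dual_vs K V) = {f \<in> carrier V \<rightarrow>\<^sub>E carrier K.
      (\<forall>u\<in>carrier V. \<forall>v\<in>carrier V. f (u \<oplus>\<^bsub>V\<^esub> v) = f u \<oplus>\<^bsub>K\<^esub> f v) \<and>
      (\<forall>c\<in>carrier K. \<forall>v\<in>carrier V. f (c \<odot>\<^bsub>V\<^esub> v) = c \<otimes>\<^bsub>K\<^esub> f v)}"
  "\<zero>\<^bsub>dual_vs K V\<^esub> = (\<lambda>v\<in>carrier V. \<zero>\<^bsub>K\<^esub>)"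
  "f \<oplus>\<^bsub>dual_vs K V\<^esub> g = (\<lambda>v\<in>carrier V. f v \<oplus>\<^bsub>K\<^esub> g v)"
  "c \<odot>\<^bsub>dual_vs K V\<^esub> f = (\<lambda>v\<in>carrier V. c \<otimes>\<^bsub>K\<^esub> f v)"
  by (simp_all add: dual_vs_def R.func_space_def)

lemma dual_vectorspace: "vectorspace K (dual_vs K V)"
proof -
  interpret F: vectorspace K "R.func_space (carrier V)"
    by (rule func_space_is_vs)
  have "subspace K {f \<in> carrier V \<rightarrow>\<^sub>E carrier K.
      (\<forall>u\<in>carrier V. \<forall>v\<in>carrier V. f (u \<oplus>\<^bsub>V\<^esub> v) = f u \<oplus>\<^bsub>K\<^esub> f v) \<and>
      (\<forall>c\<in>carrier K. \<forall>v\<in>carrier V. f (c \<odot>\<^bsub>V\<^esub> v) = c \<otimes>\<^bsub>K\<^esub> f v)} (R.func_space (carrier V))"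
    by (rule F.subspaceI)
      (auto simp: R.func_space_def PiE_iff R.a_ac R.m_ac R.r_distr intro: extensional_arb)
  then show ?thesis
    unfolding dual_vs_def by (rule F.subspace_is_vs)
qed

text \<open>A functional is determined by its values on a finite basis, and these are arbitrary.
  Restriction to \<open>B\<close> therefore identifies the dual with the free space on
  \<open>B\<close>, where finiteness of \<open>B\<close> makes every function finitely
  supported.\<close>

lemma dual_dim:
  assumes "fin_dim"
  shows "vectorspace.fin_dim K (dual_vs K V)" "vectorspace.dim K (dual_vs K V) = dim"
proof -
  obtain B where B: "finite B" "basis B"
    using finite_basis_exists[OF assms] by blast
  then have Bc: "B \<subseteq> carrier V" "span B = carrier V"
    by (auto simp: basis_def)
  interpret S: vectorspace K "self_mod K"
    by (rule self_mod_vectorspace)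
  interpret D: vectorspace K "dual_vs K V"
    by (rule dual_vectorspace)
  interpret F: vectorspace K "free_vs K B"
    by (rule free_vs_vectorspace)
  have lin: "linear_map K V (self_mod K) f" if "f \<in> carrier (dual_vs K V)" for f
    using that by (intro linear_mapI vectorspace_axioms S.vectorspace_axioms) (auto simp: dual_simps)
  have r: "linear_map K (dual_vs K V) (free_vs K B) (\<lambda>f. restrict f B)"
    using B(1) Bc(1)
    by (intro linear_mapI D.vectorspace_axioms F.vectorspace_axioms)
      (auto simp: dual_simps free_vs_carrier free_vs_add free_vs_smult fun_eq_iff subset_iff)
  have "inj_on (\<lambda>f. restrict f B) (carrier (dual_vs K V))"
  proof (rule inj_onI)
    fix f g assume fg: "f \<in> carrier (dual_vs K V)" "g \<in> carrier (dual_vs K V)"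
      "restrict f B = restrict g B"
    then have "f b = g b" if "b \<in> B" for b
      using that by (metis restrict_apply')
    then have "f v = g v" if "v \<in> carrier V" for v
      using linear_eq_on_span[OF lin[OF fg(1)] lin[OF fg(2)] Bc(1)] that Bc(2) by blast
    then show "f = g"
      using fg(1,2) by (intro PiE_ext[of f "carrier V" "\<lambda>_. carrier K" g]) (auto simp: dual_simps)
  qed
  moreover have "(\<lambda>f. restrict f B) ` carrier (dual_vs K V) = carrier (free_vs K B)"
  proof
    interpret r: linear_map K "dual_vs K V" "free_vs K B" "\<lambda>f. restrict f B"
      by (rule r)
    show "(\<lambda>f. restrict f B) ` carrier (dual_vs K V) \<subseteq> carrier (free_vs K B)"
      by auto
    show "carrier (free_vs K B) \<subseteq> (\<lambda>f. restrict f B) ` carrier (dual_vs K V)"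
    proof
      fix c assume c: "c \<in> carrier (free_vs K B)"
      then have c': "c \<in> B \<rightarrow> carrier (self_mod K)"
        by (auto simp: free_vs_carrier)
      interpret L: linear_map K V "self_mod K" "\<lambda>v. free_ext K (self_mod K) B c (coords B v)"
        by (rule linear_map_compose[OF coords_linear(1)[OF B(2)] S.free_ext_linear[OF c']])
      let ?f = "\<lambda>v\<in>carrier V. free_ext K (self_mod K) B c (coords B v)"
      have "?f \<in> carrier (dual_vs K V)"
        using L.T_im L.T_add L.T_smult by (auto simp: dual_simps)
      moreover have "restrict ?f B = c"
      proof (rule free_vs_ext[OF _ c])
        show "restrict ?f B \<in> carrier (free_vs K B)"
          using \<open>?f \<in> carrier (dual_vs K V)\<close> by (rule r.T_im)
        show "restrict ?f B b = c b" if "b \<in> B" for b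
          using that Bc(1) coords_linear(3)[OF B(2) that] S.free_ext_basis_vec[OF c' that] by auto
      qed
      ultimately show "c \<in> (\<lambda>f. restrict f B) ` carrier (dual_vs K V)"
        by (metis image_eqI)
    qed
  qed
  ultimately have bij: "bij_betw (\<lambda>f. restrict f B) (carrier (dual_vs K V)) (carrier (free_vs K B))"
    by (simp add: bij_betw_def)
  note fd = linear_map.bij_fin_dim'[OF r bij free_vs_dim(2)[OF B(1)]]
  show "D.fin_dim" "D.dim = dim"
    using fd dim_basis[OF B] free_vs_dim(1)[OF B(1)] by auto
qed

lemma line_coordinate:
  assumes "fin_dim" "dim = 1"
  obtains l h where "l \<in> carrier V" "linear_map K V (self_mod K) h" "h l = \<one>\<^bsub>K\<^esub>"
    "\<And>v. v \<in> carrier V \<Longrightarrow> v = h v \<odot>\<^bsub>V\<^esub> l"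
proof -
  obtain B where B: "finite B" "basis B"
    using finite_basis_exists[OF assms(1)] by blast
  then have "card B = 1"
    using dim_basis assms(2) by simp
  then obtain l where l: "B = {l}"
    by (auto simp: card_1_singleton_iff)
  have lc: "l \<in> carrier V"
    using B(2) l by (auto simp: basis_def)
  interpret S: vectorspace K "self_mod K"
    by (rule self_mod_vectorspace)
  note C = coords_linear[OF B(2), unfolded l]
  interpret C: linear_map K V "free_vs K {l}" "coords {l}"
    by (rule C(1))
  show thesis
  proof
    show "l \<in> carrier V"
      by fact
    show "linear_map K V (self_mod K) (\<lambda>v. coords {l} v l)"
      by (rule linear_mapI)
        (auto simp: vectorspace_axioms S.vectorspace_axioms free_vs_add free_vs_smult
          intro: free_vs_apply_closed)
    show "coords {l} l l = \<one>\<^bsub>K\<^esub>"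
      using C(3)[of l] by (simp add: basis_vec_apply)
    fix v assume v: "v \<in> carrier V"
    then have "free_ext K V {l} (\<lambda>b. b) (coords {l} v) = (\<Oplus>\<^bsub>V\<^esub>x\<in>{l}. coords {l} v x \<odot>\<^bsub>V\<^esub> x)"
      using lc by (intro free_ext_superset) auto
    also have "\<dots> = coords {l} v l \<odot>\<^bsub>V\<^esub> l"
      using lc free_vs_apply_closed[OF C.T_im[OF v], of l] by simp
    finally show "v = coords {l} v l \<odot>\<^bsub>V\<^esub> l"
      using C(4)[OF v] by simp
  qed
qed

end

lemma direct_sum_vectorspace:
  assumes "field K" "\<And>i. i \<in> J \<Longrightarrow> vectorspace K (V i)" "finite J"
  shows "vectorspace K (direct_sum_vs J V)"
proof -
  let ?D = "direct_sum_vs J V"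
  have g: "abelian_group (V i)" "module K (V i)" if "i \<in> J" for i
    using assms(2)[OF that] by (auto simp: vectorspace_def module_def)
  have c: "carrier ?D = (\<Pi>\<^sub>E i\<in>J. carrier (V i))"
    using assms(3) by (auto simp: direct_sum_vs_def)
  have "\<exists>f\<in>carrier ?D. v \<oplus>\<^bsub>?D\<^esub> f = \<zero>\<^bsub>?D\<^esub>" if v: "v \<in> carrier ?D" for v
  proof
    show "(\<lambda>i\<in>J. \<ominus>\<^bsub>V i\<^esub> v i) \<in> carrier ?D"
      using v g by (auto simp: c intro!: abelian_group.a_inv_closed)
    show "v \<oplus>\<^bsub>?D\<^esub> (\<lambda>i\<in>J. \<ominus>\<^bsub>V i\<^esub> v i) = \<zero>\<^bsub>?D\<^esub>"
      using v g unfolding c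
      by (auto simp: direct_sum_vs_def intro!: restrict_ext abelian_group.r_neg)
  qed
  moreover have "v \<oplus>\<^bsub>?D\<^esub> \<zero>\<^bsub>?D\<^esub> = v" "\<one>\<^bsub>K\<^esub> \<odot>\<^bsub>?D\<^esub> v = v" if v: "v \<in> carrier ?D" for v
    using v unfolding c
    by (auto simp: direct_sum_vs_def PiE_iff extensional_def fun_eq_iff
        abelian_monoid.r_zero[OF abelian_group.axioms(1)[OF g(1)]] module.smult_one[OF g(2)])
  moreover have sr: "a \<odot>\<^bsub>V i\<^esub> (v i \<oplus>\<^bsub>V i\<^esub> w i) = a \<odot>\<^bsub>V i\<^esub> v i \<oplus>\<^bsub>V i\<^esub> a \<odot>\<^bsub>V i\<^esub> w i"
    if "i \<in> J" "a \<in> carrier K" "v \<in> (\<Pi>\<^sub>E i\<in>J. carrier (V i))" "w \<in> (\<Pi>\<^sub>E i\<in>J. carrier (V i))" for a i v w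
    using that g(2) module.smult_r_distr PiE_mem by metis
  ultimately show ?thesis
    using g
    by (intro vs_criteria assms(1))
      (auto simp: direct_sum_vs_def assms(3) intro!: restrict_ext
        abelian_monoid.a_closed abelian_monoid.zero_closed abelian_group.axioms(1)
        module.smult_closed abelian_monoid.a_assoc abelian_monoid.a_comm
        module.smult_assoc1 module.smult_l_distr sr)
qed

text \<open>Bases of the summands, tagged by their index, act as a basis: the coordinate maps
  assemble to an isomorphism with the free space on \<open>Sigma J B\<close>.\<close>

lemma direct_sum_dim:
  assumes "field K" "\<And>i. i \<in> J \<Longrightarrow> vectorspace K (V i)" "\<And>i. i \<in> J \<Longrightarrow> vectorspace.fin_dim K (V i)"
    and "finite J"
  shows "vectorspace.fin_dim K (direct_sum_vs J V)"
    and "vectorspace.dim K (direct_sum_vs J V) = (\<Sum>i\<in>J. vectorspace.dim K (V i))"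
proof -
  interpret field K by fact
  let ?D = "direct_sum_vs J V"
  interpret D: vectorspace K ?D
    by (rule direct_sum_vectorspace) fact+
  have "\<forall>i\<in>J. \<exists>B. finite B \<and> vectorspace.basis K (V i) B"
    using assms vectorspace.finite_basis_exists by blast
  then obtain B where B: "\<And>i. i \<in> J \<Longrightarrow> finite (B i)" "\<And>i. i \<in> J \<Longrightarrow> vectorspace.basis K (V i) (B i)"
    by metis
  define C where "C i = vectorspace.coords K (V i) (B i)" for i
  have C: "linear_map K (V i) (free_vs K (B i)) (C i)"
    "bij_betw (C i) (carrier (V i)) (carrier (free_vs K (B i)))" if "i \<in> J" for i
    using vectorspace.coords_linear(1,2)[OF assms(2)[OF that] B(2)[OF that]] by (auto simp: C_def)
  have Cc: "C i v \<in> carrier (free_vs K (B i))" if "i \<in> J" "v \<in> carrier (V i)" for i v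
    using C(2)[OF that(1)] that(2) by (auto simp: bij_betw_def)
  let ?X = "Sigma J B"
  have X: "finite ?X"
    using assms(4) B(1) by blast
  interpret F: vectorspace K "free_vs K ?X"
    by (rule free_vs_vectorspace)
  let ?T = "\<lambda>f. \<lambda>(i, b)\<in>?X. C i (f i) b"
  have c: "carrier ?D = (\<Pi>\<^sub>E i\<in>J. carrier (V i))"
    using assms(4) by (auto simp: direct_sum_vs_def)
  have add: "C i (u \<oplus>\<^bsub>V i\<^esub> v) b = C i u b \<oplus>\<^bsub>K\<^esub> C i v b"
    if "i \<in> J" "u \<in> carrier (V i)" "v \<in> carrier (V i)" "b \<in> B i" for i u v b
  proof -
    interpret linear_map K "V i" "free_vs K (B i)" "C i"
      by (rule C(1)) fact
    show ?thesis
      using that by (simp add: field.free_vs_add[OF assms(1)])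
  qed
  have smult: "C i (k \<odot>\<^bsub>V i\<^esub> v) b = k \<otimes>\<^bsub>K\<^esub> C i v b"
    if "i \<in> J" "k \<in> carrier K" "v \<in> carrier (V i)" "b \<in> B i" for i k v b
  proof -
    interpret linear_map K "V i" "free_vs K (B i)" "C i"
      by (rule C(1)) fact
    show ?thesis
      using that by (simp add: field.free_vs_smult[OF assms(1)])
  qed
  have fc: "f i \<in> carrier (V i)" if "f \<in> carrier ?D" "i \<in> J" for f i
    using that by (auto simp: c)
  have T: "linear_map K ?D (free_vs K ?X) ?T"
  proof (rule linear_mapI)
    show "?T f \<in> carrier (free_vs K ?X)" if "f \<in> carrier ?D" for f
      using that X fc by (auto simp: free_vs_carrier[of ?X] intro!: free_vs_apply_closed[OF Cc])
    show "?T (f \<oplus>\<^bsub>?D\<^esub> g) = ?T f \<oplus>\<^bsub>free_vs K ?X\<^esub> ?T g" if "f \<in> carrier ?D" "g \<in> carrier ?D" for f g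
      using that fc by (auto simp: free_vs_add direct_sum_vs_def add intro!: restrict_ext)
    show "?T (k \<odot>\<^bsub>?D\<^esub> f) = k \<odot>\<^bsub>free_vs K ?X\<^esub> ?T f" if "k \<in> carrier K" "f \<in> carrier ?D" for f k
      using that fc by (auto simp: free_vs_smult direct_sum_vs_def smult intro!: restrict_ext)
  qed (rule D.vectorspace_axioms F.vectorspace_axioms)+
  have "inj_on ?T (carrier ?D)"
  proof (rule inj_onI)
    fix f g assume fg: "f \<in> carrier ?D" "g \<in> carrier ?D" "?T f = ?T g"
    have "f i = g i" if i: "i \<in> J" for i
    proof -
      have "C i (f i) b = C i (g i) b" if "b \<in> B i" for b
        using fun_cong[OF fg(3), of "(i, b)"] i that by simp
      then have "C i (f i) = C i (g i)"
        using Cc[OF i] fc[OF fg(1) i] fc[OF fg(2) i] by (intro free_vs_ext[of _ "B i"]) auto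
      then show ?thesis
        using C(2)[OF i] fc[OF fg(1) i] fc[OF fg(2) i] by (auto simp: bij_betw_def dest: inj_onD)
    qed
    then show "f = g"
      using fg(1,2) PiE_ext[of f J "\<lambda>i. carrier (V i)" g] unfolding c by blast
  qed
  moreover have "carrier (free_vs K ?X) \<subseteq> ?T ` carrier ?D"
  proof
    fix h assume h: "h \<in> carrier (free_vs K ?X)"
    have "(\<lambda>b\<in>B i. h (i, b)) \<in> carrier (free_vs K (B i))" if "i \<in> J" for i
      using h that B(1)[OF that] by (auto simp: free_vs_carrier)
    then have "\<forall>i\<in>J. \<exists>v\<in>carrier (V i). C i v = (\<lambda>b\<in>B i. h (i, b))"
      using C(2) by (metis bij_betw_imp_surj_on imageE)
    then obtain f where f: "\<And>i. i \<in> J \<Longrightarrow> f i \<in> carrier (V i)" "\<And>i. i \<in> J \<Longrightarrow> C i (f i) = (\<lambda>b\<in>B i. h (i, b))"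
      by metis
    have fD: "restrict f J \<in> carrier ?D"
      using f by (auto simp: c)
    have "h = ?T (restrict f J)"
      using h f by (intro free_vs_ext[OF h linear_map.T_im[OF T fD]]) auto
    then show "h \<in> ?T ` carrier ?D"
      using fD by blast
  qed
  ultimately have bij: "bij_betw ?T (carrier ?D) (carrier (free_vs K ?X))"
    using linear_map.T_im[OF T] by (auto simp: bij_betw_def)
  show "D.fin_dim"
    by (rule linear_map.bij_fin_dim'(1)[OF T bij free_vs_dim(2)[OF X]])
  have "D.dim = card ?X"
    using linear_map.bij_fin_dim'(2)[OF T bij free_vs_dim(2)[OF X]] free_vs_dim(1)[OF X] by simp
  also have "\<dots> = (\<Sum>i\<in>J. card (B i))"
    using assms(4) B(1) by simp
  also have "\<dots> = (\<Sum>i\<in>J. vectorspace.dim K (V i))"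
    using vectorspace.dim_basis[OF assms(2) B] by simp
  finally show "D.dim = (\<Sum>i\<in>J. vectorspace.dim K (V i))" .
qed

lemma tensor_relsI:
  fixes K V W
  defines "F \<equiv> free_vs K (carrier V \<times> carrier W)" and "e \<equiv> basis_vec K (carrier V \<times> carrier W)"
  shows "u \<in> carrier V \<Longrightarrow> v \<in> carrier V \<Longrightarrow> w \<in> carrier W \<Longrightarrow>
      e (u \<oplus>\<^bsub>V\<^esub> v, w) \<ominus>\<^bsub>F\<^esub> (e (u, w) \<oplus>\<^bsub>F\<^esub> e (v, w)) \<in> tensor_rels K V W"
    and "c \<in> carrier K \<Longrightarrow> v \<in> carrier V \<Longrightarrow> w \<in> carrier W \<Longrightarrow>
      e (c \<odot>\<^bsub>V\<^esub> v, w) \<ominus>\<^bsub>F\<^esub> (c \<odot>\<^bsub>F\<^esub> e (v, w)) \<in> tensor_rels K V W"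
    and "c \<in> carrier K \<Longrightarrow> v \<in> carrier V \<Longrightarrow> w \<in> carrier W \<Longrightarrow>
      e (v, c \<odot>\<^bsub>W\<^esub> w) \<ominus>\<^bsub>F\<^esub> (c \<odot>\<^bsub>F\<^esub> e (v, w)) \<in> tensor_rels K V W"
  unfolding tensor_rels_def Let_def F_def e_def
  by (rule UnI1, rule UnI1, rule UnI1, blast) (rule UnI1, rule UnI2, blast, rule UnI2, blast)

text \<open>Choose a generator \<open>l\<close> of the line with coordinate \<open>h\<close>.
  Sending the pair of \<open>v\<close> and \<open>w\<close> to \<open>h w\<close> times
  \<open>v\<close> respects the relations, and sending \<open>v\<close> to the class of
  \<open>v\<close> tensor \<open>l\<close> inverts it.\<close>

lemma tensor_line_dim:
  assumes V: "vectorspace K V" "vectorspace.fin_dim K V"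
    and W: "vectorspace K W" "vectorspace.fin_dim K W" "vectorspace.dim K W = 1"
  shows "vectorspace K (tensor_vs K V W)" "vectorspace.fin_dim K (tensor_vs K V W)"
    and "vectorspace.dim K (tensor_vs K V W) = vectorspace.dim K V"
proof -
  interpret V: vectorspace K V by fact
  interpret W: vectorspace K W by fact
  let ?X = "carrier V \<times> carrier W"
  let ?F = "free_vs K ?X"
  let ?e = "basis_vec K ?X"
  interpret F: vectorspace K ?F
    by (rule V.free_vs_vectorspace)
  obtain l h where l: "l \<in> carrier W" "linear_map K W (self_mod K) h" "h l = \<one>\<^bsub>K\<^esub>"
    "\<And>w. w \<in> carrier W \<Longrightarrow> w = h w \<odot>\<^bsub>W\<^esub> l"
    using W.line_coordinate[OF W(2,3)] by metis
  interpret l: linear_map K W "self_mod K" h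
    by (rule l(2))
  have lam: "h w \<in> carrier K" if "w \<in> carrier W" for w
    using l.T_im[OF that] by simp
  have lam_add: "h (w \<oplus>\<^bsub>W\<^esub> w') = h w \<oplus>\<^bsub>K\<^esub> h w'" if "w \<in> carrier W" "w' \<in> carrier W" for w w'
    using l.T_add[OF that] by simp
  have lam_smult: "h (c \<odot>\<^bsub>W\<^esub> w) = c \<otimes>\<^bsub>K\<^esub> h w" if "c \<in> carrier K" "w \<in> carrier W" for c w
    using l.T_smult[OF that] by simp
  define g where "g = (\<lambda>(v, w). h w \<odot>\<^bsub>V\<^esub> v)"
  have g: "g \<in> ?X \<rightarrow> carrier V"
    using lam by (auto simp: g_def)
  define T where "T = free_ext K V ?X g"
  interpret T: linear_map K ?F V T
    unfolding T_def by (rule V.free_ext_linear[OF g])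
  have Te: "T (?e (v, w)) = h w \<odot>\<^bsub>V\<^esub> v" if "v \<in> carrier V" "w \<in> carrier W" for v w
    using V.free_ext_basis_vec[OF g, of "(v, w)"] that by (simp add: T_def g_def)
  have e: "?e (v, w) \<in> carrier ?F" if "v \<in> carrier V" "w \<in> carrier W" for v w
    using that by (intro V.basis_vec_closed) auto
  let ?R = "tensor_rels K V W"
  let ?N = "F.span ?R"
  have R: "?R \<subseteq> {f \<in> carrier ?F. T f = \<zero>\<^bsub>V\<^esub>}"
  proof
    fix f assume "f \<in> ?R"
    then consider u v w where "u \<in> carrier V" "v \<in> carrier V" "w \<in> carrier W"
        "f = ?e (u \<oplus>\<^bsub>V\<^esub> v, w) \<ominus>\<^bsub>?F\<^esub> (?e (u, w) \<oplus>\<^bsub>?F\<^esub> ?e (v, w))"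
      | v w x where "v \<in> carrier V" "w \<in> carrier W" "x \<in> carrier W"
        "f = ?e (v, w \<oplus>\<^bsub>W\<^esub> x) \<ominus>\<^bsub>?F\<^esub> (?e (v, w) \<oplus>\<^bsub>?F\<^esub> ?e (v, x))"
      | c v w where "c \<in> carrier K" "v \<in> carrier V" "w \<in> carrier W"
        "f = ?e (c \<odot>\<^bsub>V\<^esub> v, w) \<ominus>\<^bsub>?F\<^esub> (c \<odot>\<^bsub>?F\<^esub> ?e (v, w))"
      | c v w where "c \<in> carrier K" "v \<in> carrier V" "w \<in> carrier W"
        "f = ?e (v, c \<odot>\<^bsub>W\<^esub> w) \<ominus>\<^bsub>?F\<^esub> (c \<odot>\<^bsub>?F\<^esub> ?e (v, w))"
      unfolding tensor_rels_def Let_def by (elim UnE CollectE exE conjE) metis+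
    then show "f \<in> {f \<in> carrier ?F. T f = \<zero>\<^bsub>V\<^esub>}"
    proof cases
      case 1
      then show ?thesis
        using lam by (simp add: e Te V.smult_r_distr)
    next
      case 2
      then show ?thesis
        using lam by (simp add: e Te lam_add V.smult_l_distr)
    next
      case 3
      then show ?thesis
        using lam by (simp add: e Te V.smult_assoc1[symmetric] V.R.m_comm)
    next
      case 4
      then show ?thesis
        using lam by (simp add: e Te lam_smult V.smult_assoc1)
    qed
  qed
  then have Rc: "?R \<subseteq> carrier ?F"
    by blast
  have N: "subspace K ?N ?F"
    by (rule F.span_subspace[OF Rc])
  have NT: "T f = \<zero>\<^bsub>V\<^esub>" if "f \<in> ?N" for f
    using F.span_minimal[OF T.kernel_subspace R] that by blast
  have RN: "f \<in> ?N" if "f \<in> ?R" for f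
    using F.in_own_span[OF Rc] that by blast
  let ?Q = "quot_mod ?F ?N"
  have tq: "tensor_vs K V W = ?Q"
    by (simp add: tensor_vs_def Let_def)
  let ?q = "\<lambda>f. ?N +>\<^bsub>?F\<^esub> f"
  interpret Q: vectorspace K ?Q
    by (rule F.quot_vectorspace[OF N])
  interpret q: linear_map K ?F ?Q ?q
    by (rule F.quot_proj_linear[OF N])
  have S: "linear_map K V ?Q (\<lambda>v. ?q (?e (v, l)))"
  proof (rule linear_mapI)
    show "?q (?e (v, l)) \<in> carrier ?Q" if "v \<in> carrier V" for v
      using that e l(1) by auto
    show "?q (?e (u \<oplus>\<^bsub>V\<^esub> v, l)) = ?q (?e (u, l)) \<oplus>\<^bsub>?Q\<^esub> ?q (?e (v, l))"
      if uv: "u \<in> carrier V" "v \<in> carrier V" for u v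
    proof -
      have "?e (u \<oplus>\<^bsub>V\<^esub> v, l) \<ominus>\<^bsub>?F\<^esub> (?e (u, l) \<oplus>\<^bsub>?F\<^esub> ?e (v, l)) \<in> ?N"
        using uv l(1) by (intro RN tensor_relsI(1))
      then have "?q (?e (u \<oplus>\<^bsub>V\<^esub> v, l)) = ?q (?e (u, l) \<oplus>\<^bsub>?F\<^esub> ?e (v, l))"
        using uv l(1) by (subst F.coset_eq_iff[OF N]) (auto simp: e)
      then show ?thesis
        using uv l(1) by (simp add: e)
    qed
    show "?q (?e (c \<odot>\<^bsub>V\<^esub> v, l)) = c \<odot>\<^bsub>?Q\<^esub> ?q (?e (v, l))"
      if cv: "c \<in> carrier K" "v \<in> carrier V" for c v
    proof -
      have "?e (c \<odot>\<^bsub>V\<^esub> v, l) \<ominus>\<^bsub>?F\<^esub> (c \<odot>\<^bsub>?F\<^esub> ?e (v, l)) \<in> ?N"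
        using cv l(1) by (intro RN tensor_relsI(2))
      then have "?q (?e (c \<odot>\<^bsub>V\<^esub> v, l)) = ?q (c \<odot>\<^bsub>?F\<^esub> ?e (v, l))"
        using cv l(1) by (subst F.coset_eq_iff[OF N]) (auto simp: e)
      then show ?thesis
        using cv l(1) by (simp add: e)
    qed
  qed (rule V.vectorspace_axioms Q.vectorspace_axioms)+
  interpret S: linear_map K V ?Q "\<lambda>v. ?q (?e (v, l))"
    by (rule S)
  have "bij_betw (\<lambda>v. ?q (?e (v, l))) (carrier V) (carrier ?Q)"
  proof (rule F.quot_bij[OF N T.linear_map_axioms _ NT S _ V.free_vs_span])
    have "v = T (?e (v, l))" if "v \<in> carrier V" for v
      using that l(1,3) by (simp add: Te)
    then show "T ` carrier ?F = carrier V"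
      using e l(1) by (auto intro!: image_eqI)
    show "?e ` ?X \<subseteq> carrier ?F"
      using e by auto
    fix x assume "x \<in> ?e ` ?X"
    then obtain v w where vw: "v \<in> carrier V" "w \<in> carrier W" "x = ?e (v, w)"
      by auto
    \<comment> \<open>Modulo the relations the scalar moves across: \<open>v\<close> tensor
      \<open>w\<close> is \<open>v\<close> tensor \<open>h w\<close> times \<open>l\<close>, hence
      \<open>h w\<close> times \<open>v\<close> tensor \<open>l\<close>.\<close>
    have "?e (v, h w \<odot>\<^bsub>W\<^esub> l) \<ominus>\<^bsub>?F\<^esub> (h w \<odot>\<^bsub>?F\<^esub> ?e (v, l)) \<in> ?N"
      using vw lam l(1) by (intro RN tensor_relsI(3))
    then have "?q (?e (v, h w \<odot>\<^bsub>W\<^esub> l)) = ?q (h w \<odot>\<^bsub>?F\<^esub> ?e (v, l))"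
      using vw l(1) lam by (subst F.coset_eq_iff[OF N]) (auto simp: e)
    also have "\<dots> = h w \<odot>\<^bsub>?Q\<^esub> ?q (?e (v, l))"
      using vw lam e l(1) by (intro q.T_smult) auto
    also have "\<dots> = ?q (?e (h w \<odot>\<^bsub>V\<^esub> v, l))"
      using vw lam by (intro S.T_smult[symmetric]) auto
    finally show "?q x = ?q (?e (T x, l))"
      using l(4)[OF vw(2)] vw by (simp add: Te)
  qed
  note fd = S.bij_fin_dim[OF this V(2)]
  show "vectorspace K (tensor_vs K V W)" "vectorspace.fin_dim K (tensor_vs K V W)"
    "vectorspace.dim K (tensor_vs K V W) = vectorspace.dim K V"
    using fd Q.vectorspace_axioms by (simp_all add: tq)
qed

subsection \<open>The top exterior power\<close>

context cring
begin

text \<open>The determinant. It supplies an alternating form with value one on a basis, which shows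
  that the top exterior power is not zero.\<close>

definition leibniz_det :: "nat \<Rightarrow> (nat \<Rightarrow> nat \<Rightarrow> 'a) \<Rightarrow> 'a" where
  "leibniz_det n a = (\<Oplus>\<sigma>\<in>{\<sigma>. \<sigma> permutes {..<n}}.
     (if evenperm \<sigma> then \<one> else \<ominus> \<one>) \<otimes> (\<Otimes>i\<in>{..<n}. a i (\<sigma> i)))"

lemma finprod_split:
  fixes n :: nat
  assumes "f \<in> {..<n} \<rightarrow> carrier R" "k < n"
  shows "finprod R f {..<n} = f k \<otimes> finprod R f ({..<n} - {k})"
proof -
  have "{..<n} = insert k ({..<n} - {k})"
    using assms(2) by auto
  then have "finprod R f {..<n} = finprod R f (insert k ({..<n} - {k}))"
    by simp
  also have "\<dots> = f k \<otimes> finprod R f ({..<n} - {k})"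
    using assms by (intro finprod_insert) auto
  finally show ?thesis .
qed

lemma finite_perms: "finite {\<sigma>. \<sigma> permutes {..<n::nat}}"
  by (simp add: finite_permutations)

lemma leibniz_summand_closed:
  assumes "\<And>i j. i < n \<Longrightarrow> j < n \<Longrightarrow> a i j \<in> carrier R" "\<sigma> permutes {..<n}"
  shows "(\<Otimes>i\<in>{..<n}. a i (\<sigma> i)) \<in> carrier R"
  using assms(1) permutes_in_image[OF assms(2)] by (intro finprod_closed) auto

lemma leibniz_det_add:
  assumes a: "\<And>i j. i < n \<Longrightarrow> j < n \<Longrightarrow> a i j \<in> carrier R"
    and b: "\<And>i j. i < n \<Longrightarrow> j < n \<Longrightarrow> b i j \<in> carrier R"
    and c: "\<And>i j. i < n \<Longrightarrow> j < n \<Longrightarrow> c i j \<in> carrier R"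
    and k: "k < n" "\<And>j. j < n \<Longrightarrow> a k j = b k j \<oplus> c k j"
    and other: "\<And>i j. i < n \<Longrightarrow> j < n \<Longrightarrow> i \<noteq> k \<Longrightarrow> a i j = b i j \<and> a i j = c i j"
  shows "leibniz_det n a = leibniz_det n b \<oplus> leibniz_det n c"
proof -
  let ?s = "\<lambda>\<sigma>. if evenperm \<sigma> then \<one> else \<ominus> \<one>"
  let ?p = "\<lambda>a \<sigma>. \<Otimes>i\<in>{..<n}. a i (\<sigma> i)"
  have eq: "?p a \<sigma> = ?p b \<sigma> \<oplus> ?p c \<sigma>" if s: "\<sigma> permutes {..<n}" for \<sigma>
  proof -
    have sn: "\<sigma> i < n" if "i < n" for i
      using permutes_in_image[OF s] that by auto
    let ?P = "\<Otimes>i\<in>{..<n} - {k}. a i (\<sigma> i)"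
    have P: "?P \<in> carrier R"
      using a sn by (intro finprod_closed) auto
    have "?p a \<sigma> = a k (\<sigma> k) \<otimes> ?P"
      using a sn k(1) by (intro finprod_split) auto
    moreover have "?p b \<sigma> = b k (\<sigma> k) \<otimes> (\<Otimes>i\<in>{..<n} - {k}. b i (\<sigma> i))"
      using b sn k(1) by (intro finprod_split) auto
    moreover have "?p c \<sigma> = c k (\<sigma> k) \<otimes> (\<Otimes>i\<in>{..<n} - {k}. c i (\<sigma> i))"
      using c sn k(1) by (intro finprod_split) auto
    moreover have "(\<Otimes>i\<in>{..<n} - {k}. b i (\<sigma> i)) = ?P" "(\<Otimes>i\<in>{..<n} - {k}. c i (\<sigma> i)) = ?P"
    proof -
      have "b i (\<sigma> i) = a i (\<sigma> i)" "c i (\<sigma> i) = a i (\<sigma> i)" if "i \<in> {..<n} - {k}" for i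
        using other[of i "\<sigma> i"] sn[of i] that by auto
      then show "(\<Otimes>i\<in>{..<n} - {k}. b i (\<sigma> i)) = ?P" "(\<Otimes>i\<in>{..<n} - {k}. c i (\<sigma> i)) = ?P"
        using a sn by (auto intro!: finprod_cong')
    qed
    ultimately show ?thesis
      using P k b c sn by (simp add: l_distr)
  qed
  have "leibniz_det n a = (\<Oplus>\<sigma>\<in>{\<sigma>. \<sigma> permutes {..<n}}. ?s \<sigma> \<otimes> ?p b \<sigma> \<oplus> ?s \<sigma> \<otimes> ?p c \<sigma>)"
    unfolding leibniz_det_def
    using leibniz_summand_closed[of n b] leibniz_summand_closed[of n c] b c
    by (intro finsum_cong') (auto simp: eq r_distr)
  also have "\<dots> = leibniz_det n b \<oplus> leibniz_det n c"
    unfolding leibniz_det_def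
    using leibniz_summand_closed[of n b] leibniz_summand_closed[of n c] b c
    by (intro finsum_addf) auto
  finally show ?thesis .
qed

lemma leibniz_det_smult:
  assumes a: "\<And>i j. i < n \<Longrightarrow> j < n \<Longrightarrow> a i j \<in> carrier R"
    and b: "\<And>i j. i < n \<Longrightarrow> j < n \<Longrightarrow> b i j \<in> carrier R"
    and c: "c \<in> carrier R"
    and k: "k < n" "\<And>j. j < n \<Longrightarrow> a k j = c \<otimes> b k j"
    and other: "\<And>i j. i < n \<Longrightarrow> j < n \<Longrightarrow> i \<noteq> k \<Longrightarrow> a i j = b i j"
  shows "leibniz_det n a = c \<otimes> leibniz_det n b"
proof -
  let ?s = "\<lambda>\<sigma>. if evenperm \<sigma> then \<one> else \<ominus> \<one>"
  let ?p = "\<lambda>a \<sigma>. \<Otimes>i\<in>{..<n}. a i (\<sigma> i)"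
  have eq: "?p a \<sigma> = c \<otimes> ?p b \<sigma>" if s: "\<sigma> permutes {..<n}" for \<sigma>
  proof -
    have sn: "\<sigma> i < n" if "i < n" for i
      using permutes_in_image[OF s] that by auto
    let ?P = "\<Otimes>i\<in>{..<n} - {k}. a i (\<sigma> i)"
    have P: "?P \<in> carrier R"
      using a sn by (intro finprod_closed) auto
    have "?p a \<sigma> = a k (\<sigma> k) \<otimes> ?P"
      using a sn k(1) by (intro finprod_split) auto
    moreover have "?p b \<sigma> = b k (\<sigma> k) \<otimes> (\<Otimes>i\<in>{..<n} - {k}. b i (\<sigma> i))"
      using b sn k(1) by (intro finprod_split) auto
    moreover have "(\<Otimes>i\<in>{..<n} - {k}. b i (\<sigma> i)) = ?P"
    proof -
      have "b i (\<sigma> i) = a i (\<sigma> i)" if "i \<in> {..<n} - {k}" for i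
        using other[of i "\<sigma> i"] sn[of i] that by auto
      then show ?thesis
        using a sn by (auto intro!: finprod_cong')
    qed
    ultimately show ?thesis
      using P k b c sn by (simp add: m_assoc)
  qed
  have "leibniz_det n a = (\<Oplus>\<sigma>\<in>{\<sigma>. \<sigma> permutes {..<n}}. c \<otimes> (?s \<sigma> \<otimes> ?p b \<sigma>))"
    unfolding leibniz_det_def
    using leibniz_summand_closed[of n b] b c
    by (intro finsum_cong') (auto simp: eq m_lcomm)
  also have "\<dots> = c \<otimes> leibniz_det n b"
    unfolding leibniz_det_def
    using leibniz_summand_closed[of n b] b c finite_perms
    by (intro finsum_rdistr[symmetric]) auto
  finally show ?thesis .
qed

text \<open>Composition with the transposition of \<open>i\<close> and \<open>j\<close> matches even
  with odd permutations, keeps the product because the rows \<open>i\<close> and \<open>j\<close>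
  agree, and flips the sign. The terms cancel in pairs, so characteristic two needs no separate
  treatment.\<close>

lemma leibniz_det_alternating:
  assumes a: "\<And>i j. i < n \<Longrightarrow> j < n \<Longrightarrow> a i j \<in> carrier R"
    and ij: "i < n" "j < n" "i \<noteq> j" "\<And>k. k < n \<Longrightarrow> a i k = a j k"
  shows "leibniz_det n a = \<zero>"
proof -
  let ?s = "\<lambda>\<sigma>. if evenperm \<sigma> then \<one> else \<ominus> \<one>"
  let ?p = "\<lambda>\<sigma>. \<Otimes>i\<in>{..<n}. a i (\<sigma> i)"
  let ?f = "\<lambda>\<sigma>. ?s \<sigma> \<otimes> ?p \<sigma>"
  let ?t = "transpose i j"
  let ?E = "{\<sigma>. \<sigma> permutes {..<n} \<and> evenperm \<sigma>}"
  have t: "?t permutes {..<n}"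
    using ij by (intro permutes_swap_id) auto
  have perm: "permutation \<sigma>" if "\<sigma> permutes {..<n}" for \<sigma>
    using that permutation_permutes by blast
  have ev: "evenperm (\<sigma> \<circ> ?t) \<longleftrightarrow> \<not> evenperm \<sigma>" if "\<sigma> permutes {..<n}" for \<sigma>
    using perm[OF that] perm[OF t] ij(3) by (simp add: evenperm_comp evenperm_swap)
  have tt: "\<sigma> \<circ> ?t \<circ> ?t = \<sigma>" for \<sigma> :: "nat \<Rightarrow> nat"
    by (simp add: fun_eq_iff)
  have split: "{\<sigma>. \<sigma> permutes {..<n}} = ?E \<union> (\<lambda>\<sigma>. \<sigma> \<circ> ?t) ` ?E"
  proof (intro equalityI subsetI)
    fix \<sigma> assume "\<sigma> \<in> {\<sigma>. \<sigma> permutes {..<n}}"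
    then have s: "\<sigma> permutes {..<n}"
      by simp
    show "\<sigma> \<in> ?E \<union> (\<lambda>\<sigma>. \<sigma> \<circ> ?t) ` ?E"
    proof (cases "evenperm \<sigma>")
      case False
      then have "\<sigma> \<circ> ?t \<in> ?E"
        using s ev[OF s] permutes_compose[OF t s] by simp
      then show ?thesis
        by (intro UnI2 image_eqI[of _ _ "\<sigma> \<circ> ?t"]) (simp_all only: tt)
    qed (use s in simp)
  next
    fix \<sigma> assume "\<sigma> \<in> ?E \<union> (\<lambda>\<sigma>. \<sigma> \<circ> ?t) ` ?E"
    then show "\<sigma> \<in> {\<sigma>. \<sigma> permutes {..<n}}"
      using permutes_compose[OF t] by auto
  qed
  have fin: "finite ?E"
    by (rule finite_subset[OF _ finite_perms[of n]]) auto
  have pc: "?p \<sigma> \<in> carrier R" if "\<sigma> permutes {..<n}" for \<sigma>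
    using leibniz_summand_closed[of n a] a that by blast
  have pt: "?p (\<sigma> \<circ> ?t) = ?p \<sigma>" if s: "\<sigma> permutes {..<n}" for \<sigma>
  proof -
    have sn: "\<sigma> k < n" if "k < n" for k
      using permutes_in_image[OF s] that by auto
    have tn: "?t k < n" if "k < n" for k
      using permutes_in_image[OF t] that by auto
    have "?p (\<sigma> \<circ> ?t) = (\<Otimes>k\<in>?t ` {..<n}. a k (\<sigma> (?t k)))"
      using permutes_image[OF t] by simp
    also have "\<dots> = (\<Otimes>k\<in>{..<n}. a (?t k) (\<sigma> (?t (?t k))))"
      using permutes_inj_on[OF t] a sn tn by (intro finprod_reindex) auto
    also have "\<dots> = ?p \<sigma>"
      using a sn ij by (intro finprod_cong') (auto simp: transpose_def)
    finally show ?thesis .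
  qed
  have inj: "inj_on (\<lambda>\<sigma>. \<sigma> \<circ> ?t) ?E"
    by (rule inj_on_inverseI[where g = "\<lambda>\<sigma>. \<sigma> \<circ> ?t"]) (rule tt)
  have fc: "?f \<sigma> \<in> carrier R" if "\<sigma> permutes {..<n}" for \<sigma>
    using pc[OF that] by simp
  have "leibniz_det n a = (\<Oplus>\<sigma>\<in>?E \<union> (\<lambda>\<sigma>. \<sigma> \<circ> ?t) ` ?E. ?f \<sigma>)"
    unfolding leibniz_det_def split ..
  also have "\<dots> = (\<Oplus>\<sigma>\<in>?E. ?f \<sigma>) \<oplus> (\<Oplus>\<sigma>\<in>(\<lambda>\<sigma>. \<sigma> \<circ> ?t) ` ?E. ?f \<sigma>)"
  proof (rule finsum_Un_disjoint)
    show "?E \<inter> (\<lambda>\<sigma>. \<sigma> \<circ> ?t) ` ?E = {}"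
      using ev by auto
    show "?f \<in> ?E \<rightarrow> carrier R"
      by (rule funcsetI, rule fc) simp
    show "?f \<in> (\<lambda>\<sigma>. \<sigma> \<circ> ?t) ` ?E \<rightarrow> carrier R"
      by (rule funcsetI, rule fc) (use permutes_compose[OF t] in auto)
  qed (use fin in auto)
  also have "(\<Oplus>\<sigma>\<in>(\<lambda>\<sigma>. \<sigma> \<circ> ?t) ` ?E. ?f \<sigma>) = (\<Oplus>\<sigma>\<in>?E. ?f (\<sigma> \<circ> ?t))"
  proof (rule finsum_reindex[OF _ inj])
    show "?f \<in> (\<lambda>\<sigma>. \<sigma> \<circ> ?t) ` ?E \<rightarrow> carrier R"
      by (rule funcsetI, rule fc) (use permutes_compose[OF t] in auto)
  qed
  also have "\<dots> = (\<Oplus>\<sigma>\<in>?E. \<ominus> \<one> \<otimes> ?f \<sigma>)"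
    using pc by (intro finsum_cong') (auto simp: ev pt simp del: comp_apply)
  also have "(\<Oplus>\<sigma>\<in>?E. ?f \<sigma>) \<oplus> \<dots> = (\<Oplus>\<sigma>\<in>?E. ?f \<sigma> \<oplus> \<ominus> \<one> \<otimes> ?f \<sigma>)"
    using pc by (intro finsum_addf[symmetric]) auto
  also have "\<dots> = (\<Oplus>\<sigma>\<in>?E. \<zero>)"
    using pc by (intro finsum_cong') (auto simp: l_minus r_neg)
  finally show ?thesis
    by simp
qed

text \<open>A permutation other than the identity moves some \<open>k\<close>, and then its product
  contains an off-diagonal entry.\<close>

lemma leibniz_det_identity:
  assumes "\<And>i j. i < n \<Longrightarrow> j < n \<Longrightarrow> a i j = (if i = j then \<one> else \<zero>)"
  shows "leibniz_det n a = \<one>"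
proof -
  let ?s = "\<lambda>\<sigma>. if evenperm \<sigma> then \<one> else \<ominus> \<one>"
  have "?s \<sigma> \<otimes> (\<Otimes>i\<in>{..<n}. a i (\<sigma> i)) = (if \<sigma> = id then \<one> else \<zero>)"
    if s: "\<sigma> permutes {..<n}" for \<sigma>
  proof (cases "\<sigma> = id")
    case True
    have "(\<Otimes>i\<in>{..<n}. a i i) = (\<Otimes>i\<in>{..<n}. \<one>)"
      using assms by (intro finprod_cong') auto
    then show ?thesis
      using True evenperm_id by (simp add: id_def)
  next
    case False
    then obtain k where k: "\<sigma> k \<noteq> k"
      by (auto simp: fun_eq_iff)
    then have kn: "k < n"
      using permutes_not_in[OF s, of k] by auto
    have sn: "\<sigma> k < n" if "k < n" for k
      using permutes_in_image[OF s] that by auto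
    have "(\<Otimes>i\<in>{..<n}. a i (\<sigma> i)) = a k (\<sigma> k) \<otimes> (\<Otimes>i\<in>{..<n} - {k}. a i (\<sigma> i))"
      using assms sn kn by (intro finprod_split) auto
    also have "\<dots> = \<zero>"
      using assms[OF kn sn[OF kn]] k assms sn by (auto intro!: l_null finprod_closed)
    finally show ?thesis
      using False by simp
  qed
  then have "leibniz_det n a = (\<Oplus>\<sigma>\<in>{\<sigma>. \<sigma> permutes {..<n}}. if id = \<sigma> then \<one> else \<zero>)"
    unfolding leibniz_det_def by (intro finsum_cong') auto
  also have "\<dots> = \<one>"
    using finsum_singleton[of id "{\<sigma>. \<sigma> permutes {..<n}}" "\<lambda>_. \<one>"] finite_perms permutes_id by auto
  finally show ?thesis .
qed

end

section \<open>Alternating maps and the upper bound for the top exterior power\<close>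

lemma tuples_update:
  "xs \<in> tuples V n \<Longrightarrow> u \<in> carrier V \<Longrightarrow> xs[i := u] \<in> tuples V n"
  using set_update_subset_insert[of xs i u] by (auto simp: tuples_def)

text \<open>Isolates the relations of the exterior power. The instance of interest sends a tuple to
  its class in the quotient and bounds the dimension of the latter from above.\<close>

locale alternating_map = V: vectorspace K V + Q: vectorspace K Q
  for K :: "('a, 'b) ring_scheme" and V :: "('a, 'c, 'd) module_scheme"
    and Q :: "('a, 'e, 'f) module_scheme" +
  fixes n :: nat and w :: "'c list \<Rightarrow> 'e"
  assumes w_closed: "xs \<in> tuples V n \<Longrightarrow> w xs \<in> carrier Q"
    and w_add: "xs \<in> tuples V n \<Longrightarrow> i < n \<Longrightarrow> u \<in> carrier V \<Longrightarrow> v \<in> carrier V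
      \<Longrightarrow> w (xs[i := u \<oplus>\<^bsub>V\<^esub> v]) = w (xs[i := u]) \<oplus>\<^bsub>Q\<^esub> w (xs[i := v])"
    and w_smult: "xs \<in> tuples V n \<Longrightarrow> i < n \<Longrightarrow> c \<in> carrier K \<Longrightarrow> u \<in> carrier V
      \<Longrightarrow> w (xs[i := c \<odot>\<^bsub>V\<^esub> u]) = c \<odot>\<^bsub>Q\<^esub> w (xs[i := u])"
    and w_alt: "xs \<in> tuples V n \<Longrightarrow> i < j \<Longrightarrow> j < n \<Longrightarrow> xs ! i = xs ! j \<Longrightarrow> w xs = \<zero>\<^bsub>Q\<^esub>"
begin

lemma w_alt': "xs \<in> tuples V n \<Longrightarrow> i \<noteq> j \<Longrightarrow> i < n \<Longrightarrow> j < n \<Longrightarrow> xs ! i = xs ! j \<Longrightarrow> w xs = \<zero>\<^bsub>Q\<^esub>"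
  using w_alt[of xs i j] w_alt[of xs j i] by (cases "i < j") auto

text \<open>Put the sum of the two entries in both positions and expand: the total and the two terms
  with repeated entries vanish.\<close>

lemma w_swap:
  assumes "xs \<in> tuples V n" "i \<noteq> j" "i < n" "j < n"
  shows "w (xs[i := xs ! j, j := xs ! i]) = \<ominus>\<^bsub>Q\<^esub> w xs"
proof -
  let ?a = "xs ! i" and ?b = "xs ! j"
  let ?y = "\<lambda>u v. w (xs[i := u, j := v])"
  have len: "length xs = n"
    using assms(1) by (simp add: tuples_def)
  have ab: "?a \<in> carrier V" "?b \<in> carrier V"
    using assms len by (auto simp: tuples_def)
  have zero: "?y u u = \<zero>\<^bsub>Q\<^esub>" if "u \<in> carrier V" for u
    using assms that len by (intro w_alt'[of _ i j] tuples_update) auto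
  have sw: "xs[i := u, j := v] = xs[j := v, i := u]" for u v
    using assms(2) by (rule list_update_swap)
  have add1: "?y (?a \<oplus>\<^bsub>V\<^esub> ?b) v = ?y ?a v \<oplus>\<^bsub>Q\<^esub> ?y ?b v" if "v \<in> carrier V" for v
    unfolding sw using assms that ab by (intro w_add tuples_update) auto
  have add2: "?y u (?a \<oplus>\<^bsub>V\<^esub> ?b) = ?y u ?a \<oplus>\<^bsub>Q\<^esub> ?y u ?b" if "u \<in> carrier V" for u
    using assms that ab by (intro w_add tuples_update) auto
  have c: "?y ?a ?b \<in> carrier Q" "?y ?b ?a \<in> carrier Q"
    using assms(1) ab by (auto intro!: w_closed tuples_update)
  have "?y (?a \<oplus>\<^bsub>V\<^esub> ?b) (?a \<oplus>\<^bsub>V\<^esub> ?b)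
      = (?y ?a ?a \<oplus>\<^bsub>Q\<^esub> ?y ?a ?b) \<oplus>\<^bsub>Q\<^esub> (?y ?b ?a \<oplus>\<^bsub>Q\<^esub> ?y ?b ?b)"
    unfolding add1[OF V.M.a_closed[OF ab]] add2[OF ab(1)] add2[OF ab(2)] ..
  also have "\<dots> = ?y ?a ?b \<oplus>\<^bsub>Q\<^esub> ?y ?b ?a"
    unfolding zero[OF ab(1)] zero[OF ab(2)] using c by simp
  finally have "?y (?a \<oplus>\<^bsub>V\<^esub> ?b) (?a \<oplus>\<^bsub>V\<^esub> ?b) = ?y ?a ?b \<oplus>\<^bsub>Q\<^esub> ?y ?b ?a" .
  then have "?y ?a ?b \<oplus>\<^bsub>Q\<^esub> ?y ?b ?a = \<zero>\<^bsub>Q\<^esub>"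
    using zero[OF V.M.a_closed[OF ab]] by (simp only:)
  then have "?y ?b ?a \<oplus>\<^bsub>Q\<^esub> ?y ?a ?b = \<zero>\<^bsub>Q\<^esub>"
    by (simp only: Q.M.a_comm[OF c])
  moreover have "?y ?a ?b = w xs"
    by (simp add: list_update_id)
  ultimately show ?thesis
    using c by (metis Q.M.minus_equality)
qed

text \<open>Tuples of basis vectors come first: with a repetition the value is zero, and otherwise
  transpositions lead to \<open>bs\<close> at the cost of a sign. Multilinearity then frees one slot
  at a time.\<close>

lemma w_in_line:
  assumes bs: "V.basis (set bs)" "distinct bs" "length bs = n" and xs: "xs \<in> tuples V n"
  shows "w xs \<in> Q.span {w bs}"
proof -
  have B: "set bs \<subseteq> carrier V" "V.span (set bs) = carrier V"
    using bs(1) by (auto simp: V.basis_def)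
  have bst: "bs \<in> tuples V n"
    using B bs(3) by (simp add: tuples_def)
  have L: "subspace K (Q.span {w bs}) Q"
    using w_closed[OF bst] by (intro Q.span_subspace) auto
  note L' = Q.subspaceD[OF L]
  have perm: "w ys \<in> Q.span {w bs}" if "distinct ys" "set ys = set bs" for ys
    using that
  proof (induction "card {k. k < n \<and> ys ! k \<noteq> bs ! k}" arbitrary: ys rule: less_induct)
    case less
    let ?D = "\<lambda>ys. {k. k < n \<and> ys ! k \<noteq> bs ! k}"
    have len: "length ys = n"
      using less.prems bs(2,3) by (metis distinct_card)
    have ys: "ys \<in> tuples V n"
      using less.prems len B by (simp add: tuples_def)
    show ?case
    proof (cases "?D ys = {}")
      case True
      then have "ys = bs"
        using len bs(3) by (intro nth_equalityI) auto
      then show ?thesis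
        using Q.span_self w_closed[OF bst] by simp
    next
      case False
      then obtain k where k: "k < n" "ys ! k \<noteq> bs ! k"
        by blast
      have "bs ! k \<in> set ys"
        using k(1) bs(3) less.prems by simp
      then obtain j where j: "j < n" "ys ! j = bs ! k"
        using len by (auto simp: in_set_conv_nth)
      have jk: "j \<noteq> k"
        using j k by auto
      have jb: "ys ! j \<noteq> bs ! j"
        using j jk k(1) bs(2,3) by (simp add: nth_eq_iff_index_eq)
      \<comment> \<open>The transposition brings \<open>bs ! k\<close> to position \<open>k\<close>.
        Position \<open>j\<close> was wrong before, as \<open>jb\<close> shows, so the number of
        misplaced entries drops.\<close>
      let ?z = "ys[k := ys ! j, j := ys ! k]"
      have "?D ?z \<subseteq> ?D ys - {k}"
        using j k jb len jk by (auto simp: nth_list_update split: if_splits)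
      then have "?D ?z \<subset> ?D ys"
        using k by blast
      then have "card (?D ?z) < card (?D ys)"
        by (intro psubset_card_mono) auto
      moreover have "k < length ys" "j < length ys"
        using j(1) k(1) len by simp_all
      then have "distinct ?z" "set ?z = set bs"
        using less.prems by simp_all
      ultimately have "w ?z \<in> Q.span {w bs}"
        using less.hyps by blast
      moreover have "w ?z = \<ominus>\<^bsub>Q\<^esub> w ys"
        using ys j k jk by (intro w_swap) auto
      ultimately have "\<zero>\<^bsub>Q\<^esub> \<ominus>\<^bsub>Q\<^esub> (\<ominus>\<^bsub>Q\<^esub> w ys) \<in> Q.span {w bs}"
        using L'(2,5) by metis
      then show ?thesis
        using w_closed[OF ys] by (simp add: a_minus_def)
    qed
  qed
  \<comment> \<open>The slots below \<open>k\<close> are arbitrary and the others hold basis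
    vectors; for \<open>k = n\<close> this is the claim.\<close>
  have "\<forall>xs\<in>tuples V n. (\<forall>j. k \<le> j \<and> j < n \<longrightarrow> xs ! j \<in> set bs) \<longrightarrow> w xs \<in> Q.span {w bs}" for k
  proof (induction k)
    case 0
    show ?case
    proof (intro ballI impI)
      fix xs assume xs: "xs \<in> tuples V n" and "\<forall>j. 0 \<le> j \<and> j < n \<longrightarrow> xs ! j \<in> set bs"
      then have sub: "set xs \<subseteq> set bs" and len: "length xs = n"
        by (auto simp: tuples_def in_set_conv_nth)
      show "w xs \<in> Q.span {w bs}"
      proof (cases "distinct xs")
        case True
        then have "card (set xs) = card (set bs)"
          using bs len by (simp add: distinct_card)
        then have "set xs = set bs"
          using sub by (intro card_subset_eq) auto
        then show ?thesis
          using perm True by blast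
      next
        case False
        then obtain i j where "i < length xs" "j < length xs" "i \<noteq> j" "xs ! i = xs ! j"
          by (auto simp: distinct_conv_nth)
        then show ?thesis
          using w_alt'[OF xs, of i j] len L'(2) by simp
      qed
    qed
  next
    case (Suc k)
    show ?case
    proof (intro ballI impI)
      fix xs assume xs: "xs \<in> tuples V n" and h: "\<forall>j. Suc k \<le> j \<and> j < n \<longrightarrow> xs ! j \<in> set bs"
      have len: "length xs = n"
        using xs by (simp add: tuples_def)
      show "w xs \<in> Q.span {w bs}"
      proof (cases "k < n")
        case True
        let ?U = "{u \<in> carrier V. w (xs[k := u]) \<in> Q.span {w bs}}"
        \<comment> \<open>A zero entry gives the value zero: homogeneity with the scalar
          zero.\<close>
        have "w (xs[k := \<zero>\<^bsub>K\<^esub> \<odot>\<^bsub>V\<^esub> \<zero>\<^bsub>V\<^esub>]) = \<zero>\<^bsub>Q\<^esub>"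
          using w_smult[OF xs True, of "\<zero>\<^bsub>K\<^esub>" "\<zero>\<^bsub>V\<^esub>"] w_closed[OF tuples_update[OF xs, of "\<zero>\<^bsub>V\<^esub>" k]]
          by simp
        then have "subspace K ?U V"
          using L' w_add[OF xs True] w_smult[OF xs True] by (intro V.subspaceI) auto
        moreover have "set bs \<subseteq> ?U"
        proof
          fix b assume b: "b \<in> set bs"
          have "\<forall>j. k \<le> j \<and> j < n \<longrightarrow> xs[k := b] ! j \<in> set bs"
            using h b len by (auto simp: nth_list_update)
          then show "b \<in> ?U"
            using Suc.IH tuples_update[OF xs, of b k] b B by blast
        qed
        ultimately have "carrier V \<subseteq> ?U"
          using V.span_minimal B(2) by blast
        moreover have "xs ! k \<in> carrier V"
          using xs True by (auto simp: tuples_def)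
        ultimately show ?thesis
          by (auto simp: list_update_id)
      qed (use Suc.IH xs in auto)
    qed
  qed
  from this[of n] show ?thesis
    using xs by auto
qed

end

lemma ext_relsI:
  fixes K V n
  defines "F \<equiv> free_vs K (tuples V n)" and "e \<equiv> basis_vec K (tuples V n)"
  shows "xs \<in> tuples V n \<Longrightarrow> i < n \<Longrightarrow> u \<in> carrier V \<Longrightarrow> v \<in> carrier V \<Longrightarrow>
      e (xs[i := u \<oplus>\<^bsub>V\<^esub> v]) \<ominus>\<^bsub>F\<^esub> (e (xs[i := u]) \<oplus>\<^bsub>F\<^esub> e (xs[i := v])) \<in> ext_rels K n V"
    and "xs \<in> tuples V n \<Longrightarrow> i < n \<Longrightarrow> c \<in> carrier K \<Longrightarrow> u \<in> carrier V \<Longrightarrow>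
      e (xs[i := c \<odot>\<^bsub>V\<^esub> u]) \<ominus>\<^bsub>F\<^esub> (c \<odot>\<^bsub>F\<^esub> e (xs[i := u])) \<in> ext_rels K n V"
    and "xs \<in> tuples V n \<Longrightarrow> i < j \<Longrightarrow> j < n \<Longrightarrow> xs ! i = xs ! j \<Longrightarrow> e xs \<in> ext_rels K n V"
  unfolding ext_rels_def Let_def F_def e_def
  by (rule UnI1, rule UnI1, blast) (rule UnI1, rule UnI2, blast, rule UnI2, blast)

text \<open>The class of a basis spans because the classes of tuples form an alternating map; it is
  nonzero because the determinant kills the relations and takes the value one there. For
  \<open>n = 0\<close> the only tuple is the empty one.\<close>

lemma ext_power_dim:
  assumes V: "vectorspace K V" "vectorspace.fin_dim K V" "vectorspace.dim K V = n"
  shows "vectorspace K (ext_power K n V)" "vectorspace.fin_dim K (ext_power K n V)"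
    and "vectorspace.dim K (ext_power K n V) = 1"
proof -
  interpret V: vectorspace K V by fact
  let ?X = "tuples V n"
  let ?F = "free_vs K ?X"
  let ?e = "basis_vec K ?X"
  interpret F: vectorspace K ?F
    by (rule V.free_vs_vectorspace)
  interpret S: vectorspace K "self_mod K"
    by (rule V.self_mod_vectorspace)
  obtain B where B: "finite B" "V.basis B"
    using V.finite_basis_exists[OF V(2)] by blast
  obtain bs where bs: "set bs = B" "distinct bs"
    using finite_distinct_list[OF B(1)] by blast
  have len: "length bs = n"
    using V.dim_basis[OF B] V(3) bs distinct_card by metis
  have Bc: "B \<subseteq> carrier V"
    using B(2) by (simp add: V.basis_def)
  have bst: "bs \<in> ?X"
    using Bc bs len by (simp add: tuples_def)
  interpret C: linear_map K V "free_vs K B" "V.coords B"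
    by (rule V.coords_linear(1)[OF B(2)])
  have bsB: "j < n \<Longrightarrow> bs ! j \<in> B" for j
    using bs len by auto
  define a where "a xs i j = V.coords B (xs ! i) (bs ! j)" for xs i j
  define D where "D xs = V.leibniz_det n (a xs)" for xs
  have ac: "a xs i j \<in> carrier K" if "xs \<in> ?X" "i < n" "j < n" for xs i j
    using that bsB[of j] by (auto simp: a_def tuples_def intro!: V.free_vs_apply_closed[OF C.T_im])
  have Dc: "D xs \<in> carrier K" if "xs \<in> ?X" for xs
    unfolding D_def V.leibniz_det_def
    using V.leibniz_summand_closed[of n "a xs"] ac[OF that] by (intro V.R.finsum_closed) auto
  have a_upd: "a (xs[i := u]) k j = (if k = i then V.coords B u (bs ! j) else a xs k j)"
    if "xs \<in> ?X" "k < n" for xs i u k j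
    using that by (auto simp: a_def nth_list_update tuples_def)
  have D_add: "D (xs[i := u \<oplus>\<^bsub>V\<^esub> v]) = D (xs[i := u]) \<oplus>\<^bsub>K\<^esub> D (xs[i := v])"
    if h: "xs \<in> ?X" "i < n" "u \<in> carrier V" "v \<in> carrier V" for xs i u v
    unfolding D_def
  proof (rule V.leibniz_det_add[where k = i])
    have *: "a (xs[i := y]) k j \<in> carrier K" if "y \<in> {u, v, u \<oplus>\<^bsub>V\<^esub> v}" "k < n" "j < n" for y k j
      using that h by (intro ac tuples_update) auto
    fix k j assume kj: "k < n" "j < n"
    show "a (xs[i := u \<oplus>\<^bsub>V\<^esub> v]) k j \<in> carrier K" "a (xs[i := u]) k j \<in> carrier K"
      "a (xs[i := v]) k j \<in> carrier K"
      by (rule *[OF _ kj], simp)+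
  qed (use h in \<open>simp_all add: a_upd V.free_vs_add bsB\<close>)
  have D_smult: "D (xs[i := c \<odot>\<^bsub>V\<^esub> u]) = c \<otimes>\<^bsub>K\<^esub> D (xs[i := u])"
    if h: "xs \<in> ?X" "i < n" "c \<in> carrier K" "u \<in> carrier V" for xs i c u
    unfolding D_def
  proof (rule V.leibniz_det_smult[where k = i])
    have *: "a (xs[i := y]) k j \<in> carrier K" if "y \<in> {u, c \<odot>\<^bsub>V\<^esub> u}" "k < n" "j < n" for y k j
      using that h by (intro ac tuples_update) auto
    fix k j assume kj: "k < n" "j < n"
    show "a (xs[i := c \<odot>\<^bsub>V\<^esub> u]) k j \<in> carrier K" "a (xs[i := u]) k j \<in> carrier K"
      by (rule *[OF _ kj], simp)+
  qed (use h in \<open>simp_all add: a_upd V.free_vs_smult bsB\<close>)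
  have D_alt: "D xs = \<zero>\<^bsub>K\<^esub>" if h: "xs \<in> ?X" "i < j" "j < n" "xs ! i = xs ! j" for xs i j
    unfolding D_def
  proof (rule V.leibniz_det_alternating[where i = i and j = j])
    show "a xs k l \<in> carrier K" if "k < n" "l < n" for k l
      using h(1) that by (rule ac)
  qed (use h in \<open>simp_all add: a_def\<close>)
  have D_bs: "D bs = \<one>\<^bsub>K\<^esub>"
    unfolding D_def
  proof (rule V.leibniz_det_identity)
    fix i j assume ij: "i < n" "j < n"
    then show "a bs i j = (if i = j then \<one>\<^bsub>K\<^esub> else \<zero>\<^bsub>K\<^esub>)"
      using V.coords_linear(3)[OF B(2) bsB[OF ij(1)]] bsB bs(2) len
      by (auto simp: a_def V.basis_vec_apply nth_eq_iff_index_eq)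
  qed
  have Dg: "D \<in> ?X \<rightarrow> carrier (self_mod K)"
    using Dc by auto
  define T where "T = free_ext K (self_mod K) ?X D"
  interpret T: linear_map K ?F "self_mod K" T
    unfolding T_def by (rule S.free_ext_linear[OF Dg])
  have Te: "T (?e xs) = D xs" if "xs \<in> ?X" for xs
    unfolding T_def by (rule S.free_ext_basis_vec[OF Dg that])
  have e: "?e xs \<in> carrier ?F" if "xs \<in> ?X" for xs
    using that by (rule V.basis_vec_closed)
  let ?R = "ext_rels K n V"
  let ?N = "F.span ?R"
  have R: "?R \<subseteq> {f \<in> carrier ?F. T f = \<zero>\<^bsub>self_mod K\<^esub>}"
  proof
    fix f assume "f \<in> ?R"
    then consider xs i u v where "xs \<in> ?X" "i < n" "u \<in> carrier V" "v \<in> carrier V"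
        "f = ?e (xs[i := u \<oplus>\<^bsub>V\<^esub> v]) \<ominus>\<^bsub>?F\<^esub> (?e (xs[i := u]) \<oplus>\<^bsub>?F\<^esub> ?e (xs[i := v]))"
      | xs i c u where "xs \<in> ?X" "i < n" "c \<in> carrier K" "u \<in> carrier V"
        "f = ?e (xs[i := c \<odot>\<^bsub>V\<^esub> u]) \<ominus>\<^bsub>?F\<^esub> (c \<odot>\<^bsub>?F\<^esub> ?e (xs[i := u]))"
      | xs i j where "xs \<in> ?X" "i < j" "j < n" "xs ! i = xs ! j" "f = ?e xs"
      unfolding ext_rels_def Let_def by (elim UnE CollectE exE conjE) metis+
    then show "f \<in> {f \<in> carrier ?F. T f = \<zero>\<^bsub>self_mod K\<^esub>}"
    proof cases
      case 1
      then have "T f = D (xs[i := u \<oplus>\<^bsub>V\<^esub> v]) \<ominus>\<^bsub>self_mod K\<^esub> (D (xs[i := u]) \<oplus>\<^bsub>K\<^esub> D (xs[i := v]))"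
        by (simp add: e Te tuples_update)
      also have "\<dots> = \<zero>\<^bsub>self_mod K\<^esub>"
        using 1 Dc by (subst S.minus_other_side) (auto simp: D_add tuples_update)
      finally show ?thesis
        using 1 by (simp add: e tuples_update)
    next
      case 2
      then have "T f = D (xs[i := c \<odot>\<^bsub>V\<^esub> u]) \<ominus>\<^bsub>self_mod K\<^esub> (c \<otimes>\<^bsub>K\<^esub> D (xs[i := u]))"
        by (simp add: e Te tuples_update)
      also have "\<dots> = \<zero>\<^bsub>self_mod K\<^esub>"
        using 2 Dc by (subst S.minus_other_side) (auto simp: D_smult tuples_update)
      finally show ?thesis
        using 2 by (simp add: e tuples_update)
    next
      case 3
      then show ?thesis
        by (simp add: e Te D_alt)
    qed
  qed
  then have Rc: "?R \<subseteq> carrier ?F"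
    by blast
  have N: "subspace K ?N ?F"
    by (rule F.span_subspace[OF Rc])
  have NT: "T f = \<zero>\<^bsub>K\<^esub>" if "f \<in> ?N" for f
    using F.span_minimal[OF T.kernel_subspace R] that by auto
  have RN: "f \<in> ?N" if "f \<in> ?R" for f
    using F.in_own_span[OF Rc] that by blast
  let ?Q = "quot_mod ?F ?N"
  have tq: "ext_power K n V = ?Q"
    by (simp add: ext_power_def Let_def)
  let ?q = "\<lambda>f. ?N +>\<^bsub>?F\<^esub> f"
  interpret Q: vectorspace K ?Q
    by (rule F.quot_vectorspace[OF N])
  interpret q: linear_map K ?F ?Q ?q
    by (rule F.quot_proj_linear[OF N])
  interpret A: alternating_map K V ?Q n "\<lambda>xs. ?q (?e xs)"
  proof unfold_locales
    show "?q (?e xs) \<in> carrier ?Q" if "xs \<in> ?X" for xs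
      using that e by blast
    show "?q (?e (xs[i := u \<oplus>\<^bsub>V\<^esub> v])) = ?q (?e (xs[i := u])) \<oplus>\<^bsub>?Q\<^esub> ?q (?e (xs[i := v]))"
      if h: "xs \<in> ?X" "i < n" "u \<in> carrier V" "v \<in> carrier V" for xs i u v
    proof -
      have "?e (xs[i := u \<oplus>\<^bsub>V\<^esub> v]) \<ominus>\<^bsub>?F\<^esub> (?e (xs[i := u]) \<oplus>\<^bsub>?F\<^esub> ?e (xs[i := v])) \<in> ?N"
        using h by (intro RN ext_relsI(1))
      then have "?q (?e (xs[i := u \<oplus>\<^bsub>V\<^esub> v])) = ?q (?e (xs[i := u]) \<oplus>\<^bsub>?F\<^esub> ?e (xs[i := v]))"
        using h by (subst F.coset_eq_iff[OF N]) (auto simp: e tuples_update)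
      then show ?thesis
        using h by (simp add: e tuples_update)
    qed
    show "?q (?e (xs[i := c \<odot>\<^bsub>V\<^esub> u])) = c \<odot>\<^bsub>?Q\<^esub> ?q (?e (xs[i := u]))"
      if h: "xs \<in> ?X" "i < n" "c \<in> carrier K" "u \<in> carrier V" for xs i c u
    proof -
      have "?e (xs[i := c \<odot>\<^bsub>V\<^esub> u]) \<ominus>\<^bsub>?F\<^esub> (c \<odot>\<^bsub>?F\<^esub> ?e (xs[i := u])) \<in> ?N"
        using h by (intro RN ext_relsI(2))
      then have "?q (?e (xs[i := c \<odot>\<^bsub>V\<^esub> u])) = ?q (c \<odot>\<^bsub>?F\<^esub> ?e (xs[i := u]))"
        using h by (subst F.coset_eq_iff[OF N]) (auto simp: e tuples_update)
      then show ?thesis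
        using h by (simp add: e tuples_update)
    qed
    show "?q (?e xs) = \<zero>\<^bsub>?Q\<^esub>" if h: "xs \<in> ?X" "i < j" "j < n" "xs ! i = xs ! j" for xs i j
    proof -
      have "?e xs \<in> ?N"
        using h by (intro RN ext_relsI(3)[of xs _ _ i j])
      then show ?thesis
        using e h(1) by (simp add: F.quot_zero F.coset_eq_zero_iff[OF N])
    qed
  qed
  let ?l = "?q (?e bs)"
  have l: "?l \<in> carrier ?Q"
    using e[OF bst] by (rule q.T_im)
  have "?l \<noteq> \<zero>\<^bsub>?Q\<^esub>"
  proof
    assume "?l = \<zero>\<^bsub>?Q\<^esub>"
    then have "?e bs \<in> ?N"
      using e[OF bst] by (simp add: F.quot_zero F.coset_eq_zero_iff[OF N])
    then show False
      using NT[of "?e bs"] Te[OF bst] D_bs by simp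
  qed
  moreover have "Q.span {?l} = carrier ?Q"
  proof
    show "Q.span {?l} \<subseteq> carrier ?Q"
      using l by (intro Q.span_is_subset2) simp
    have L: "subspace K (Q.span {?l}) ?Q"
      using l by (intro Q.span_subspace) auto
    have "?e ` ?X \<subseteq> {f \<in> carrier ?F. ?q f \<in> Q.span {?l}}"
      using A.w_in_line[of bs] B(2) bs len e by auto
    then have "carrier ?F \<subseteq> {f \<in> carrier ?F. ?q f \<in> Q.span {?l}}"
      using F.span_minimal[OF q.preimage_subspace[OF L]] V.free_vs_span[of ?X] by blast
    then show "carrier ?Q \<subseteq> Q.span {?l}"
      unfolding F.quot_carrier by blast
  qed
  ultimately show "vectorspace K (ext_power K n V)" "vectorspace.fin_dim K (ext_power K n V)"
    "vectorspace.dim K (ext_power K n V) = 1"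
    unfolding tq using Q.dim1I[of ?l] l Q.vectorspace_axioms
    by (auto simp: Q.fin_dim_def intro!: exI[of _ "{?l}"])
qed

section \<open>Symmetric algebras\<close>

subsection \<open>Polynomial algebras\<close>

lemma finite_submultisets: "finite {d. d \<subseteq># m}"
proof (induction m)
  case (add x m)
  have "{d. d \<subseteq># add_mset x m} \<subseteq> {d. d \<subseteq># m} \<union> add_mset x ` {d. d \<subseteq># m}"
  proof
    fix d assume "d \<in> {d. d \<subseteq># add_mset x m}"
    then have d: "d \<subseteq># add_mset x m"
      by simp
    show "d \<in> {d. d \<subseteq># m} \<union> add_mset x ` {d. d \<subseteq># m}"
    proof (cases "x \<in># d")
      case True
      then obtain d' where "d = add_mset x d'"
        by (metis insert_DiffM)
      then show ?thesis
        using d by auto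
    next
      case False
      then have "d \<subseteq># m"
        using d by (metis diff_single_trivial subset_eq_diff_conv add_mset_add_single)
      then show ?thesis
        by simp
    qed
  qed
  then show ?case
    using add finite_subset by blast
qed simp

locale alg_hom = linear_map K A B H + A: algebra K A + B: algebra K B for K A B H +
  assumes hom_mult: "x \<in> carrier A \<Longrightarrow> y \<in> carrier A \<Longrightarrow> H (x \<otimes>\<^bsub>A\<^esub> y) = H x \<otimes>\<^bsub>B\<^esub> H y"
    and hom_one: "H \<one>\<^bsub>A\<^esub> = \<one>\<^bsub>B\<^esub>"

context field
begin

lemma monomials_mono: "m \<in> monomials W \<Longrightarrow> d \<subseteq># m \<Longrightarrow> d \<in> monomials W"
  using set_mset_mono by (fastforce simp: monomials_def)

lemma monomials_simps [simp]:
  "{#} \<in> monomials W" "a + b \<in> monomials W \<longleftrightarrow> a \<in> monomials W \<and> b \<in> monomials W"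
  "add_mset x a \<in> monomials W \<longleftrightarrow> x \<in> carrier W \<and> a \<in> monomials W"
  by (auto simp: monomials_def)

lemma poly_simps:
  "carrier (poly_alg R W) = carrier (free_vs R (monomials W))"
  "\<zero>\<^bsub>poly_alg R W\<^esub> = \<zero>\<^bsub>free_vs R (monomials W)\<^esub>"
  "f \<oplus>\<^bsub>poly_alg R W\<^esub> g = f \<oplus>\<^bsub>free_vs R (monomials W)\<^esub> g"
  "c \<odot>\<^bsub>poly_alg R W\<^esub> f = c \<odot>\<^bsub>free_vs R (monomials W)\<^esub> f"
  "\<one>\<^bsub>poly_alg R W\<^esub> = basis_vec R (monomials W) {#}"
  by (simp_all add: poly_alg_def)

lemma poly_add_eq: "add (poly_alg R W) = add (free_vs R (monomials W))"
  by (simp add: poly_alg_def)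

lemma poly_vectorspace: "vectorspace R (poly_alg R W)"
  using free_vs_vectorspace[of "monomials W"]
  by (simp add: vectorspace_def module_def module_axioms_def abelian_group_def abelian_monoid_def
      abelian_group_axioms_def poly_simps poly_add_eq)

lemma poly_mult:
  "f \<otimes>\<^bsub>poly_alg R W\<^esub> g = (\<lambda>m\<in>monomials W. \<Oplus>d\<in>{d. d \<subseteq># m}. f d \<otimes> g (m - d))"
  by (simp add: poly_alg_def)

lemma poly_apply_closed: "f \<in> carrier (poly_alg R W) \<Longrightarrow> m \<in> monomials W \<Longrightarrow> d \<subseteq># m \<Longrightarrow> f d \<in> carrier R"
  using monomials_mono by (auto simp: poly_simps intro: free_vs_apply_closed)

lemma poly_apply_closed': "f \<in> carrier (poly_alg R W) \<Longrightarrow> m \<in> monomials W \<Longrightarrow> f (m - d) \<in> carrier R"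
  using poly_apply_closed diff_subset_eq_self by blast

lemma poly_mult_summand:
  assumes "f \<in> carrier (poly_alg R W)" "g \<in> carrier (poly_alg R W)" "m \<in> monomials W"
  shows "(\<lambda>d. f d \<otimes> g (m - d)) \<in> {d. d \<subseteq># m} \<rightarrow> carrier R"
  using poly_apply_closed[OF assms(1,3)] poly_apply_closed'[OF assms(2,3)] by auto

lemma poly_mult_closed:
  assumes f: "f \<in> carrier (poly_alg R W)" and g: "g \<in> carrier (poly_alg R W)"
  shows "f \<otimes>\<^bsub>poly_alg R W\<^esub> g \<in> carrier (poly_alg R W)"
proof -
  let ?s = "\<lambda>f. {m \<in> monomials W. f m \<noteq> \<zero>}"
  let ?p = "f \<otimes>\<^bsub>poly_alg R W\<^esub> g"
  have "?s ?p \<subseteq> (\<lambda>(a, b). a + b) ` (?s f \<times> ?s g)"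
  proof
    fix m assume "m \<in> ?s ?p"
    then have m: "m \<in> monomials W" "?p m \<noteq> \<zero>"
      by auto
    have "\<exists>d. d \<subseteq># m \<and> f d \<otimes> g (m - d) \<noteq> \<zero>"
    proof (rule ccontr)
      assume "\<nexists>d. d \<subseteq># m \<and> f d \<otimes> g (m - d) \<noteq> \<zero>"
      then have "(\<Oplus>d\<in>{d. d \<subseteq># m}. f d \<otimes> g (m - d)) = (\<Oplus>d\<in>{d. d \<subseteq># m}. \<zero>)"
        by (intro finsum_cong') auto
      then show False
        using m by (simp add: poly_mult)
    qed
    then obtain d where d: "d \<subseteq># m" "f d \<otimes> g (m - d) \<noteq> \<zero>"
      by blast
    then have "f d \<noteq> \<zero>" "g (m - d) \<noteq> \<zero>"
      using poly_apply_closed[OF f m(1) d(1)] poly_apply_closed'[OF g m(1), of d] by auto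
    moreover have "d \<in> monomials W" "m - d \<in> monomials W"
      using monomials_mono[OF m(1)] d(1) diff_subset_eq_self by blast+
    moreover have "d + (m - d) = m"
      using d(1) by simp
    ultimately show "m \<in> (\<lambda>(a, b). a + b) ` (?s f \<times> ?s g)"
      by (intro image_eqI[of _ _ "(d, m - d)"]) auto
  qed
  moreover have "finite ((\<lambda>(a, b). a + b) ` (?s f \<times> ?s g))"
    using f g by (auto simp: poly_simps free_vs_carrier)
  ultimately have "finite (?s ?p)"
    using finite_subset by blast
  then show ?thesis
    using poly_mult_summand[OF f g] by (auto simp: poly_simps free_vs_carrier poly_mult intro!: finsum_closed)
qed

lemma poly_mult_add_left:
  assumes "f \<in> carrier (poly_alg R W)" "f' \<in> carrier (poly_alg R W)" "g \<in> carrier (poly_alg R W)"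
  shows "(f \<oplus>\<^bsub>poly_alg R W\<^esub> f') \<otimes>\<^bsub>poly_alg R W\<^esub> g
    = f \<otimes>\<^bsub>poly_alg R W\<^esub> g \<oplus>\<^bsub>poly_alg R W\<^esub> f' \<otimes>\<^bsub>poly_alg R W\<^esub> g"
proof -
  have "(\<Oplus>d\<in>{d. d \<subseteq># m}. (f \<oplus>\<^bsub>poly_alg R W\<^esub> f') d \<otimes> g (m - d))
      = (\<Oplus>d\<in>{d. d \<subseteq># m}. f d \<otimes> g (m - d)) \<oplus> (\<Oplus>d\<in>{d. d \<subseteq># m}. f' d \<otimes> g (m - d))"
    if m: "m \<in> monomials W" for m
  proof -
    have "(\<Oplus>d\<in>{d. d \<subseteq># m}. (f \<oplus>\<^bsub>poly_alg R W\<^esub> f') d \<otimes> g (m - d))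
        = (\<Oplus>d\<in>{d. d \<subseteq># m}. f d \<otimes> g (m - d) \<oplus> f' d \<otimes> g (m - d))"
      using poly_apply_closed[OF assms(1) m] poly_apply_closed[OF assms(2) m]
        poly_apply_closed'[OF assms(3) m] monomials_mono[OF m]
      by (intro finsum_cong') (auto simp: poly_simps(3) free_vs_add l_distr)
    then show ?thesis
      using poly_mult_summand[OF assms(1,3) m] poly_mult_summand[OF assms(2,3) m]
      by (simp add: finsum_addf)
  qed
  then show ?thesis
    by (auto simp: poly_mult poly_simps(3) free_vs_add intro!: restrict_ext)
qed

lemma poly_mult_smult_left:
  assumes "c \<in> carrier R" "f \<in> carrier (poly_alg R W)" "g \<in> carrier (poly_alg R W)"
  shows "(c \<odot>\<^bsub>poly_alg R W\<^esub> f) \<otimes>\<^bsub>poly_alg R W\<^esub> g = c \<odot>\<^bsub>poly_alg R W\<^esub> (f \<otimes>\<^bsub>poly_alg R W\<^esub> g)"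
proof -
  have "(\<Oplus>d\<in>{d. d \<subseteq># m}. (c \<odot>\<^bsub>poly_alg R W\<^esub> f) d \<otimes> g (m - d))
      = c \<otimes> (\<Oplus>d\<in>{d. d \<subseteq># m}. f d \<otimes> g (m - d))"
    if m: "m \<in> monomials W" for m
  proof -
    have "(\<Oplus>d\<in>{d. d \<subseteq># m}. (c \<odot>\<^bsub>poly_alg R W\<^esub> f) d \<otimes> g (m - d))
        = (\<Oplus>d\<in>{d. d \<subseteq># m}. c \<otimes> (f d \<otimes> g (m - d)))"
      using poly_apply_closed[OF assms(2) m] poly_apply_closed'[OF assms(3) m] monomials_mono[OF m] assms(1)
      by (intro finsum_cong') (auto simp: poly_simps(4) free_vs_smult m_assoc)
    then show ?thesis
      using finsum_rdistr[OF finite_submultisets assms(1) poly_mult_summand[OF assms(2,3) m]] by simp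
  qed
  then show ?thesis
    by (auto simp: poly_mult poly_simps(4) free_vs_smult intro!: restrict_ext)
qed

lemma poly_mult_comm:
  assumes "f \<in> carrier (poly_alg R W)" "g \<in> carrier (poly_alg R W)"
  shows "f \<otimes>\<^bsub>poly_alg R W\<^esub> g = g \<otimes>\<^bsub>poly_alg R W\<^esub> f"
proof -
  have "(\<Oplus>d\<in>{d. d \<subseteq># m}. f d \<otimes> g (m - d)) = (\<Oplus>d\<in>{d. d \<subseteq># m}. g d \<otimes> f (m - d))"
    if m: "m \<in> monomials W" for m
  proof -
    have im: "(\<lambda>d. m - d) ` {d. d \<subseteq># m} = {d. d \<subseteq># m}"
    proof (intro equalityI subsetI)
      fix d assume "d \<in> {d. d \<subseteq># m}"
      then have "d = m - (m - d)"
        by (simp add: multiset_eq_iff mset_subset_eq_count)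
      then show "d \<in> (\<lambda>d. m - d) ` {d. d \<subseteq># m}"
        using diff_subset_eq_self by blast
    qed auto
    have inj: "inj_on (\<lambda>d. m - d) {d. d \<subseteq># m}"
      by (rule inj_on_inverseI[where g = "\<lambda>d. m - d"]) (auto simp: multiset_eq_iff mset_subset_eq_count)
    have "(\<Oplus>d\<in>{d. d \<subseteq># m}. f d \<otimes> g (m - d)) = (\<Oplus>d\<in>(\<lambda>d. m - d) ` {d. d \<subseteq># m}. f d \<otimes> g (m - d))"
      by (simp only: im)
    also have "\<dots> = (\<Oplus>d\<in>{d. d \<subseteq># m}. f (m - d) \<otimes> g (m - (m - d)))"
      using poly_mult_summand[OF assms m] im inj by (intro finsum_reindex) auto
    also have "\<dots> = (\<Oplus>d\<in>{d. d \<subseteq># m}. g d \<otimes> f (m - d))"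
    proof (rule finsum_cong')
      fix d assume "d \<in> {d. d \<subseteq># m}"
      then have "d \<subseteq># m" "m - (m - d) = d"
        by (auto simp: multiset_eq_iff mset_subset_eq_count)
      then show "f (m - d) \<otimes> g (m - (m - d)) = g d \<otimes> f (m - d)"
        using poly_apply_closed[OF assms(2) m] poly_apply_closed'[OF assms(1) m] by (simp add: m_comm)
    qed (use poly_mult_summand[OF assms(2,1) m] in auto)
    finally show ?thesis .
  qed
  then show ?thesis
    by (auto simp: poly_mult intro!: restrict_ext)
qed

lemma poly_var_mult_apply:
  assumes "g \<in> carrier (poly_alg R W)" "a \<in> monomials W" "m \<in> monomials W"
  shows "(basis_vec R (monomials W) a \<otimes>\<^bsub>poly_alg R W\<^esub> g) m = (if a \<subseteq># m then g (m - a) else \<zero>)"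
proof -
  have "(basis_vec R (monomials W) a \<otimes>\<^bsub>poly_alg R W\<^esub> g) m
      = (\<Oplus>d\<in>{d. d \<subseteq># m}. if a = d then g (m - d) else \<zero>)"
    unfolding poly_mult using assms poly_apply_closed'[OF assms(1,3)] monomials_mono[OF assms(3)]
    by (auto simp: basis_vec_apply intro!: finsum_cong')
  also have "\<dots> = (if a \<subseteq># m then g (m - a) else \<zero>)"
  proof (cases "a \<subseteq># m")
    case True
    then show ?thesis
      using finsum_singleton[of a "{d. d \<subseteq># m}" "\<lambda>d. g (m - d)"] finite_submultisets
        poly_apply_closed'[OF assms(1,3)] by auto
  next
    case False
    then have "(\<Oplus>d\<in>{d. d \<subseteq># m}. if a = d then g (m - d) else \<zero>) = (\<Oplus>d\<in>{d. d \<subseteq># m}. \<zero>)"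
      by (intro finsum_cong') auto
    then show ?thesis
      using False by simp
  qed
  finally show ?thesis .
qed

lemma poly_basis_mult:
  assumes "a \<in> monomials W" "b \<in> monomials W"
  shows "basis_vec R (monomials W) a \<otimes>\<^bsub>poly_alg R W\<^esub> basis_vec R (monomials W) b
    = basis_vec R (monomials W) (a + b)"
proof (rule free_vs_ext)
  have c: "basis_vec R (monomials W) m \<in> carrier (poly_alg R W)" if "m \<in> monomials W" for m
    using that by (simp add: poly_simps basis_vec_closed)
  show "basis_vec R (monomials W) a \<otimes>\<^bsub>poly_alg R W\<^esub> basis_vec R (monomials W) b
      \<in> carrier (free_vs R (monomials W))"
    using poly_mult_closed[OF c c] assms by (simp add: poly_simps)
  show "basis_vec R (monomials W) (a + b) \<in> carrier (free_vs R (monomials W))"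
    using assms by (simp add: basis_vec_closed)
  fix m assume m: "m \<in> monomials W"
  have "a \<subseteq># m \<and> m - a = b \<longleftrightarrow> m = a + b"
    by auto
  moreover have "m - a \<in> monomials W"
    using m monomials_mono diff_subset_eq_self by blast
  ultimately show "(basis_vec R (monomials W) a \<otimes>\<^bsub>poly_alg R W\<^esub> basis_vec R (monomials W) b) m
      = basis_vec R (monomials W) (a + b) m"
    using m by (subst poly_var_mult_apply[OF c[OF assms(2)] assms(1) m]) (auto simp: basis_vec_apply)
qed

text \<open>Associativity is immediate for monomials and extends by linearity in one factor at a
  time, from the right factor to the left one.\<close>

lemma poly_algebra: "algebra R (poly_alg R W)"
proof -
  let ?P = "poly_alg R W" and ?e = "basis_vec R (monomials W)"
  interpret P: vectorspace R ?P
    by (rule poly_vectorspace)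
  note closed = poly_mult_closed[of _ W]
  have e: "?e m \<in> carrier ?P" if "m \<in> monomials W" for m
    using that by (simp add: poly_simps basis_vec_closed)
  have smult_r: "f \<otimes>\<^bsub>?P\<^esub> (c \<odot>\<^bsub>?P\<^esub> g) = c \<odot>\<^bsub>?P\<^esub> (f \<otimes>\<^bsub>?P\<^esub> g)"
    if "c \<in> carrier R" "f \<in> carrier ?P" "g \<in> carrier ?P" for c f g
    using that poly_mult_comm[of f W] poly_mult_smult_left[of c g W f] by simp
  have add_r: "f \<otimes>\<^bsub>?P\<^esub> (g \<oplus>\<^bsub>?P\<^esub> h) = f \<otimes>\<^bsub>?P\<^esub> g \<oplus>\<^bsub>?P\<^esub> f \<otimes>\<^bsub>?P\<^esub> h"
    if "f \<in> carrier ?P" "g \<in> carrier ?P" "h \<in> carrier ?P" for f g h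
    using that poly_mult_comm[of f W] poly_mult_add_left[of g W h f] by simp
  have lin_l: "linear_map R ?P ?P (\<lambda>f. f \<otimes>\<^bsub>?P\<^esub> g)" if "g \<in> carrier ?P" for g
    using that by (intro linear_mapI P.vectorspace_axioms closed poly_mult_add_left poly_mult_smult_left)
  have lin_r: "linear_map R ?P ?P (\<lambda>f. g \<otimes>\<^bsub>?P\<^esub> f)" if "g \<in> carrier ?P" for g
    using that by (intro linear_mapI P.vectorspace_axioms closed add_r smult_r)
  have sp: "f \<in> P.span (?e ` monomials W)" if "f \<in> carrier ?P" for f
  proof -
    have eP: "?e ` monomials W \<subseteq> carrier ?P"
      using e by blast
    note S = P.subspaceD[OF P.span_subspace[OF eP]]
    have "f \<in> carrier (free_vs R (monomials W))"
      using that by (simp add: poly_simps)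
    then show ?thesis
      by (induction rule: free_vs_induct)
        (use S P.in_own_span[OF eP] in \<open>auto simp: poly_simps(2-4)[of W, symmetric]\<close>)
  qed
  have eP: "?e ` monomials W \<subseteq> carrier ?P"
    using e by blast
  have assoc0: "(?e a \<otimes>\<^bsub>?P\<^esub> ?e b) \<otimes>\<^bsub>?P\<^esub> ?e c = ?e a \<otimes>\<^bsub>?P\<^esub> (?e b \<otimes>\<^bsub>?P\<^esub> ?e c)"
    if "a \<in> monomials W" "b \<in> monomials W" "c \<in> monomials W" for a b c
    using that by (simp add: poly_basis_mult add.assoc)
  have assoc1: "(?e a \<otimes>\<^bsub>?P\<^esub> ?e b) \<otimes>\<^bsub>?P\<^esub> h = ?e a \<otimes>\<^bsub>?P\<^esub> (?e b \<otimes>\<^bsub>?P\<^esub> h)"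
    if "a \<in> monomials W" "b \<in> monomials W" "h \<in> carrier ?P" for a b h
    by (rule P.linear_eq_on_span[OF lin_r[OF closed[OF e[OF that(1)] e[OF that(2)]]]
          linear_map_compose[OF lin_r[OF e[OF that(2)]] lin_r[OF e[OF that(1)]]] eP _ sp[OF that(3)]])
      (auto simp: assoc0 that)
  have assoc2: "(?e a \<otimes>\<^bsub>?P\<^esub> g) \<otimes>\<^bsub>?P\<^esub> h = ?e a \<otimes>\<^bsub>?P\<^esub> (g \<otimes>\<^bsub>?P\<^esub> h)"
    if "a \<in> monomials W" "g \<in> carrier ?P" "h \<in> carrier ?P" for a g h
    by (rule P.linear_eq_on_span[OF linear_map_compose[OF lin_r[OF e[OF that(1)]] lin_l[OF that(3)]]
          linear_map_compose[OF lin_l[OF that(3)] lin_r[OF e[OF that(1)]]] eP _ sp[OF that(2)]])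
      (auto simp: assoc1 that)
  have assoc: "(f \<otimes>\<^bsub>?P\<^esub> g) \<otimes>\<^bsub>?P\<^esub> h = f \<otimes>\<^bsub>?P\<^esub> (g \<otimes>\<^bsub>?P\<^esub> h)"
    if "f \<in> carrier ?P" "g \<in> carrier ?P" "h \<in> carrier ?P" for f g h
    by (rule P.linear_eq_on_span[OF linear_map_compose[OF lin_l[OF that(2)] lin_l[OF that(3)]]
          lin_l[OF closed[OF that(2,3)]] eP _ sp[OF that(1)]])
      (auto simp: assoc2 that)
  have one: "?e {#} \<otimes>\<^bsub>?P\<^esub> f = f" if "f \<in> carrier ?P" for f
  proof (rule free_vs_ext)
    show "?e {#} \<otimes>\<^bsub>?P\<^esub> f \<in> carrier (free_vs R (monomials W))" "f \<in> carrier (free_vs R (monomials W))"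
      using closed[OF e[of "{#}"] that] that by (auto simp: poly_simps)
    show "(?e {#} \<otimes>\<^bsub>?P\<^esub> f) m = f m" if "m \<in> monomials W" for m
      using poly_var_mult_apply[OF \<open>f \<in> carrier ?P\<close> _ that, of "{#}"] by simp
  qed
  have "cring ?P"
  proof (rule cringI)
    show "abelian_group ?P"
      by (rule P.M.abelian_group_axioms)
    show "comm_monoid ?P"
      using closed assoc one e[of "{#}"] poly_mult_comm[of _ W]
      by (intro comm_monoidI) (auto simp: poly_simps(5))
    show "(x \<oplus>\<^bsub>?P\<^esub> y) \<otimes>\<^bsub>?P\<^esub> z = x \<otimes>\<^bsub>?P\<^esub> z \<oplus>\<^bsub>?P\<^esub> y \<otimes>\<^bsub>?P\<^esub> z"
      if "x \<in> carrier ?P" "y \<in> carrier ?P" "z \<in> carrier ?P" for x y z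
      using that by (rule poly_mult_add_left)
  qed
  then show ?thesis
    using poly_mult_smult_left[of _ _ W]
    by (intro algebra.intro algebra_axioms.intro P.module_axioms) auto
qed

end

text \<open>Evaluation of a monomial. The powers are products over the finite support, so that no
  order of the factors has to be chosen.\<close>

definition eval_mono :: "('c, 'n) ring_scheme \<Rightarrow> ('w \<Rightarrow> 'c) \<Rightarrow> 'w multiset \<Rightarrow> 'c" where
  "eval_mono C g m = (\<Otimes>\<^bsub>C\<^esub>x\<in>set_mset m. g x [^]\<^bsub>C\<^esub> count m x)"

context cring
begin

lemma eval_mono_closed: "g \<in> set_mset m \<rightarrow> carrier R \<Longrightarrow> eval_mono R g m \<in> carrier R"
  unfolding eval_mono_def by (intro finprod_closed) auto

lemma eval_mono_empty: "eval_mono R g {#} = \<one>"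
  by (simp add: eval_mono_def)

text \<open>Lets monomials with different supports be evaluated over one index set, as
  multiplicativity requires; the extra powers have exponent zero.\<close>

lemma eval_mono_superset:
  assumes "g \<in> A \<rightarrow> carrier R" "finite A" "set_mset m \<subseteq> A"
  shows "eval_mono R g m = (\<Otimes>x\<in>A. g x [^] count m x)"
  unfolding eval_mono_def
  using assms by (intro finprod_mono_neutral_cong_left) (auto simp: not_in_iff Pi_iff)

lemma eval_mono_add:
  assumes "g \<in> set_mset m \<union> set_mset m' \<rightarrow> carrier R"
  shows "eval_mono R g (m + m') = eval_mono R g m \<otimes> eval_mono R g m'"
proof -
  let ?A = "set_mset m \<union> set_mset m'"
  have "eval_mono R g (m + m') = (\<Otimes>x\<in>?A. g x [^] count m x \<otimes> g x [^] count m' x)"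
    unfolding eval_mono_def using assms by (intro finprod_cong') (auto simp: nat_pow_mult Pi_iff)
  also have "\<dots> = (\<Otimes>x\<in>?A. g x [^] count m x) \<otimes> (\<Otimes>x\<in>?A. g x [^] count m' x)"
    using assms by (intro finprod_multf) auto
  also have "(\<Otimes>x\<in>?A. g x [^] count m x) = eval_mono R g m"
    using assms by (intro eval_mono_superset[symmetric]) auto
  also have "(\<Otimes>x\<in>?A. g x [^] count m' x) = eval_mono R g m'"
    using assms by (intro eval_mono_superset[symmetric]) auto
  finally show ?thesis .
qed

lemma eval_mono_single: "g x \<in> carrier R \<Longrightarrow> eval_mono R g {#x#} = g x"
  by (simp add: eval_mono_def)

end

subsection \<open>The universal property\<close>

lemma (in algebra) mult_smult_right:
  assumes "c \<in> carrier R" "x \<in> carrier M" "y \<in> carrier M"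
  shows "x \<otimes>\<^bsub>M\<^esub> (c \<odot>\<^bsub>M\<^esub> y) = c \<odot>\<^bsub>M\<^esub> (x \<otimes>\<^bsub>M\<^esub> y)"
  using assms smult_assoc2[of c y x] by (simp add: m_comm)

lemma mult_left_linear:
  assumes "algebra K A" "field K" "x \<in> carrier A"
  shows "linear_map K A A (\<lambda>y. x \<otimes>\<^bsub>A\<^esub> y)"
proof -
  interpret A: algebra K A by fact
  interpret A: vectorspace K A
    by (rule vectorspace.intro[OF A.module assms(2)])
  show ?thesis
    using assms(3) by (intro linear_mapI A.vectorspace_axioms) (auto simp: A.r_distr A.mult_smult_right)
qed

lemma (in field) poly_alg_span:
  "module.span R (poly_alg R W) (basis_vec R (monomials W) ` monomials W) = carrier (poly_alg R W)"
proof -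
  interpret Q: vectorspace R "poly_alg R W"
    by (rule poly_vectorspace)
  have sub: "basis_vec R (monomials W) ` monomials W \<subseteq> carrier (poly_alg R W)"
    by (auto simp: poly_simps basis_vec_closed)
  note S = Q.subspaceD[OF Q.span_subspace[OF sub]]
  have "f \<in> Q.span (basis_vec R (monomials W) ` monomials W)" if "f \<in> carrier (free_vs R (monomials W))" for f
    using that
    by (induction rule: free_vs_induct)
      (use S Q.in_own_span[OF sub] in \<open>auto simp: poly_simps(2-4)[of W, symmetric]\<close>)
  then show ?thesis
    using S(1) by (auto simp: poly_simps)
qed

context vectorspace
begin

abbreviation "\<P> \<equiv> poly_alg K V"
abbreviation "\<X> \<equiv> basis_vec K (monomials V)"
abbreviation "\<J> \<equiv> sym_ideal K V"

interpretation P: algebra K \<P>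
  by (rule poly_algebra)

interpretation P: vectorspace K \<P>
  by (rule poly_vectorspace)

lemma poly_basis_closed: "m \<in> monomials V \<Longrightarrow> \<X> m \<in> carrier \<P>"
  by (simp add: poly_simps basis_vec_closed)

lemma poly_basis_image: "\<X> ` monomials V \<subseteq> carrier \<P>"
  using poly_basis_closed by blast

lemma poly_span: "P.span (\<X> ` monomials V) = carrier \<P>"
  by (rule poly_alg_span)

definition sym_gens :: "('c multiset \<Rightarrow> 'a) set" where
  "sym_gens = {\<X> {#u \<oplus>\<^bsub>V\<^esub> v#} \<ominus>\<^bsub>\<P>\<^esub> (\<X> {#u#} \<oplus>\<^bsub>\<P>\<^esub> \<X> {#v#}) | u v. u \<in> carrier V \<and> v \<in> carrier V} \<union>
     {\<X> {#c \<odot>\<^bsub>V\<^esub> u#} \<ominus>\<^bsub>\<P>\<^esub> (c \<odot>\<^bsub>\<P>\<^esub> \<X> {#u#}) | c u. c \<in> carrier K \<and> u \<in> carrier V}"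

lemma var_closed: "w \<in> carrier V \<Longrightarrow> \<X> {#w#} \<in> carrier \<P>"
  by (rule poly_basis_closed) simp

lemma sym_gens_closed: "sym_gens \<subseteq> carrier \<P>"
  by (auto simp: sym_gens_def intro!: P.M.minus_closed P.M.a_closed P.smult_closed var_closed)

lemma sym_ideal_eq: "\<J> = Idl\<^bsub>\<P>\<^esub> sym_gens"
  by (simp add: sym_ideal_def sym_gens_def Let_def)

lemma sym_ideal_ideal: "ideal \<J> \<P>"
  unfolding sym_ideal_eq by (rule P.genideal_ideal[OF sym_gens_closed])

text \<open>A scalar acts on an algebra as multiplication by its multiple of the unit, so ideals are
  closed under scalars and the results on quotients of vector spaces apply.\<close>

lemma sym_ideal_subspace: "subspace K \<J> \<P>"
proof -
  interpret J: ideal \<J> \<P>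
    by (rule sym_ideal_ideal)
  have "c \<odot>\<^bsub>\<P>\<^esub> x \<in> \<J>" if "c \<in> carrier K" "x \<in> \<J>" for c x
  proof -
    have "x \<in> carrier \<P>"
      using that J.a_subset by blast
    then have "c \<odot>\<^bsub>\<P>\<^esub> x = (c \<odot>\<^bsub>\<P>\<^esub> \<one>\<^bsub>\<P>\<^esub>) \<otimes>\<^bsub>\<P>\<^esub> x"
      using that P.smult_assoc2[of c "\<one>\<^bsub>\<P>\<^esub>" x] by simp
    then show ?thesis
      using that J.I_l_closed by simp
  qed
  then show ?thesis
    using J.a_subset by (intro P.subspaceI) auto
qed

lemma sym_alg_eq: "sym_alg K V = quot_mod \<P> \<J>"
  by (simp add: sym_alg_def)

lemma sym_vectorspace: "vectorspace K (sym_alg K V)"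
  unfolding sym_alg_eq by (rule P.quot_vectorspace[OF sym_ideal_subspace])

lemma sym_carrier: "carrier (sym_alg K V) = (\<lambda>x. \<J> +>\<^bsub>\<P>\<^esub> x) ` carrier \<P>"
  unfolding sym_alg_eq by (rule P.quot_carrier)

lemma sym_proj_linear: "linear_map K \<P> (sym_alg K V) (\<lambda>x. \<J> +>\<^bsub>\<P>\<^esub> x)"
  unfolding sym_alg_eq by (rule P.quot_proj_linear[OF sym_ideal_subspace])

lemma sym_mult:
  assumes "x \<in> carrier \<P>" "y \<in> carrier \<P>"
  shows "(\<J> +>\<^bsub>\<P>\<^esub> x) \<otimes>\<^bsub>sym_alg K V\<^esub> (\<J> +>\<^bsub>\<P>\<^esub> y) = \<J> +>\<^bsub>\<P>\<^esub> (x \<otimes>\<^bsub>\<P>\<^esub> y)"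
  using ideal.rcoset_mult_add[OF sym_ideal_ideal assms]
  by (simp add: sym_alg_eq quot_mod_def FactRing_def ring.defs module.defs)

lemma sym_one: "\<one>\<^bsub>sym_alg K V\<^esub> = \<J> +>\<^bsub>\<P>\<^esub> \<one>\<^bsub>\<P>\<^esub>"
  by (simp add: sym_alg_eq quot_mod_def FactRing_def ring.defs module.defs)

lemma sym_algebra: "algebra K (sym_alg K V)"
proof -
  let ?S = "sym_alg K V"
  interpret S: vectorspace K ?S
    by (rule sym_vectorspace)
  interpret q: linear_map K \<P> ?S "\<lambda>x. \<J> +>\<^bsub>\<P>\<^esub> x"
    by (rule sym_proj_linear)
  have q: "\<exists>x\<in>carrier \<P>. Y = \<J> +>\<^bsub>\<P>\<^esub> x" if "Y \<in> carrier ?S" for Y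
    using that by (auto simp: sym_carrier)
  have "comm_monoid ?S"
  proof (rule comm_monoidI)
    show "\<one>\<^bsub>?S\<^esub> \<in> carrier ?S"
      unfolding sym_one by (rule q.T_im) simp
    show "x \<otimes>\<^bsub>?S\<^esub> y \<in> carrier ?S" if "x \<in> carrier ?S" "y \<in> carrier ?S" for x y
    proof -
      obtain a b where ab: "a \<in> carrier \<P>" "b \<in> carrier \<P>" "x = \<J> +>\<^bsub>\<P>\<^esub> a" "y = \<J> +>\<^bsub>\<P>\<^esub> b"
        using q[OF \<open>x \<in> carrier ?S\<close>] q[OF \<open>y \<in> carrier ?S\<close>] by blast
      then show ?thesis
        using q.T_im[of "a \<otimes>\<^bsub>\<P>\<^esub> b"] by (simp add: sym_mult)
    qed
    show "x \<otimes>\<^bsub>?S\<^esub> y \<otimes>\<^bsub>?S\<^esub> z = x \<otimes>\<^bsub>?S\<^esub> (y \<otimes>\<^bsub>?S\<^esub> z)"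
      if "x \<in> carrier ?S" "y \<in> carrier ?S" "z \<in> carrier ?S" for x y z
      using q[OF that(1)] q[OF that(2)] q[OF that(3)] by (auto simp: sym_mult P.m_assoc)
    show "\<one>\<^bsub>?S\<^esub> \<otimes>\<^bsub>?S\<^esub> x = x" if "x \<in> carrier ?S" for x
      using q[OF that] by (auto simp: sym_one sym_mult)
    show "x \<otimes>\<^bsub>?S\<^esub> y = y \<otimes>\<^bsub>?S\<^esub> x" if "x \<in> carrier ?S" "y \<in> carrier ?S" for x y
      using q[OF that(1)] q[OF that(2)] by (auto simp: sym_mult P.m_comm)
  qed
  moreover have "(x \<oplus>\<^bsub>?S\<^esub> y) \<otimes>\<^bsub>?S\<^esub> z = x \<otimes>\<^bsub>?S\<^esub> z \<oplus>\<^bsub>?S\<^esub> y \<otimes>\<^bsub>?S\<^esub> z"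
    if xyz: "x \<in> carrier ?S" "y \<in> carrier ?S" "z \<in> carrier ?S" for x y z
  proof -
    obtain a b c where abc: "a \<in> carrier \<P>" "b \<in> carrier \<P>" "c \<in> carrier \<P>"
        "x = \<J> +>\<^bsub>\<P>\<^esub> a" "y = \<J> +>\<^bsub>\<P>\<^esub> b" "z = \<J> +>\<^bsub>\<P>\<^esub> c"
      using q[OF xyz(1)] q[OF xyz(2)] q[OF xyz(3)] by blast
    then show ?thesis
      by (simp add: sym_mult q.T_add[symmetric] P.l_distr del: q.T_add)
  qed
  ultimately have "cring ?S"
    by (intro cringI S.M.abelian_group_axioms)
  moreover have "(c \<odot>\<^bsub>?S\<^esub> x) \<otimes>\<^bsub>?S\<^esub> y = c \<odot>\<^bsub>?S\<^esub> (x \<otimes>\<^bsub>?S\<^esub> y)"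
    if cxy: "c \<in> carrier K" "x \<in> carrier ?S" "y \<in> carrier ?S" for c x y
  proof -
    obtain a b where ab: "a \<in> carrier \<P>" "b \<in> carrier \<P>" "x = \<J> +>\<^bsub>\<P>\<^esub> a" "y = \<J> +>\<^bsub>\<P>\<^esub> b"
      using q[OF cxy(2)] q[OF cxy(3)] by blast
    then show ?thesis
      using cxy(1) by (simp add: sym_mult q.T_smult[symmetric] P.smult_assoc2 del: q.T_smult)
  qed
  ultimately show ?thesis
    by (intro algebra.intro algebra_axioms.intro S.module_axioms)
qed

lemma sym_incl_eq: "sym_incl K V w = \<J> +>\<^bsub>\<P>\<^esub> \<X> {#w#}"
  by (simp add: sym_incl_def)

lemma sym_incl_linear: "linear_map K V (sym_alg K V) (sym_incl K V)"
proof (rule linear_mapI)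
  let ?S = "sym_alg K V"
  interpret q: linear_map K \<P> ?S "\<lambda>x. \<J> +>\<^bsub>\<P>\<^esub> x"
    by (rule sym_proj_linear)
  have gen: "g \<in> \<J>" if "g \<in> sym_gens" for g
    unfolding sym_ideal_eq using P.genideal_self[OF sym_gens_closed] that by blast
  show "sym_incl K V v \<in> carrier ?S" if "v \<in> carrier V" for v
    unfolding sym_incl_eq using q.T_im[OF var_closed[OF that]] .
  show "sym_incl K V (u \<oplus>\<^bsub>V\<^esub> v) = sym_incl K V u \<oplus>\<^bsub>?S\<^esub> sym_incl K V v"
    if uv: "u \<in> carrier V" "v \<in> carrier V" for u v
  proof -
    have "\<X> {#u \<oplus>\<^bsub>V\<^esub> v#} \<ominus>\<^bsub>\<P>\<^esub> (\<X> {#u#} \<oplus>\<^bsub>\<P>\<^esub> \<X> {#v#}) \<in> \<J>"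
      using uv by (intro gen) (auto simp only: sym_gens_def)
    then have "\<J> +>\<^bsub>\<P>\<^esub> \<X> {#u \<oplus>\<^bsub>V\<^esub> v#} = \<J> +>\<^bsub>\<P>\<^esub> (\<X> {#u#} \<oplus>\<^bsub>\<P>\<^esub> \<X> {#v#})"
      using uv by (subst P.coset_eq_iff[OF sym_ideal_subspace]) (auto simp: var_closed)
    then show ?thesis
      using uv by (simp add: sym_incl_eq var_closed)
  qed
  show "sym_incl K V (c \<odot>\<^bsub>V\<^esub> u) = c \<odot>\<^bsub>?S\<^esub> sym_incl K V u" if cu: "c \<in> carrier K" "u \<in> carrier V" for c u
  proof -
    have "\<X> {#c \<odot>\<^bsub>V\<^esub> u#} \<ominus>\<^bsub>\<P>\<^esub> (c \<odot>\<^bsub>\<P>\<^esub> \<X> {#u#}) \<in> \<J>"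
      using cu by (intro gen) (auto simp only: sym_gens_def)
    then have "\<J> +>\<^bsub>\<P>\<^esub> \<X> {#c \<odot>\<^bsub>V\<^esub> u#} = \<J> +>\<^bsub>\<P>\<^esub> (c \<odot>\<^bsub>\<P>\<^esub> \<X> {#u#})"
      using cu by (subst P.coset_eq_iff[OF sym_ideal_subspace]) (auto simp: var_closed)
    then show ?thesis
      using cu by (simp add: sym_incl_eq var_closed)
  qed
qed (rule vectorspace_axioms sym_vectorspace)+

text \<open>Serves as induction over the symmetric algebra: monomials are reached from the unit by
  multiplying with vectors, and their classes span.\<close>

lemma sym_generated:
  assumes N: "subspace K N (sym_alg K V)" and one: "\<one>\<^bsub>sym_alg K V\<^esub> \<in> N"
    and mult: "\<And>w f. w \<in> carrier V \<Longrightarrow> f \<in> N \<Longrightarrow> sym_incl K V w \<otimes>\<^bsub>sym_alg K V\<^esub> f \<in> N"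
  shows "N = carrier (sym_alg K V)"
proof
  let ?S = "sym_alg K V"
  interpret S: vectorspace K ?S
    by (rule sym_vectorspace)
  interpret q: linear_map K \<P> ?S "\<lambda>x. \<J> +>\<^bsub>\<P>\<^esub> x"
    by (rule sym_proj_linear)
  show "N \<subseteq> carrier ?S"
    by (rule S.subspaceD(1)[OF N])
  have "\<J> +>\<^bsub>\<P>\<^esub> \<X> m \<in> N" if "m \<in> monomials V" for m
    using that
  proof (induction m)
    case empty
    then show ?case
      using one by (simp add: sym_one poly_simps)
  next
    case (add x m)
    then have x: "x \<in> carrier V" "m \<in> monomials V"
      by auto
    have "\<J> +>\<^bsub>\<P>\<^esub> \<X> (add_mset x m) = \<J> +>\<^bsub>\<P>\<^esub> (\<X> {#x#} \<otimes>\<^bsub>\<P>\<^esub> \<X> m)"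
      using x by (subst poly_basis_mult) auto
    also have "\<dots> = sym_incl K V x \<otimes>\<^bsub>?S\<^esub> (\<J> +>\<^bsub>\<P>\<^esub> \<X> m)"
      using x by (simp add: sym_mult sym_incl_eq var_closed poly_basis_closed)
    finally show ?case
      using mult[OF x(1)] add.IH[OF x(2)] by simp
  qed
  then have "\<X> ` monomials V \<subseteq> {x \<in> carrier \<P>. \<J> +>\<^bsub>\<P>\<^esub> x \<in> N}"
    using poly_basis_closed by blast
  then have "carrier \<P> \<subseteq> {x \<in> carrier \<P>. \<J> +>\<^bsub>\<P>\<^esub> x \<in> N}"
    using P.span_minimal[OF q.preimage_subspace[OF N]] poly_span by blast
  then show "carrier ?S \<subseteq> N"
    unfolding sym_carrier by blast
qed

text \<open>The universal property of the polynomial algebra. The map is fixed on monomials and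
  extended linearly; multiplicativity holds for monomials and is carried over to one factor after
  the other.\<close>

lemma poly_eval_exists:
  assumes C: "algebra K C" and f: "f \<in> carrier V \<rightarrow> carrier C"
  shows "\<exists>E. alg_hom K \<P> C E \<and> (\<forall>w\<in>carrier V. E (\<X> {#w#}) = f w)
    \<and> (\<forall>w\<in>carrier V. \<forall>m\<in>monomials V. E (\<X> (add_mset w m)) = f w \<otimes>\<^bsub>C\<^esub> E (\<X> m))"
proof -
  interpret C: algebra K C
    by (rule C)
  interpret C: vectorspace K C
    by (rule vectorspace.intro[OF C.module field_axioms])
  have cr: "cring C"
    by (rule C.M_cring)
  let ?F = "free_vs K (monomials V)"
  let ?g = "eval_mono C f"
  define E where "E = free_ext K C (monomials V) ?g"
  have fm: "f \<in> set_mset m \<rightarrow> carrier C" if "m \<in> monomials V" for m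
    using that f by (auto simp: monomials_def)
  have g: "?g \<in> monomials V \<rightarrow> carrier C"
    using cring.eval_mono_closed[OF cr fm] by auto
  interpret E0: linear_map K ?F C E
    unfolding E_def by (rule C.free_ext_linear[OF g])
  interpret E: linear_map K \<P> C E
    using E0.T_add E0.T_smult E0.T_im
    by (intro linear_mapI P.vectorspace_axioms C.vectorspace_axioms) (auto simp: poly_simps)
  have EX: "E (\<X> m) = ?g m" if "m \<in> monomials V" for m
    unfolding E_def by (rule C.free_ext_basis_vec[OF g that])
  have gadd: "?g (a + b) = ?g a \<otimes>\<^bsub>C\<^esub> ?g b" if "a \<in> monomials V" "b \<in> monomials V" for a b
    using fm[OF that(1)] fm[OF that(2)] by (intro cring.eval_mono_add[OF cr]) auto
  have gc: "?g m \<in> carrier C" if "m \<in> monomials V" for m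
    using g that by blast
  note lmP = mult_left_linear[OF poly_algebra[of V] field_axioms]
  note lmC = mult_left_linear[OF C field_axioms]
  have m1: "E (\<X> a \<otimes>\<^bsub>\<P>\<^esub> y) = E (\<X> a) \<otimes>\<^bsub>C\<^esub> E y" if "a \<in> monomials V" "y \<in> carrier \<P>" for a y
  proof (rule P.linear_eq_on_span[OF linear_map_compose[OF lmP[OF poly_basis_closed[OF that(1)]] E.linear_map_axioms]
        linear_map_compose[OF E.linear_map_axioms lmC[OF E.T_im[OF poly_basis_closed[OF that(1)]]]] poly_basis_image])
    show "y \<in> P.span (\<X> ` monomials V)"
      using that(2) poly_span by simp
    fix b assume "b \<in> \<X> ` monomials V"
    then show "E (\<X> a \<otimes>\<^bsub>\<P>\<^esub> b) = E (\<X> a) \<otimes>\<^bsub>C\<^esub> E b"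
      using that(1) by (auto simp: poly_basis_mult EX gadd)
  qed
  have m2: "E (x \<otimes>\<^bsub>\<P>\<^esub> y) = E x \<otimes>\<^bsub>C\<^esub> E y" if xy: "x \<in> carrier \<P>" "y \<in> carrier \<P>" for x y
  proof -
    have "E (y \<otimes>\<^bsub>\<P>\<^esub> x) = E y \<otimes>\<^bsub>C\<^esub> E x"
    proof (rule P.linear_eq_on_span[OF linear_map_compose[OF lmP[OF xy(2)] E.linear_map_axioms]
          linear_map_compose[OF E.linear_map_axioms lmC[OF E.T_im[OF xy(2)]]] poly_basis_image])
      show "x \<in> P.span (\<X> ` monomials V)"
        using xy(1) poly_span by simp
      fix b assume "b \<in> \<X> ` monomials V"
      then show "E (y \<otimes>\<^bsub>\<P>\<^esub> b) = E y \<otimes>\<^bsub>C\<^esub> E b"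
        using m1[OF _ xy(2)] xy(2) by (auto simp: P.m_comm[of y] C.m_comm[of "E y"] poly_basis_closed)
    qed
    then show ?thesis
      using xy by (simp add: P.m_comm C.m_comm)
  qed
  have "alg_hom K \<P> C E"
    using m2 EX[of "{#}"] cring.eval_mono_empty[OF cr]
    by (intro alg_hom.intro E.linear_map_axioms poly_algebra C alg_hom_axioms.intro) (auto simp: poly_simps)
  moreover have fs: "?g {#w#} = f w" if "w \<in> carrier V" for w
    using f that by (intro cring.eval_mono_single[OF cr]) auto
  moreover have "E (\<X> (add_mset w m)) = f w \<otimes>\<^bsub>C\<^esub> E (\<X> m)" if "w \<in> carrier V" "m \<in> monomials V" for w m
    using gadd[of "{#w#}" m] fs[OF that(1)] that by (simp add: EX)
  ultimately show ?thesis
    by (intro exI[of _ E]) (auto simp: EX)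
qed

text \<open>Evaluation at \<open>f\<close> kills the generators of the ideal because
  \<open>f\<close> is linear, and so it factors through the quotient.\<close>

lemma sym_lift:
  assumes C: "algebra K C" and f: "linear_map K V C f"
  shows "\<exists>H. alg_hom K (sym_alg K V) C H \<and> (\<forall>w\<in>carrier V. H (sym_incl K V w) = f w)"
proof -
  interpret C: algebra K C
    by (rule C)
  interpret f: linear_map K V C f
    by (rule f)
  interpret C: vectorspace K C
    by (rule f.W.vectorspace_axioms)
  have fc: "f \<in> carrier V \<rightarrow> carrier C"
    by auto
  obtain E where E: "alg_hom K \<P> C E" "\<And>w. w \<in> carrier V \<Longrightarrow> E (\<X> {#w#}) = f w"
    using poly_eval_exists[OF C fc] by blast
  interpret E: alg_hom K \<P> C E
    by (rule E(1))
  let ?S = "sym_alg K V"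
  interpret q: linear_map K \<P> ?S "\<lambda>x. \<J> +>\<^bsub>\<P>\<^esub> x"
    by (rule sym_proj_linear)
  have hom: "ring_hom_ring \<P> C E"
    using E.hom_mult E.hom_one
    by (intro ring_hom_ringI P.ring_axioms C.ring_axioms) auto
  let ?N = "a_kernel \<P> C E"
  have kern: "?N = {x \<in> carrier \<P>. E x = \<zero>\<^bsub>C\<^esub>}"
    by (rule a_kernel_def')
  have "sym_gens \<subseteq> ?N"
    unfolding kern sym_gens_def by (auto simp: var_closed E(2))
  then have JN: "\<J> \<subseteq> ?N"
    unfolding sym_ideal_eq by (rule P.genideal_minimal[OF ring_hom_ring.kernel_is_ideal[OF hom]])
  \<comment> \<open>An arbitrary representative of the coset is evaluated; the next step shows that
    its choice does not matter.\<close>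
  define H where "H Y = E (SOME x. x \<in> carrier \<P> \<and> Y = \<J> +>\<^bsub>\<P>\<^esub> x)" for Y
  have H: "H (\<J> +>\<^bsub>\<P>\<^esub> x) = E x" if x: "x \<in> carrier \<P>" for x
  proof -
    let ?y = "SOME y. y \<in> carrier \<P> \<and> \<J> +>\<^bsub>\<P>\<^esub> x = \<J> +>\<^bsub>\<P>\<^esub> y"
    have y: "?y \<in> carrier \<P> \<and> \<J> +>\<^bsub>\<P>\<^esub> x = \<J> +>\<^bsub>\<P>\<^esub> ?y"
      by (rule someI[of _ x]) (simp add: x)
    then have "x \<ominus>\<^bsub>\<P>\<^esub> ?y \<in> \<J>"
      using P.coset_eq_iff[OF sym_ideal_subspace x, of ?y] by blast
    then have "E (x \<ominus>\<^bsub>\<P>\<^esub> ?y) = \<zero>\<^bsub>C\<^esub>"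
      using JN kern by blast
    then have "E x = E ?y"
      using x y by simp
    then show ?thesis
      by (simp add: H_def)
  qed
  have q: "\<exists>x\<in>carrier \<P>. Y = \<J> +>\<^bsub>\<P>\<^esub> x" if "Y \<in> carrier ?S" for Y
    using that by (auto simp: sym_carrier)
  have "linear_map K ?S C H"
  proof (rule linear_mapI)
    show "H Y \<in> carrier C" if "Y \<in> carrier ?S" for Y
      using q[OF that] H by auto
    show "H (Y \<oplus>\<^bsub>?S\<^esub> Z) = H Y \<oplus>\<^bsub>C\<^esub> H Z" if "Y \<in> carrier ?S" "Z \<in> carrier ?S" for Y Z
    proof -
      obtain a b where ab: "a \<in> carrier \<P>" "b \<in> carrier \<P>" "Y = \<J> +>\<^bsub>\<P>\<^esub> a" "Z = \<J> +>\<^bsub>\<P>\<^esub> b"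
        using q[OF \<open>Y \<in> carrier ?S\<close>] q[OF \<open>Z \<in> carrier ?S\<close>] by blast
      then show ?thesis
        by (simp add: q.T_add[symmetric] H del: q.T_add)
    qed
    show "H (c \<odot>\<^bsub>?S\<^esub> Y) = c \<odot>\<^bsub>C\<^esub> H Y" if "c \<in> carrier K" "Y \<in> carrier ?S" for c Y
    proof -
      obtain a where a: "a \<in> carrier \<P>" "Y = \<J> +>\<^bsub>\<P>\<^esub> a"
        using q[OF \<open>Y \<in> carrier ?S\<close>] by blast
      then show ?thesis
        using that(1) by (simp add: q.T_smult[symmetric] H del: q.T_smult)
    qed
  qed (rule sym_vectorspace f.W.vectorspace_axioms)+
  moreover have "H (Y \<otimes>\<^bsub>?S\<^esub> Z) = H Y \<otimes>\<^bsub>C\<^esub> H Z" if YZ: "Y \<in> carrier ?S" "Z \<in> carrier ?S" for Y Z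
  proof -
    obtain a b where ab: "a \<in> carrier \<P>" "b \<in> carrier \<P>" "Y = \<J> +>\<^bsub>\<P>\<^esub> a" "Z = \<J> +>\<^bsub>\<P>\<^esub> b"
      using q[OF YZ(1)] q[OF YZ(2)] by blast
    then show ?thesis
      by (simp add: sym_mult H E.hom_mult)
  qed
  moreover have "H \<one>\<^bsub>?S\<^esub> = \<one>\<^bsub>C\<^esub>"
    by (simp add: sym_one H E.hom_one)
  ultimately have "alg_hom K ?S C H"
    by (intro alg_hom.intro sym_algebra C alg_hom_axioms.intro)
  moreover have "H (sym_incl K V w) = f w" if "w \<in> carrier V" for w
    using that by (simp add: sym_incl_eq H var_closed E(2))
  ultimately show ?thesis
    by blast
qed

text \<open>In terms of a basis \<open>B\<close> the symmetric algebra is the polynomial algebra with variables \<open>B\<close>;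
  multiplication by a basis vector shifts the exponents.\<close>

lemma sym_coordinates:
  assumes B: "basis B"
  defines "F \<equiv> free_vs K {m. set_mset m \<subseteq> B}"
  shows "\<exists>\<Theta>. linear_map K (sym_alg K V) F \<Theta> \<and> bij_betw \<Theta> (carrier (sym_alg K V)) (carrier F) \<and>
    \<Theta> \<one>\<^bsub>sym_alg K V\<^esub> = basis_vec K {m. set_mset m \<subseteq> B} {#} \<and>
    (\<forall>b\<in>B. \<forall>f\<in>carrier (sym_alg K V). \<forall>m. set_mset m \<subseteq> B \<longrightarrow>
      \<Theta> (sym_incl K V b \<otimes>\<^bsub>sym_alg K V\<^esub> f) m = (if b \<in># m then \<Theta> f (m - {#b#}) else \<zero>\<^bsub>K\<^esub>))"
proof -
  let ?S = "sym_alg K V" and ?W = "V\<lparr>carrier := B\<rparr>"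
  let ?Q = "poly_alg K ?W" and ?Y = "basis_vec K (monomials ?W)"
  have Bc: "B \<subseteq> carrier V" "span B = carrier V"
    using B by (auto simp: basis_def)
  have mon: "monomials ?W = {m. set_mset m \<subseteq> B}"
    by (simp add: monomials_def)
  interpret Q: algebra K ?Q
    by (rule poly_algebra)
  interpret Q: vectorspace K ?Q
    by (rule poly_vectorspace)
  interpret S: algebra K ?S
    by (rule sym_algebra)
  interpret S: vectorspace K ?S
    by (rule sym_vectorspace)
  interpret i: linear_map K V ?S "sym_incl K V"
    by (rule sym_incl_linear)
  have Yc: "?Y m \<in> carrier ?Q" if "m \<in> monomials ?W" for m
    using that by (simp add: poly_simps basis_vec_closed)
  have Yb: "(\<lambda>b. ?Y {#b#}) \<in> B \<rightarrow> carrier ?Q"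
    using Yc by (auto simp: mon)
  interpret f: linear_map K V ?Q "\<lambda>v. free_ext K ?Q B (\<lambda>b. ?Y {#b#}) (coords B v)"
    by (rule linear_map_compose[OF coords_linear(1)[OF B] Q.free_ext_linear[OF Yb]])
  \<comment> \<open>The algebra map that turns the coordinates of a vector over \<open>B\<close>
    into a combination of variables.\<close>
  obtain \<Theta> where T: "alg_hom K ?S ?Q \<Theta>"
    "\<And>w. w \<in> carrier V \<Longrightarrow> \<Theta> (sym_incl K V w) = free_ext K ?Q B (\<lambda>b. ?Y {#b#}) (coords B w)"
    using sym_lift[OF poly_algebra f.linear_map_axioms] by blast
  interpret T: alg_hom K ?S ?Q \<Theta>
    by (rule T(1))
  have Tb: "\<Theta> (sym_incl K V b) = ?Y {#b#}" if "b \<in> B" for b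
    using T(2)[OF subsetD[OF Bc(1) that]] coords_linear(3)[OF B that] Q.free_ext_basis_vec[OF Yb that]
    by (simp only:)
  have TbM: "\<Theta> (sym_incl K V b \<otimes>\<^bsub>?S\<^esub> f) = ?Y {#b#} \<otimes>\<^bsub>?Q\<^esub> \<Theta> f" if "b \<in> B" "f \<in> carrier ?S" for b f
    using that Bc(1) by (subst T.hom_mult) (auto simp: Tb)
  have im: "sym_incl K V \<in> B \<rightarrow> carrier ?S"
    using Bc(1) by auto
  have VW: "carrier ?W = B"
    by simp
  have "?Y m \<in> \<Theta> ` carrier ?S" if "m \<in> monomials ?W" for m
    using that
  proof (induction m)
    case empty
    then show ?case
      using T.hom_one by (metis S.one_closed image_eqI poly_simps(5))
  next
    case (add b m)
    then have b: "b \<in> B" "m \<in> monomials ?W"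
      by auto
    obtain f where f: "f \<in> carrier ?S" "?Y m = \<Theta> f"
      using add.IH[OF b(2)] by blast
    have "\<Theta> (sym_incl K V b \<otimes>\<^bsub>?S\<^esub> f) = ?Y (add_mset b m)"
      unfolding TbM[OF b(1) f(1)] f(2)[symmetric] using b by (subst poly_basis_mult) auto
    then show ?case
      using f(1) b(1) Bc(1) by (intro image_eqI[of _ _ "sym_incl K V b \<otimes>\<^bsub>?S\<^esub> f"]) auto
  qed
  then have "?Y ` monomials ?W \<subseteq> \<Theta> ` carrier ?S"
    by blast
  then have "carrier ?Q \<subseteq> \<Theta> ` carrier ?S"
    using Q.span_minimal[OF T.image_subspace[OF S.subspace_carrier]] poly_alg_span[of ?W] by blast
  then have surj: "\<Theta> ` carrier ?S = carrier ?Q"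
    by auto
  have cr: "cring ?S"
    by (rule S.M_cring)
  let ?g = "eval_mono ?S (sym_incl K V)"
  have fm: "sym_incl K V \<in> set_mset m \<rightarrow> carrier ?S" if "m \<in> monomials ?W" for m
    using that im by (auto simp: mon)
  have g: "?g \<in> monomials ?W \<rightarrow> carrier ?S"
    using cring.eval_mono_closed[OF cr fm] by auto
  \<comment> \<open>The candidate inverse, evaluation of monomials in the symmetric algebra. Besides
    linearity, the argument uses only that it respects multiplication by variables.\<close>
  define \<Psi> where "\<Psi> = free_ext K ?S (monomials ?W) ?g"
  interpret L0: linear_map K "free_vs K (monomials ?W)" ?S \<Psi>
    unfolding \<Psi>_def by (rule S.free_ext_linear[OF g])
  interpret L: linear_map K ?Q ?S \<Psi>
    using L0.T_add L0.T_smult L0.T_im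
    by (intro linear_mapI Q.vectorspace_axioms S.vectorspace_axioms) (auto simp: poly_simps)
  have LY: "\<Psi> (?Y m) = ?g m" if "m \<in> monomials ?W" for m
    unfolding \<Psi>_def by (rule S.free_ext_basis_vec[OF g that])
  have Lmult: "\<Psi> (?Y {#b#} \<otimes>\<^bsub>?Q\<^esub> h) = sym_incl K V b \<otimes>\<^bsub>?S\<^esub> \<Psi> h" if b: "b \<in> B" and h: "h \<in> carrier ?Q" for b h
  proof -
    have bS: "sym_incl K V b \<in> carrier ?S"
      using b im by blast
    have bQ: "?Y {#b#} \<in> carrier ?Q"
      using b Yb by blast
    have "subspace K {h \<in> carrier ?Q. \<Psi> (?Y {#b#} \<otimes>\<^bsub>?Q\<^esub> h) = sym_incl K V b \<otimes>\<^bsub>?S\<^esub> \<Psi> h} ?Q"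
    proof (rule Q.subspaceI)
      fix c v assume "c \<in> carrier K" "v \<in> {h \<in> carrier ?Q. \<Psi> (?Y {#b#} \<otimes>\<^bsub>?Q\<^esub> h) = sym_incl K V b \<otimes>\<^bsub>?S\<^esub> \<Psi> h}"
      then show "c \<odot>\<^bsub>?Q\<^esub> v \<in> {h \<in> carrier ?Q. \<Psi> (?Y {#b#} \<otimes>\<^bsub>?Q\<^esub> h) = sym_incl K V b \<otimes>\<^bsub>?S\<^esub> \<Psi> h}"
        using bS bQ by (simp add: Q.mult_smult_right S.mult_smult_right)
    qed (use bS bQ in \<open>auto simp: Q.r_distr S.r_distr\<close>)
    moreover have "?Y m \<in> {h \<in> carrier ?Q. \<Psi> (?Y {#b#} \<otimes>\<^bsub>?Q\<^esub> h) = sym_incl K V b \<otimes>\<^bsub>?S\<^esub> \<Psi> h}"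
      if m: "m \<in> monomials ?W" for m
    proof -
      have "?Y {#b#} \<otimes>\<^bsub>?Q\<^esub> ?Y m = ?Y (add_mset b m)"
        using b m by (subst poly_basis_mult) auto
      moreover have "?g ({#b#} + m) = ?g {#b#} \<otimes>\<^bsub>?S\<^esub> ?g m"
        using bS fm[OF m] by (intro cring.eval_mono_add[OF cr]) auto
      ultimately show ?thesis
        using b m Yc LY cring.eval_mono_single[OF cr, of "sym_incl K V" b]  bS by simp
    qed
    ultimately have "Q.span (?Y ` monomials ?W) \<subseteq> {h \<in> carrier ?Q. \<Psi> (?Y {#b#} \<otimes>\<^bsub>?Q\<^esub> h) = sym_incl K V b \<otimes>\<^bsub>?S\<^esub> \<Psi> h}"
      by (intro Q.span_minimal) auto
    then show ?thesis
      using h poly_alg_span[of ?W] by blast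
  qed
  \<comment> \<open>\<open>\<Psi>\<close> is a left inverse: the elements fixed by the composite
    form a subspace containing the unit and stable under multiplication by vectors, by those in
    \<open>B\<close> first and by their span afterwards.\<close>
  have "{f \<in> carrier ?S. \<Psi> (\<Theta> f) = f} = carrier ?S"
  proof (rule sym_generated)
    show sub: "subspace K {f \<in> carrier ?S. \<Psi> (\<Theta> f) = f} ?S"
      by (rule S.subspaceI) auto
    have "\<Psi> (?Y {#}) = \<one>\<^bsub>?S\<^esub>"
      using LY[of "{#}"] cring.eval_mono_empty[OF cr] by simp
    then show "\<one>\<^bsub>?S\<^esub> \<in> {f \<in> carrier ?S. \<Psi> (\<Theta> f) = f}"
      using T.hom_one by (simp add: poly_simps)
    fix w f assume w: "w \<in> carrier V" and f: "f \<in> {f \<in> carrier ?S. \<Psi> (\<Theta> f) = f}"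
    have "B \<subseteq> {w \<in> carrier V. sym_incl K V w \<otimes>\<^bsub>?S\<^esub> f \<in> {f \<in> carrier ?S. \<Psi> (\<Theta> f) = f}}"
      using f Bc(1) im by (auto simp: TbM Lmult)
    moreover have "linear_map K V ?S (\<lambda>w. sym_incl K V w \<otimes>\<^bsub>?S\<^esub> f)"
      using f by (intro linear_mapI vectorspace_axioms S.vectorspace_axioms)
        (auto simp: S.l_distr S.smult_assoc2)
    ultimately have "carrier V \<subseteq> {w \<in> carrier V. sym_incl K V w \<otimes>\<^bsub>?S\<^esub> f \<in> {f \<in> carrier ?S. \<Psi> (\<Theta> f) = f}}"
      using span_minimal[OF linear_map.preimage_subspace[OF _ sub]] Bc(2) by blast
    then show "sym_incl K V w \<otimes>\<^bsub>?S\<^esub> f \<in> {f \<in> carrier ?S. \<Psi> (\<Theta> f) = f}"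
      using w by blast
  qed
  then have "inj_on \<Theta> (carrier ?S)"
    by (intro inj_on_inverseI[where g = \<Psi>]) blast
  then have bij: "bij_betw \<Theta> (carrier ?S) (carrier F)"
    using surj by (simp add: bij_betw_def F_def poly_simps mon)
  have lin: "linear_map K ?S F \<Theta>"
    using T.T_add T.T_smult T.T_im unfolding F_def mon[symmetric]
    by (intro linear_mapI S.vectorspace_axioms free_vs_vectorspace) (auto simp: poly_simps)
  have "\<Theta> (sym_incl K V b \<otimes>\<^bsub>?S\<^esub> f) m = (if b \<in># m then \<Theta> f (m - {#b#}) else \<zero>\<^bsub>K\<^esub>)"
    if "b \<in> B" "f \<in> carrier ?S" "set_mset m \<subseteq> B" for b f m
    unfolding TbM[OF that(1,2)] using that by (subst poly_var_mult_apply) (auto simp: mon)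
  then show ?thesis
    using lin bij T.hom_one by (intro exI[of _ \<Theta>]) (simp add: poly_simps mon)
qed

end

subsection \<open>Order of vanishing along a subspace\<close>

text \<open>An interface that hides the quotient construction. Lifting is stated for endomorphisms
  of \<open>V\<close>, which suffices because contractions are realised inside
  \<open>V\<close>.\<close>

locale symmetric_algebra = vectorspace K V + S: algebra K S
  for K :: "('k, 'm) ring_scheme" and V :: "('k, 'v, 'n) module_scheme"
    and S :: "('k, 's, 'p) module_scheme" +
  fixes inc :: "'v \<Rightarrow> 's"
  assumes inc_linear: "linear_map K V S inc"
    and generated: "subspace K N S \<Longrightarrow> \<one>\<^bsub>S\<^esub> \<in> N \<Longrightarrow>
      (\<And>w f. w \<in> carrier V \<Longrightarrow> f \<in> N \<Longrightarrow> inc w \<otimes>\<^bsub>S\<^esub> f \<in> N) \<Longrightarrow> N = carrier S"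
    and lift: "linear_map K V V h \<Longrightarrow> \<exists>H. alg_hom K S S H \<and> (\<forall>w\<in>carrier V. H (inc w) = inc (h w))"
    and coordinates: "basis B \<Longrightarrow>
      \<exists>\<Theta>. linear_map K S (free_vs K {m. set_mset m \<subseteq> B}) \<Theta> \<and>
        bij_betw \<Theta> (carrier S) (carrier (free_vs K {m. set_mset m \<subseteq> B})) \<and>
        \<Theta> \<one>\<^bsub>S\<^esub> = basis_vec K {m. set_mset m \<subseteq> B} {#} \<and>
        (\<forall>b\<in>B. \<forall>f\<in>carrier S. \<forall>m. set_mset m \<subseteq> B \<longrightarrow>
          \<Theta> (inc b \<otimes>\<^bsub>S\<^esub> f) m = (if b \<in># m then \<Theta> f (m - {#b#}) else \<zero>\<^bsub>K\<^esub>))"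

lemma (in vectorspace) sym_alg_symmetric_algebra: "symmetric_algebra K V (sym_alg K V) (sym_incl K V)"
proof (intro symmetric_algebra.intro symmetric_algebra_axioms.intro)
  show "\<exists>H. alg_hom K (sym_alg K V) (sym_alg K V) H \<and>
      (\<forall>w\<in>carrier V. H (sym_incl K V w) = sym_incl K V (h w))" if "linear_map K V V h" for h
    using sym_lift[OF sym_algebra linear_map_compose[OF that sym_incl_linear]] .
qed (use vectorspace_axioms sym_algebra sym_incl_linear sym_generated sym_coordinates in blast)+

context symmetric_algebra
begin

sublocale S: vectorspace K S
  by (rule vectorspace.intro[OF S.module field_axioms])

sublocale inc: linear_map K V S inc
  by (rule inc_linear)

text \<open>Products of \<open>n\<close> vectors with \<open>k\<close> factors declared to lie in
  \<open>U\<close>. Rule \<open>any\<close> accepts vectors of \<open>U\<close> too, so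
  \<open>k\<close> is only a lower bound for their number and can be decreased.\<close>

inductive prods :: "'v set \<Rightarrow> nat \<Rightarrow> nat \<Rightarrow> 's \<Rightarrow> bool" for U where
  one: "prods U 0 0 \<one>\<^bsub>S\<^esub>"
| any: "prods U k n f \<Longrightarrow> w \<in> carrier V \<Longrightarrow> prods U k (Suc n) (inc w \<otimes>\<^bsub>S\<^esub> f)"
| inU: "prods U k n f \<Longrightarrow> w \<in> U \<Longrightarrow> prods U (Suc k) (Suc n) (inc w \<otimes>\<^bsub>S\<^esub> f)"

text \<open>The forms of degree \<open>n\<close> that, as polynomial functions on the dual of \<open>V\<close>, vanish to order
  at least \<open>k\<close> on the annihilator of \<open>U\<close>.\<close>

definition van :: "'v set \<Rightarrow> nat \<Rightarrow> nat \<Rightarrow> 's set" where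
  "van U k n = S.span {f. prods U k n f}"

lemma prods_closed: "prods U k n f \<Longrightarrow> U \<subseteq> carrier V \<Longrightarrow> f \<in> carrier S"
  by (induction rule: prods.induct) auto

lemma prods_le: "prods U k n f \<Longrightarrow> k \<le> n"
  by (induction rule: prods.induct) auto

lemma prods_less: "prods U k n f \<Longrightarrow> U \<subseteq> carrier V \<Longrightarrow> j \<le> k \<Longrightarrow> prods U j n f"
proof (induction arbitrary: j rule: prods.induct)
  case (inU k n f w)
  then show ?case
    by (cases j) (auto intro: prods.intros)
qed (auto intro: prods.intros)

lemma prods_zero: "prods U k n f \<Longrightarrow> U \<subseteq> {\<zero>\<^bsub>V\<^esub>} \<Longrightarrow> 0 < k \<Longrightarrow> f = \<zero>\<^bsub>S\<^esub>"
proof (induction rule: prods.induct)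
  case (inU k n f w)
  then have "f \<in> carrier S"
    using prods_closed[of U k n f] by auto
  then show ?case
    using inU by auto
qed auto

lemma van_subspace: "U \<subseteq> carrier V \<Longrightarrow> subspace K (van U k n) S"
  unfolding van_def using prods_closed by (intro S.span_subspace) auto

lemma prods_van: "prods U k n f \<Longrightarrow> U \<subseteq> carrier V \<Longrightarrow> f \<in> van U k n"
  unfolding van_def using prods_closed by (intro S.span_mem) auto

lemma van_le: "U \<subseteq> carrier V \<Longrightarrow> j \<le> k \<Longrightarrow> van U k n \<subseteq> van U j n"
  unfolding van_def using prods_less by (intro S.span_is_monotone) blast

lemma van_gt:
  assumes "n < k"
  shows "van U k n = {\<zero>\<^bsub>S\<^esub>}"
proof -
  have "{f. prods U k n f} = {}"
    using prods_le assms by fastforce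
  then show ?thesis
    by (simp add: van_def S.span_empty)
qed

text \<open>A factor taken from the zero space kills the product. Loops are disposed of in this
  way.\<close>

lemma van_zero:
  assumes "U \<subseteq> {\<zero>\<^bsub>V\<^esub>}" "0 < k"
  shows "van U k n = {\<zero>\<^bsub>S\<^esub>}"
proof -
  have "{f. prods U k n f} \<subseteq> {\<zero>\<^bsub>S\<^esub>}"
    using prods_zero assms by blast
  then have "van U k n \<subseteq> {\<zero>\<^bsub>S\<^esub>}"
    unfolding van_def by (rule S.span_minimal[OF S.subspace_zero])
  then show ?thesis
    using S.span_zero by (auto simp: van_def)
qed

lemma van_0_0: "van U 0 0 = S.span {\<one>\<^bsub>S\<^esub>}"
proof -
  have "{f. prods U 0 0 f} = {\<one>\<^bsub>S\<^esub>}"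
    by (auto elim: prods.cases intro: prods.intros)
  then show ?thesis
    by (simp add: van_def)
qed

lemma mult_linear: "x \<in> carrier S \<Longrightarrow> linear_map K S S (\<lambda>f. x \<otimes>\<^bsub>S\<^esub> f)"
  by (rule mult_left_linear[OF S.algebra_axioms field_axioms])

lemma mult_right_linear:
  assumes "f \<in> carrier S"
  shows "linear_map K V S (\<lambda>w. inc w \<otimes>\<^bsub>S\<^esub> f)"
  using assms by (intro linear_mapI vectorspace_axioms S.vectorspace_axioms)
    (auto simp: S.l_distr S.smult_assoc2)

lemma van_mult:
  assumes "U \<subseteq> carrier V" "w \<in> carrier V" "\<And>f. prods U k n f \<Longrightarrow> prods U k' n' (inc w \<otimes>\<^bsub>S\<^esub> f)"
    and "f \<in> van U k n"
  shows "inc w \<otimes>\<^bsub>S\<^esub> f \<in> van U k' n'"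
proof -
  interpret m: linear_map K S S "\<lambda>f. inc w \<otimes>\<^bsub>S\<^esub> f"
    using assms(2) by (intro mult_linear) auto
  have "{f. prods U k n f} \<subseteq> {f \<in> carrier S. inc w \<otimes>\<^bsub>S\<^esub> f \<in> van U k' n'}"
    using assms prods_van prods_closed by blast
  then have "van U k n \<subseteq> {f \<in> carrier S. inc w \<otimes>\<^bsub>S\<^esub> f \<in> van U k' n'}"
    unfolding van_def[of U k n] by (intro S.span_minimal m.preimage_subspace van_subspace assms)
  then show ?thesis
    using assms(4) by blast
qed

lemma van_mult_any:
  "U \<subseteq> carrier V \<Longrightarrow> w \<in> carrier V \<Longrightarrow> f \<in> van U k n \<Longrightarrow> inc w \<otimes>\<^bsub>S\<^esub> f \<in> van U k (Suc n)"
  by (rule van_mult) (auto intro: prods.intros)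

lemma van_mult_in:
  "U \<subseteq> carrier V \<Longrightarrow> w \<in> U \<Longrightarrow> f \<in> van U k n \<Longrightarrow> inc w \<otimes>\<^bsub>S\<^esub> f \<in> van U (Suc k) (Suc n)"
  by (rule van_mult) (auto intro: prods.intros)

text \<open>Substitution acts factor by factor, so a count of factors from \<open>U\<close> becomes
  a count of factors from its image.\<close>

lemma van_hom:
  assumes H: "alg_hom K S S H" "\<And>w. w \<in> carrier V \<Longrightarrow> H (inc w) = inc (h w)"
    and h: "h \<in> carrier V \<rightarrow> carrier V" and U: "U \<subseteq> carrier V" and f: "f \<in> van U k n"
  shows "H f \<in> van (h ` U) k n"
proof -
  interpret H: alg_hom K S S H
    by (rule H(1))
  have hU: "h ` U \<subseteq> carrier V"
    using h U by blast
  have "prods (h ` U) k n (H f)" if "prods U k n f" for f k n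
    using that
  proof (induction rule: prods.induct)
    case one
    then show ?case
      by (simp add: H.hom_one prods.one)
  next
    case (any k n f w)
    then have "H (inc w \<otimes>\<^bsub>S\<^esub> f) = inc (h w) \<otimes>\<^bsub>S\<^esub> H f"
      using prods_closed[OF any(1) U] by (simp add: H.hom_mult H(2))
    then show ?case
      using any h by (auto intro: prods.any)
  next
    case (inU k n f w)
    then have "H (inc w \<otimes>\<^bsub>S\<^esub> f) = inc (h w) \<otimes>\<^bsub>S\<^esub> H f"
      using prods_closed[OF inU(1) U] U by (subst H.hom_mult) (auto simp: H(2) subset_iff)
    then show ?case
      using inU by (auto intro: prods.inU)
  qed
  then have "{f. prods U k n f} \<subseteq> {f \<in> carrier S. H f \<in> van (h ` U) k n}"
    using prods_van[OF _ hU] prods_closed[OF _ U] by blast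
  then have "van U k n \<subseteq> {f \<in> carrier S. H f \<in> van (h ` U) k n}"
    unfolding van_def[of U] by (intro S.span_minimal H.preimage_subspace van_subspace hU)
  then show ?thesis
    using f by blast
qed

end

lemma (in vectorspace) finsum_in_subspace:
  assumes N: "subspace K N V" and "finite A" "\<And>a. a \<in> A \<Longrightarrow> g a \<in> N"
  shows "(\<Oplus>\<^bsub>V\<^esub>a\<in>A. g a) \<in> N"
  using assms(2,3)
proof (induction A)
  case empty
  then show ?case
    using subspaceD(2)[OF N] by simp
next
  case (insert a A)
  have "g b \<in> carrier V" if "b \<in> insert a A" for b
    using insert.prems that subspaceD(1)[OF N] by blast
  then have "(\<Oplus>\<^bsub>V\<^esub>a\<in>insert a A. g a) = g a \<oplus>\<^bsub>V\<^esub> (\<Oplus>\<^bsub>V\<^esub>a\<in>A. g a)"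
    using insert.hyps by (intro M.finsum_insert) auto
  then show ?case
    using insert subspaceD(3)[OF N] by simp
qed

lemma (in vectorspace) adapted_basis:
  assumes U: "subspace K U V"
  obtains B L where "basis B" "L \<subseteq> B" "L \<subseteq> U" "span L = U"
    "\<And>v. v = u \<Longrightarrow> v \<in> carrier V \<Longrightarrow> v \<noteq> \<zero>\<^bsub>V\<^esub> \<Longrightarrow> v \<in> B \<and> (v \<in> L \<longleftrightarrow> v \<in> U)"
proof -
  note U' = subspaceD[OF U]
  interpret U: vectorspace K "vs U"
    by (rule subspace_is_vs[OF U])
  have single: "lin_indpt {v}" if "v \<in> carrier V" "v \<noteq> \<zero>\<^bsub>V\<^esub>" for v
  proof
    assume "lin_dep {v}"
    then have "v \<in> span ({v} - {v})"
      using lindep_span[of "{v}"] that by auto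
    then show False
      using that span_empty by simp
  qed
  have empty: "lin_indpt {}"
    by (auto simp: lin_dep_def)
  define L0 where "L0 = (if u \<in> U \<and> u \<noteq> \<zero>\<^bsub>V\<^esub> then {u} else {})"
  have L0: "L0 \<subseteq> U" "lin_indpt L0"
    using single empty U'(1) by (auto simp: L0_def)
  have "U.lin_indpt L0"
    using span_li_not_depend(2)[OF L0(1) is_module[OF U]] L0(2) by simp
  then obtain L where L: "L0 \<subseteq> L" "U.basis L"
    using U.exists_basis_extending[of L0] L0(1) by auto
  then have LU: "L \<subseteq> U" "U.lin_indpt L" "U.span L = U"
    by (auto simp: U.basis_def)
  then have L': "lin_indpt L" "span L = U"
    using span_li_not_depend[OF LU(1) is_module[OF U]] by auto
  have Lc: "L \<subseteq> carrier V"
    using LU(1) U'(1) by blast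
  define L1 where "L1 = (if u \<in> carrier V \<and> u \<notin> U then L \<union> {u} else L)"
  have "lin_indpt L1"
    using lin_dep_iff_in_span[OF Lc L'(1), of u] L' LU(1) by (auto simp: L1_def)
  moreover have "L1 \<subseteq> carrier V"
    using Lc by (auto simp: L1_def)
  ultimately obtain B where B: "L1 \<subseteq> B" "basis B"
    using exists_basis_extending by blast
  have "v \<in> B \<and> (v \<in> L \<longleftrightarrow> v \<in> U)" if "v = u" "v \<in> carrier V" "v \<noteq> \<zero>\<^bsub>V\<^esub>" for v
    using that B(1) L(1) LU(1) by (auto simp: L1_def L0_def split: if_splits)
  then show thesis
    using B L' LU(1) by (intro that[of B L]) (auto simp: L1_def split: if_splits)
qed

context symmetric_algebra
begin

text \<open>Multiplication by a basis vector shifts exponents, so the products in question involve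
  only monomials with \<open>n\<close> factors, at least \<open>k\<close> of them in
  \<open>L\<close>. Conversely each such monomial is itself a product of this kind, and a form is a
  finite combination of its monomials.\<close>

lemma van_coordinates:
  assumes B: "basis B" and L: "L \<subseteq> B"
    and T: "linear_map K S (free_vs K {m. set_mset m \<subseteq> B}) \<Theta>"
      "bij_betw \<Theta> (carrier S) (carrier (free_vs K {m. set_mset m \<subseteq> B}))"
      "\<Theta> \<one>\<^bsub>S\<^esub> = basis_vec K {m. set_mset m \<subseteq> B} {#}"
      "\<And>b f m. b \<in> B \<Longrightarrow> f \<in> carrier S \<Longrightarrow> set_mset m \<subseteq> B \<Longrightarrow>
        \<Theta> (inc b \<otimes>\<^bsub>S\<^esub> f) m = (if b \<in># m then \<Theta> f (m - {#b#}) else \<zero>\<^bsub>K\<^esub>)"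
    and f: "f \<in> carrier S"
  shows "f \<in> van (span L) k n \<longleftrightarrow> (\<forall>m. set_mset m \<subseteq> B \<longrightarrow> \<Theta> f m \<noteq> \<zero>\<^bsub>K\<^esub> \<longrightarrow>
    size m = n \<and> k \<le> size (filter_mset (\<lambda>b. b \<in> L) m))"
proof -
  let ?M = "{m. set_mset m \<subseteq> B}"
  let ?F = "free_vs K ?M"
  let ?U = "span L"
  let ?l = "\<lambda>m. size (filter_mset (\<lambda>b. b \<in> L) m)"
  interpret T: linear_map K S ?F \<Theta>
    by (rule T(1))
  have Bc: "B \<subseteq> carrier V" "span B = carrier V"
    using B by (auto simp: basis_def)
  have Lc: "L \<subseteq> carrier V"
    using L Bc(1) by blast
  have Uc: "?U \<subseteq> carrier V"
    using Lc by (rule span_is_subset2)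
  define N where "N k n = {f \<in> carrier S. \<forall>m\<in>?M. \<Theta> f m \<noteq> \<zero>\<^bsub>K\<^esub> \<longrightarrow> size m = n \<and> k \<le> ?l m}" for k n
  have Tc: "\<Theta> f m \<in> carrier K" if "f \<in> carrier S" "m \<in> ?M" for f m
    using that by (intro free_vs_apply_closed[OF T.T_im])
  have Nsub: "subspace K (N k n) S" for k n
  proof (rule S.subspaceI)
    show "N k n \<subseteq> carrier S"
      by (auto simp: N_def)
    show "\<zero>\<^bsub>S\<^esub> \<in> N k n"
      by (auto simp: N_def free_vs_zero)
    fix u v assume uv: "u \<in> N k n" "v \<in> N k n"
    then have c: "u \<in> carrier S" "v \<in> carrier S"
      by (auto simp: N_def)
    have "\<Theta> u m \<noteq> \<zero>\<^bsub>K\<^esub> \<or> \<Theta> v m \<noteq> \<zero>\<^bsub>K\<^esub>" if "m \<in> ?M" "\<Theta> (u \<oplus>\<^bsub>S\<^esub> v) m \<noteq> \<zero>\<^bsub>K\<^esub>" for m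
      using that c by (auto simp: free_vs_add)
    then show "u \<oplus>\<^bsub>S\<^esub> v \<in> N k n"
      using uv c unfolding N_def by blast
  next
    fix c v assume cv: "c \<in> carrier K" "v \<in> N k n"
    then have vc: "v \<in> carrier S"
      by (auto simp: N_def)
    have "\<Theta> v m \<noteq> \<zero>\<^bsub>K\<^esub>" if "m \<in> ?M" "\<Theta> (c \<odot>\<^bsub>S\<^esub> v) m \<noteq> \<zero>\<^bsub>K\<^esub>" for m
      using that cv(1) vc by (auto simp: free_vs_smult)
    then show "c \<odot>\<^bsub>S\<^esub> v \<in> N k n"
      using cv vc unfolding N_def by blast
  qed
  have shift: "inc b \<otimes>\<^bsub>S\<^esub> f \<in> N k' (Suc n)"
    if "b \<in> B" "f \<in> N k n" "k' \<le> (if b \<in> L then Suc k else k)" for b f k k' n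
  proof -
    have fc: "f \<in> carrier S"
      using that(2) by (auto simp: N_def)
    have "size m = Suc n \<and> k' \<le> ?l m" if m: "m \<in> ?M" "\<Theta> (inc b \<otimes>\<^bsub>S\<^esub> f) m \<noteq> \<zero>\<^bsub>K\<^esub>" for m
    proof -
      have bm: "b \<in># m" "\<Theta> f (m - {#b#}) \<noteq> \<zero>\<^bsub>K\<^esub>"
        using m T(4)[OF \<open>b \<in> B\<close> fc, of m] by (auto split: if_splits)
      obtain m' where m': "m = add_mset b m'"
        using bm(1) by (metis insert_DiffM)
      then have "size m' = n \<and> k \<le> ?l m'"
        using bm(2) m(1) \<open>f \<in> N k n\<close> by (auto simp: N_def)
      then show ?thesis
        using m' \<open>k' \<le> (if b \<in> L then Suc k else k)\<close> by auto
    qed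
    then show ?thesis
      using fc that(1) Bc(1) by (auto simp: N_def)
  qed
  \<comment> \<open>Linearity in \<open>w\<close> reduces to basis vectors; \<open>C = B\<close>
    will handle an arbitrary factor and \<open>C = L\<close> a factor from the span of
    \<open>L\<close>.\<close>
  have shift_span: "inc w \<otimes>\<^bsub>S\<^esub> f \<in> N k' (Suc n)"
    if "f \<in> N k n" "w \<in> span C" "C \<subseteq> B" "\<And>b. b \<in> C \<Longrightarrow> k' \<le> (if b \<in> L then Suc k else k)" for C w f k k' n
  proof -
    have fc: "f \<in> carrier S"
      using that(1) by (auto simp: N_def)
    interpret m: linear_map K V S "\<lambda>w. inc w \<otimes>\<^bsub>S\<^esub> f"
      by (rule mult_right_linear[OF fc])
    have "C \<subseteq> {w \<in> carrier V. inc w \<otimes>\<^bsub>S\<^esub> f \<in> N k' (Suc n)}"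
      using that shift Bc(1) by blast
    then show ?thesis
      using span_minimal[OF m.preimage_subspace[OF Nsub]] that(2) by blast
  qed
  have "f \<in> N k n" if "prods ?U k n f" for f k n
    using that
  proof (induction rule: prods.induct)
    case one
    then show ?case
      by (auto simp: N_def T(3) basis_vec_apply)
  next
    case (any k n f w)
    then show ?case
      using Bc(2) by (intro shift_span[of f k n w B]) auto
  next
    case (inU k n f w)
    then show ?case
      using L by (intro shift_span[of f k n w L]) auto
  qed
  then have "{f. prods ?U k n f} \<subseteq> N k n"
    by blast
  then have "van ?U k n \<subseteq> N k n"
    unfolding van_def by (rule S.span_minimal[OF Nsub])
  moreover have "N k n \<subseteq> van ?U k n"
  proof
    fix f assume f: "f \<in> N k n"
    have mono: "\<exists>g\<in>van ?U k n. \<Theta> g = basis_vec K ?M m" if "set_mset m \<subseteq> B" "size m = n" "k \<le> ?l m" for m k n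
      using that
    proof (induction m arbitrary: k n)
      case empty
      then show ?case
        using prods_van[OF prods.one Uc] T(3) by auto
    next
      case (add b m)
      \<comment> \<open>The truncated difference matters: once \<open>k\<close> is 0, a further
        factor from \<open>L\<close> is counted as arbitrary.\<close>
      let ?k = "if b \<in> L then k - 1 else k"
      have kl: "?k \<le> ?l m"
        using add.prems(3) by (cases "b \<in> L") auto
      obtain g where g: "g \<in> van ?U ?k (size m)" "\<Theta> g = basis_vec K ?M m"
        using add.IH[OF _ refl kl] add.prems(1) by auto
      have gc: "g \<in> carrier S"
        using g(1) S.subspaceD(1)[OF van_subspace[OF Uc]] by blast
      have b: "b \<in> B" "b \<in> carrier V"
        using add.prems(1) Bc(1) by auto
      have bL: "b \<in> ?U" if "b \<in> L"
        using that Lc in_own_span by blast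
      have n: "n = Suc (size m)"
        using add.prems(2) by simp
      have "inc b \<otimes>\<^bsub>S\<^esub> g \<in> van ?U k n"
      proof (cases "b \<in> L \<and> k \<noteq> 0")
        case True
        then show ?thesis
          using van_mult_in[OF Uc bL, of g "k - 1" "size m"] g(1) n by simp
      next
        case False
        then show ?thesis
          using van_mult_any[OF Uc b(2), of g ?k "size m"] g(1) n by (auto split: if_splits)
      qed
      moreover have "\<Theta> (inc b \<otimes>\<^bsub>S\<^esub> g) = basis_vec K ?M (add_mset b m)"
      proof (rule free_vs_ext)
        show "\<Theta> (inc b \<otimes>\<^bsub>S\<^esub> g) \<in> carrier ?F"
          using gc b by (intro T.T_im) auto
        show "basis_vec K ?M (add_mset b m) \<in> carrier ?F"
          using add.prems(1) by (intro basis_vec_closed) auto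
        fix m' assume m': "m' \<in> ?M"
        have "m' - {#b#} \<in> ?M"
          using m' by (auto dest: in_diffD)
        moreover have "b \<in># m' \<and> m' - {#b#} = m \<longleftrightarrow> m' = add_mset b m"
          by auto
        ultimately show "\<Theta> (inc b \<otimes>\<^bsub>S\<^esub> g) m' = basis_vec K ?M (add_mset b m) m'"
          using T(4)[OF b(1) gc, of m'] m' by (auto simp: g(2) basis_vec_apply)
      qed
      ultimately show ?case
        by blast
    qed
    have fS: "f \<in> carrier S"
      using f by (auto simp: N_def)
    let ?I = "\<Theta> ` van ?U k n"
    have I: "subspace K ?I ?F"
      by (rule T.image_subspace[OF van_subspace[OF Uc]])
    have "(\<Oplus>\<^bsub>?F\<^esub>a\<in>{m \<in> ?M. \<Theta> f m \<noteq> \<zero>\<^bsub>K\<^esub>}. \<Theta> f a \<odot>\<^bsub>?F\<^esub> basis_vec K ?M a) \<in> ?I"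
    proof (rule T.W.finsum_in_subspace[OF I])
      show "finite {m \<in> ?M. \<Theta> f m \<noteq> \<zero>\<^bsub>K\<^esub>}"
        using T.T_im[OF fS] by (auto simp: free_vs_carrier)
      fix m assume m: "m \<in> {m \<in> ?M. \<Theta> f m \<noteq> \<zero>\<^bsub>K\<^esub>}"
      then have "\<exists>g\<in>van ?U k n. \<Theta> g = basis_vec K ?M m"
        using f by (intro mono) (auto simp: N_def)
      then have "basis_vec K ?M m \<in> ?I"
        by force
      then show "\<Theta> f m \<odot>\<^bsub>?F\<^esub> basis_vec K ?M m \<in> ?I"
        using m Tc[OF fS] T.W.subspaceD(4)[OF I] by simp
    qed
    then have "\<Theta> f \<in> ?I"
      using free_vs_expand[OF T.T_im[OF fS]] by simp
    then obtain g where g: "g \<in> van ?U k n" "\<Theta> f = \<Theta> g"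
      by blast
    then have "g = f"
      using T(2) fS S.subspaceD(1)[OF van_subspace[OF Uc]] by (metis bij_betw_def inj_onD subsetD)
    then show "f \<in> van ?U k n"
      using g(1) by simp
  qed
  ultimately have "van ?U k n = N k n"
    by blast
  then show ?thesis
    using f by (auto simp: N_def)
qed

text \<open>In a basis adapted to \<open>U\<close> and \<open>v\<close>, division by
  \<open>v\<close> removes one \<open>v\<close> from every monomial. The degree drops by one, and
  the number of factors from \<open>L\<close> drops by one just when \<open>v\<close> itself is in
  \<open>L\<close>.\<close>

lemma van_div:
  assumes U: "subspace K U V" and v: "v \<in> carrier V" "v \<noteq> \<zero>\<^bsub>V\<^esub>" and g: "g \<in> carrier S"
    and vg: "inc v \<otimes>\<^bsub>S\<^esub> g \<in> van U k n"
  shows "n = 0 \<Longrightarrow> g = \<zero>\<^bsub>S\<^esub>"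
    and "n = Suc n' \<Longrightarrow> v \<in> U \<Longrightarrow> g \<in> van U (k - 1) n'"
    and "n = Suc n' \<Longrightarrow> v \<notin> U \<Longrightarrow> g \<in> van U k n'"
proof -
  obtain B L where BL: "basis B" "L \<subseteq> B" "L \<subseteq> U" "span L = U" "v \<in> B" "v \<in> L \<longleftrightarrow> v \<in> U"
    using adapted_basis[OF U, of v] v by metis
  obtain \<Theta> where T: "linear_map K S (free_vs K {m. set_mset m \<subseteq> B}) \<Theta>"
      "bij_betw \<Theta> (carrier S) (carrier (free_vs K {m. set_mset m \<subseteq> B}))"
      "\<Theta> \<one>\<^bsub>S\<^esub> = basis_vec K {m. set_mset m \<subseteq> B} {#}"
      "\<And>b f m. b \<in> B \<Longrightarrow> f \<in> carrier S \<Longrightarrow> set_mset m \<subseteq> B \<Longrightarrow>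
        \<Theta> (inc b \<otimes>\<^bsub>S\<^esub> f) m = (if b \<in># m then \<Theta> f (m - {#b#}) else \<zero>\<^bsub>K\<^esub>)"
    using coordinates[OF BL(1)] by blast
  interpret T: linear_map K S "free_vs K {m. set_mset m \<subseteq> B}" \<Theta>
    by (rule T(1))
  have iff: "f \<in> van U k n \<longleftrightarrow> (\<forall>m. set_mset m \<subseteq> B \<longrightarrow> \<Theta> f m \<noteq> \<zero>\<^bsub>K\<^esub> \<longrightarrow>
      size m = n \<and> k \<le> size (filter_mset (\<lambda>b. b \<in> L) m))" if "f \<in> carrier S" for f k n
    using van_coordinates[OF BL(1,2) T that] BL(4) by simp
  have vgc: "inc v \<otimes>\<^bsub>S\<^esub> g \<in> carrier S"
    using v(1) g by simp
  \<comment> \<open>The coefficient of \<open>m\<close> in \<open>g\<close> is the coefficient of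
    \<open>add_mset v m\<close> in the product, to which the monomial condition applies.\<close>
  have supp: "size m + 1 = n \<and> k \<le> size (filter_mset (\<lambda>b. b \<in> L) (add_mset v m))"
    if m: "set_mset m \<subseteq> B" "\<Theta> g m \<noteq> \<zero>\<^bsub>K\<^esub>" for m
  proof -
    have "\<Theta> (inc v \<otimes>\<^bsub>S\<^esub> g) (add_mset v m) \<noteq> \<zero>\<^bsub>K\<^esub>"
      using T(4)[OF BL(5) g, of "add_mset v m"] m BL(5) by simp
    moreover have "set_mset (add_mset v m) \<subseteq> B"
      using m(1) BL(5) by simp
    ultimately have "size (add_mset v m) = n \<and> k \<le> size (filter_mset (\<lambda>b. b \<in> L) (add_mset v m))"
      using vg unfolding iff[OF vgc] by blast
    then show ?thesis
      by simp
  qed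
  show "g = \<zero>\<^bsub>S\<^esub>" if "n = 0"
  proof -
    have eq: "\<Theta> g = \<Theta> \<zero>\<^bsub>S\<^esub>"
    proof (rule free_vs_ext)
      show "\<Theta> g \<in> carrier (free_vs K {m. set_mset m \<subseteq> B})" "\<Theta> \<zero>\<^bsub>S\<^esub> \<in> carrier (free_vs K {m. set_mset m \<subseteq> B})"
        using g T.T_im by blast+
      show "\<Theta> g m = \<Theta> \<zero>\<^bsub>S\<^esub> m" if "m \<in> {m. set_mset m \<subseteq> B}" for m
        using supp[of m] that \<open>n = 0\<close> by (auto simp: free_vs_zero)
    qed
    show ?thesis
      by (rule inj_onD[OF bij_betw_imp_inj_on[OF T(2)] eq g S.M.zero_closed])
  qed
  show "g \<in> van U (k - 1) n'" if "n = Suc n'" "v \<in> U"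
    unfolding iff[OF g]
  proof (intro allI impI)
    fix m assume "set_mset m \<subseteq> B" "\<Theta> g m \<noteq> \<zero>\<^bsub>K\<^esub>"
    from supp[OF this] show "size m = n' \<and> k - 1 \<le> size (filter_mset (\<lambda>b. b \<in> L) m)"
      using that BL(6) by auto
  qed
  show "g \<in> van U k n'" if "n = Suc n'" "v \<notin> U"
    unfolding iff[OF g]
  proof (intro allI impI)
    fix m assume "set_mset m \<subseteq> B" "\<Theta> g m \<noteq> \<zero>\<^bsub>K\<^esub>"
    from supp[OF this] show "size m = n' \<and> k \<le> size (filter_mset (\<lambda>b. b \<in> L) m)"
      using that BL(6) by auto
  qed
qed

text \<open>Zero belongs to the forms of degree 0, where no nonzero multiple of \<open>v\<close>
  lives.\<close>

lemma mult_cancel_zero: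
  assumes v: "v \<in> carrier V" "v \<noteq> \<zero>\<^bsub>V\<^esub>" and g: "g \<in> carrier S" "inc v \<otimes>\<^bsub>S\<^esub> g = \<zero>\<^bsub>S\<^esub>"
  shows "g = \<zero>\<^bsub>S\<^esub>"
proof (rule van_div(1)[OF subspace_carrier v g(1), where k = 0 and n = 0])
  show "inc v \<otimes>\<^bsub>S\<^esub> g \<in> van (carrier V) 0 0"
    using S.subspaceD(2)[OF van_subspace[of "carrier V" 0 0]] g(2) by simp
qed simp

lemma one_nonzero: "\<one>\<^bsub>S\<^esub> \<noteq> \<zero>\<^bsub>S\<^esub>"
proof
  assume h: "\<one>\<^bsub>S\<^esub> = \<zero>\<^bsub>S\<^esub>"
  have "lin_indpt {}"
    by (auto simp: lin_dep_def)
  then obtain B where B: "basis B"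
    using exists_basis_extending[of "{}"] by auto
  obtain \<Theta> where T: "linear_map K S (free_vs K {m. set_mset m \<subseteq> B}) \<Theta>"
      "\<Theta> \<one>\<^bsub>S\<^esub> = basis_vec K {m. set_mset m \<subseteq> B} {#}"
    using coordinates[OF B] by blast
  interpret T: linear_map K S "free_vs K {m. set_mset m \<subseteq> B}" \<Theta>
    by (rule T(1))
  have "\<Theta> \<one>\<^bsub>S\<^esub> {#} = \<zero>\<^bsub>K\<^esub>"
    unfolding h by (simp add: free_vs_zero)
  then show False
    by (simp add: T(2) basis_vec_apply)
qed

text \<open>\<open>H\<close> substitutes \<open>h\<close>, which changes each vector by a multiple
  of \<open>v\<close>; hence every form is congruent to its image modulo \<open>v\<close>. In
  particular the kernel of \<open>H\<close> consists of multiples of \<open>v\<close>.\<close>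

lemma hom_complement:
  assumes H: "alg_hom K S S H" "\<And>w. w \<in> carrier V \<Longrightarrow> H (inc w) = inc (h w)"
    and h: "h \<in> carrier V \<rightarrow> carrier V"
    and v: "v \<in> carrier V" "\<And>w. w \<in> carrier V \<Longrightarrow> \<exists>c\<in>carrier K. w = h w \<oplus>\<^bsub>V\<^esub> c \<odot>\<^bsub>V\<^esub> v"
    and f: "f \<in> carrier S"
  shows "\<exists>g\<in>carrier S. f = H f \<oplus>\<^bsub>S\<^esub> inc v \<otimes>\<^bsub>S\<^esub> g"
proof -
  interpret H: alg_hom K S S H
    by (rule H(1))
  have iv: "inc v \<in> carrier S"
    using v(1) by simp
  let ?N = "{f \<in> carrier S. \<exists>g\<in>carrier S. f = H f \<oplus>\<^bsub>S\<^esub> inc v \<otimes>\<^bsub>S\<^esub> g}"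
  have "?N = carrier S"
  proof (rule generated)
    show "subspace K ?N S"
    proof (rule S.subspaceI)
      show "\<zero>\<^bsub>S\<^esub> \<in> ?N"
        using iv by (auto intro!: bexI[of _ "\<zero>\<^bsub>S\<^esub>"])
      fix f f' assume "f \<in> ?N" "f' \<in> ?N"
      then obtain g g' where g: "f \<in> carrier S" "g \<in> carrier S" "f = H f \<oplus>\<^bsub>S\<^esub> inc v \<otimes>\<^bsub>S\<^esub> g"
        "f' \<in> carrier S" "g' \<in> carrier S" "f' = H f' \<oplus>\<^bsub>S\<^esub> inc v \<otimes>\<^bsub>S\<^esub> g'"
        by blast
      have "f \<oplus>\<^bsub>S\<^esub> f' = (H f \<oplus>\<^bsub>S\<^esub> inc v \<otimes>\<^bsub>S\<^esub> g) \<oplus>\<^bsub>S\<^esub> (H f' \<oplus>\<^bsub>S\<^esub> inc v \<otimes>\<^bsub>S\<^esub> g')"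
        using g(3,6) by simp
      also have "\<dots> = H (f \<oplus>\<^bsub>S\<^esub> f') \<oplus>\<^bsub>S\<^esub> inc v \<otimes>\<^bsub>S\<^esub> (g \<oplus>\<^bsub>S\<^esub> g')"
        using g(1,2,4,5) iv by (simp add: S.r_distr S.a_ac)
      finally show "f \<oplus>\<^bsub>S\<^esub> f' \<in> ?N"
        using g(1,2,4,5) by blast
    next
      fix c f assume c: "c \<in> carrier K" and "f \<in> ?N"
      then obtain g where g: "f \<in> carrier S" "g \<in> carrier S" "f = H f \<oplus>\<^bsub>S\<^esub> inc v \<otimes>\<^bsub>S\<^esub> g"
        by blast
      have "c \<odot>\<^bsub>S\<^esub> f = c \<odot>\<^bsub>S\<^esub> (H f \<oplus>\<^bsub>S\<^esub> inc v \<otimes>\<^bsub>S\<^esub> g)"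
        using g(3) by simp
      also have "\<dots> = H (c \<odot>\<^bsub>S\<^esub> f) \<oplus>\<^bsub>S\<^esub> inc v \<otimes>\<^bsub>S\<^esub> (c \<odot>\<^bsub>S\<^esub> g)"
        using g(1,2) iv c by (simp add: S.smult_r_distr S.mult_smult_right)
      finally show "c \<odot>\<^bsub>S\<^esub> f \<in> ?N"
        using g(1,2) c by blast
    qed auto
    show "\<one>\<^bsub>S\<^esub> \<in> ?N"
      using iv by (auto simp: H.hom_one intro!: bexI[of _ "\<zero>\<^bsub>S\<^esub>"])
    fix w f assume w: "w \<in> carrier V" and "f \<in> ?N"
    then obtain g where g: "f \<in> carrier S" "g \<in> carrier S" "f = H f \<oplus>\<^bsub>S\<^esub> inc v \<otimes>\<^bsub>S\<^esub> g"
      by blast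
    obtain c where c: "c \<in> carrier K" "w = h w \<oplus>\<^bsub>V\<^esub> c \<odot>\<^bsub>V\<^esub> v"
      using v(2)[OF w] by blast
    have hw: "h w \<in> carrier V"
      using h w by blast
    \<comment> \<open>The part of \<open>w\<close> along \<open>v\<close> contributes a multiple of
      \<open>v\<close> at once; for the part \<open>h w\<close> the decomposition of
      \<open>f\<close> is multiplied through.\<close>
    have "inc w = inc (h w) \<oplus>\<^bsub>S\<^esub> c \<odot>\<^bsub>S\<^esub> inc v"
      using arg_cong[OF c(2), of inc] hw v(1) c(1) by simp
    then have "inc w \<otimes>\<^bsub>S\<^esub> f = inc (h w) \<otimes>\<^bsub>S\<^esub> f \<oplus>\<^bsub>S\<^esub> inc v \<otimes>\<^bsub>S\<^esub> (c \<odot>\<^bsub>S\<^esub> f)"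
      using g(1) hw iv c(1) by (simp add: S.l_distr S.smult_assoc2 S.mult_smult_right)
    also have "inc (h w) \<otimes>\<^bsub>S\<^esub> f = inc (h w) \<otimes>\<^bsub>S\<^esub> (H f \<oplus>\<^bsub>S\<^esub> inc v \<otimes>\<^bsub>S\<^esub> g)"
      using g(3) by simp
    also have "\<dots> = H (inc w \<otimes>\<^bsub>S\<^esub> f) \<oplus>\<^bsub>S\<^esub> inc v \<otimes>\<^bsub>S\<^esub> (inc (h w) \<otimes>\<^bsub>S\<^esub> g)"
      using g(1,2) hw iv w by (simp add: S.r_distr H.hom_mult H(2) S.m_lcomm)
    finally have "inc w \<otimes>\<^bsub>S\<^esub> f = H (inc w \<otimes>\<^bsub>S\<^esub> f) \<oplus>\<^bsub>S\<^esub> inc v \<otimes>\<^bsub>S\<^esub> (inc (h w) \<otimes>\<^bsub>S\<^esub> g \<oplus>\<^bsub>S\<^esub> c \<odot>\<^bsub>S\<^esub> f)"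
      using g(1,2) hw iv w c(1) by (simp add: S.r_distr S.a_assoc)
    then show "inc w \<otimes>\<^bsub>S\<^esub> f \<in> ?N"
      using g(1,2) hw iv w c(1) by (auto intro!: bexI[of _ "inc (h w) \<otimes>\<^bsub>S\<^esub> g \<oplus>\<^bsub>S\<^esub> c \<odot>\<^bsub>S\<^esub> f"])
  qed
  then show ?thesis
    using f by blast
qed

end

section \<open>Vector configurations\<close>

subsection \<open>Nullity and cyclic sets\<close>

context vectorspace
begin

lemma indpt_span_dim:
  assumes "L \<subseteq> carrier V" "lin_indpt L" "finite L"
  shows "vectorspace.dim K (vs (span L)) = card L"
proof -
  interpret N: vectorspace K "vs (span L)"
    by (rule subspace_is_vs[OF span_subspace[OF assms(1)]])
  have L: "L \<subseteq> span L"
    by (rule in_own_span[OF assms(1)])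
  have "N.basis L"
    using span_li_not_depend[OF L span_is_submodule[OF assms(1)]] L assms(2) by (simp add: N.basis_def)
  then show ?thesis
    using N.dim_basis assms(3) by blast
qed

lemma span_insert_eq:
  assumes "Y \<subseteq> carrier V" "Z \<subseteq> carrier V" "v \<in> carrier V" "span Y = span Z"
  shows "span (insert v Y) = span (insert v Z)"
  using span_Un[of "{v}" "{v}" Y Z] assms by simp

lemma span_dim_insert:
  assumes Y: "finite Y" "Y \<subseteq> carrier V" and v: "v \<in> carrier V"
  shows "vectorspace.dim K (vs (span (insert v Y))) =
    vectorspace.dim K (vs (span Y)) + (if v \<in> span Y then 0 else 1)"
proof (cases "v \<in> span Y")
  case True
  then show ?thesis
    using already_in_span[OF Y(2) True] by simp
next
  case False
  interpret N: vectorspace K "vs (span Y)"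
    by (rule subspace_is_vs[OF span_subspace[OF Y(2)]])
  obtain L where L: "finite L" "N.basis L"
    using N.finite_basis_exists fin_dim_span(1)[OF Y] by blast
  then have LY: "L \<subseteq> span Y"
    by (auto simp: N.basis_def)
  then have L': "lin_indpt L" "span L = span Y"
    using L(2) span_li_not_depend[OF LY span_is_submodule[OF Y(2)]] by (auto simp: N.basis_def)
  have Lc: "L \<subseteq> carrier V"
    using LY span_is_subset2[OF Y(2)] by blast
  have vL: "v \<notin> L"
    using False LY by blast
  have "lin_indpt (insert v L)"
    using lin_dep_iff_in_span[OF Lc L'(1) v vL] False L'(2) by simp
  then have "vectorspace.dim K (vs (span (insert v L))) = Suc (card L)"
    using indpt_span_dim[of "insert v L"] Lc v L(1) vL by simp
  moreover have "span (insert v L) = span (insert v Y)"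
    by (rule span_insert_eq[OF Lc Y(2) v L'(2)])
  moreover have "vectorspace.dim K (vs (span Y)) = card L"
    using indpt_span_dim[OF Lc L'(1) L(1)] L'(2) by simp
  ultimately show ?thesis
    using False by simp
qed

text \<open>The level plus one. On finite sets the difference is never truncated, by
  \<open>rank_le_card\<close>.\<close>

definition nullity :: "('e \<Rightarrow> 'c) \<Rightarrow> 'e set \<Rightarrow> nat" where
  "nullity x Y = card Y - vectorspace.dim K (vs (span (x ` Y)))"

text \<open>Nonempty and without coloops: the nonempty unions of circuits, that is, the
  T-flats.\<close>

definition cyclic :: "('e \<Rightarrow> 'c) \<Rightarrow> 'e set \<Rightarrow> bool" where
  "cyclic x A \<longleftrightarrow> A \<noteq> {} \<and> (\<forall>a\<in>A. x a \<in> span (x ` (A - {a})))"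

lemma nullity_empty [simp]: "nullity x {} = 0"
  by (simp add: nullity_def)

context
  fixes x :: "'e \<Rightarrow> 'c"
  assumes x: "\<And>a. x a \<in> carrier V"
begin

lemma x_image: "x ` Y \<subseteq> carrier V"
  using x by blast

lemma span_x_subspace: "subspace K (span (x ` Y)) V"
  by (rule span_subspace[OF x_image])

lemma span_x_closed: "span (x ` Y) \<subseteq> carrier V"
  by (rule span_is_subset2[OF x_image])

lemma in_span_x: "a \<in> Y \<Longrightarrow> x a \<in> span (x ` Y)"
  using in_own_span[OF x_image] by blast

lemma span_x_mono: "Y \<subseteq> Z \<Longrightarrow> span (x ` Y) \<subseteq> span (x ` Z)"
  by (intro span_is_monotone image_mono)

lemma rank_le_card:
  assumes "finite Y"
  shows "vectorspace.dim K (vs (span (x ` Y))) \<le> card Y"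
  using fin_dim_span(2)[OF _ x_image, of Y] card_image_le[of Y x] assms by force

lemma nullity_insert:
  assumes "finite Y" "a \<notin> Y"
  shows "nullity x (insert a Y) = nullity x Y + (if x a \<in> span (x ` Y) then 1 else 0)"
  using span_dim_insert[OF _ x_image x, of Y a] assms rank_le_card[of Y] rank_le_card[of "insert a Y"]
  by (auto simp: nullity_def)

lemma nullity_remove:
  assumes "finite Y" "a \<in> Y"
  shows "nullity x Y = nullity x (Y - {a}) + (if x a \<in> span (x ` (Y - {a})) then 1 else 0)"
  using nullity_insert[of "Y - {a}" a] assms by (simp add: insert_absorb)

lemma nullity_mono:
  assumes "finite Z" "Y \<subseteq> Z"
  shows "nullity x Y \<le> nullity x Z"
proof -
  have "nullity x Y \<le> nullity x (Y \<union> D)" if "finite D" for D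
    using that
  proof (induction D)
    case (insert a D)
    have fin: "finite (Y \<union> D)"
      using insert.hyps(1) assms finite_subset by blast
    show ?case
    proof (cases "a \<in> Y \<union> D")
      case True
      then have "Y \<union> insert a D = Y \<union> D"
        by blast
      then show ?thesis
        using insert.IH by simp
    next
      case False
      then show ?thesis
        using nullity_insert[OF fin False] insert.IH by simp
    qed
  qed simp
  from this[of Z] show ?thesis
    using assms by (simp add: Un_absorb1)
qed

text \<open>An element that depends on the smaller set depends on the larger one too, so each
  insertion raises the nullity of the larger set at least as much.\<close>

lemma nullity_supermodular:
  assumes "finite Z" "finite D" "Y \<subseteq> Z" "D \<inter> Z = {}"
  shows "nullity x (Y \<union> D) + nullity x Z \<le> nullity x (Z \<union> D) + nullity x Y"
  using assms(2,4)
proof (induction D)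
  case (insert a D)
  have fin: "finite (Y \<union> D)" "finite (Z \<union> D)"
    using insert.hyps(1) assms finite_subset by blast+
  have a: "a \<notin> Y \<union> D" "a \<notin> Z \<union> D"
    using insert assms(3) by auto
  have "x a \<in> span (x ` (Y \<union> D)) \<Longrightarrow> x a \<in> span (x ` (Z \<union> D))"
    using span_x_mono[of "Y \<union> D" "Z \<union> D"] assms(3) by blast
  then show ?case
    using nullity_insert[OF fin(1) a(1)] nullity_insert[OF fin(2) a(2)] insert by simp
qed simp

lemma cyclic_remove:
  assumes "cyclic x A" "finite A" "a \<in> A"
  shows "nullity x A = Suc (nullity x (A - {a}))"
  using nullity_remove[OF assms(2,3)] assms(1,3) by (simp add: cyclic_def)

lemma cyclic_pos:
  assumes "cyclic x A" "finite A"
  shows "0 < nullity x A"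
proof -
  obtain a where "a \<in> A"
    using assms(1) by (auto simp: cyclic_def)
  then show ?thesis
    using cyclic_remove[OF assms] by simp
qed

text \<open>Count the dimension of the span of \<open>Y\<close>, \<open>a\<close> and
  \<open>b\<close> in both orders of insertion: starting with \<open>b\<close>, it exceeds that of
  \<open>Y\<close> by at most one, and \<open>a\<close> alone already accounts for this one.\<close>

lemma span_exchange:
  assumes "finite Y" "x a \<in> span (x ` insert b Y)" "x a \<notin> span (x ` Y)"
  shows "x b \<in> span (x ` insert a Y)"
proof -
  have Y: "finite (x ` Y)" "x ` Y \<subseteq> carrier V"
    using assms(1) x_image by auto
  have "insert (x a) (insert (x b) (x ` Y)) = insert (x b) (insert (x a) (x ` Y))"
    by blast
  then show ?thesis
    using span_dim_insert[of "insert (x b) (x ` Y)" "x a"] span_dim_insert[of "insert (x a) (x ` Y)" "x b"]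
      span_dim_insert[OF Y x[of a]] span_dim_insert[OF Y x[of b]] Y x assms(2,3)
    by (auto split: if_splits)
qed

end

end

text \<open>The beta invariant, written with the nullity in place of the rank so that the recursion
  below has no exceptions; this is the beta invariant of the dual.\<close>

definition beta :: "('e set \<Rightarrow> nat) \<Rightarrow> 'e set \<Rightarrow> int" where
  "beta \<nu> A = - ((-1) ^ (card A + \<nu> A)) * (\<Sum>Y\<in>Pow A. (-1) ^ card Y * int (\<nu> Y))"

lemma sum_Pow_insert:
  fixes g :: "'e set \<Rightarrow> int"
  assumes "finite A" "e \<notin> A"
  shows "(\<Sum>Y\<in>Pow (insert e A). g Y) = (\<Sum>Y\<in>Pow A. g Y) + (\<Sum>Y\<in>Pow A. g (insert e Y))"
proof -
  have inj: "inj_on (insert e) (Pow A)"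
    using assms(2) by (intro inj_onI) (metis PowD insert_ident subsetD)
  have "(\<Sum>Y\<in>Pow (insert e A). g Y) = (\<Sum>Y\<in>Pow A. g Y) + (\<Sum>Y\<in>insert e ` Pow A. g Y)"
    unfolding Pow_insert using assms by (intro sum.union_disjoint) auto
  then show ?thesis
    using sum.reindex[OF inj, of g] by simp
qed

lemma sum_Pow_signs:
  assumes "finite A" "A \<noteq> {}"
  shows "(\<Sum>Y\<in>Pow A. (-1::int) ^ card Y) = 0"
proof -
  obtain e where e: "e \<in> A"
    using assms(2) by blast
  have fin: "finite (A - {e})"
    using assms(1) by simp
  have "(\<Sum>Y\<in>Pow (insert e (A - {e})). (-1::int) ^ card Y)
      = (\<Sum>Y\<in>Pow (A - {e}). (-1) ^ card Y) + (\<Sum>Y\<in>Pow (A - {e}). (-1) ^ card (insert e Y))"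
    by (rule sum_Pow_insert[OF fin]) simp
  also have "(\<Sum>Y\<in>Pow (A - {e}). (-1::int) ^ card (insert e Y)) = (\<Sum>Y\<in>Pow (A - {e}). - ((-1) ^ card Y))"
  proof (rule sum.cong[OF refl])
    fix Y assume "Y \<in> Pow (A - {e})"
    then have "finite Y" "e \<notin> Y"
      using fin by (auto intro: finite_subset)
    then show "(-1::int) ^ card (insert e Y) = - ((-1) ^ card Y)"
      by simp
  qed
  finally show ?thesis
    using e by (simp add: insert_absorb sum_negf)
qed

text \<open>Pairs each \<open>Y\<close> not containing \<open>e\<close> with
  \<open>insert e Y\<close>; the opposite signs turn the sum into a difference.\<close>

lemma beta_split:
  assumes "finite A" "e \<in> A" "\<And>Y. Y \<subseteq> A - {e} \<Longrightarrow> int (\<nu> (insert e Y)) = g Y"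
  shows "beta \<nu> A = - ((-1) ^ (card A + \<nu> A)) *
    ((\<Sum>Y\<in>Pow (A - {e}). (-1) ^ card Y * int (\<nu> Y)) - (\<Sum>Y\<in>Pow (A - {e}). (-1) ^ card Y * g Y))"
proof -
  have fin: "finite (A - {e})"
    using assms(1) by simp
  have "(\<Sum>Y\<in>Pow (insert e (A - {e})). (-1) ^ card Y * int (\<nu> Y))
      = (\<Sum>Y\<in>Pow (A - {e}). (-1) ^ card Y * int (\<nu> Y))
        + (\<Sum>Y\<in>Pow (A - {e}). (-1) ^ card (insert e Y) * int (\<nu> (insert e Y)))"
    by (rule sum_Pow_insert[OF fin]) simp
  also have "(\<Sum>Y\<in>Pow (A - {e}). (-1) ^ card (insert e Y) * int (\<nu> (insert e Y)))
      = (\<Sum>Y\<in>Pow (A - {e}). - ((-1) ^ card Y * g Y))"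
  proof (rule sum.cong[OF refl])
    fix Y assume Y: "Y \<in> Pow (A - {e})"
    then have "finite Y" "e \<notin> Y"
      using fin by (auto intro: finite_subset)
    then show "(-1) ^ card (insert e Y) * int (\<nu> (insert e Y)) = - ((-1) ^ card Y * g Y)"
      using assms(3)[of Y] Y by simp
  qed
  finally show ?thesis
    using assms(2) by (simp add: beta_def insert_absorb sum_negf)
qed

lemma beta_coloop:
  assumes "finite A" "e \<in> A" "\<And>Y. Y \<subseteq> A - {e} \<Longrightarrow> \<nu> (insert e Y) = \<nu> Y"
  shows "beta \<nu> A = 0"
  using beta_split[OF assms(1,2), of \<nu> "\<lambda>Y. int (\<nu> Y)"] assms(3) by simp

text \<open>Within each pair the terms differ by the sign of \<open>Y\<close> alone, and these signs
  sum to zero because \<open>A - {e}\<close> is nonempty.\<close>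

lemma beta_loop:
  assumes "finite A" "e \<in> A" "A \<noteq> {e}" "\<And>Y. Y \<subseteq> A - {e} \<Longrightarrow> \<nu> (insert e Y) = Suc (\<nu> Y)"
  shows "beta \<nu> A = 0"
proof -
  have "(\<Sum>Y\<in>Pow (A - {e}). (-1::int) ^ card Y) = 0"
    using assms by (intro sum_Pow_signs) auto
  then have "(\<Sum>Y\<in>Pow (A - {e}). (-1) ^ card Y * (int (\<nu> Y) + 1))
      = (\<Sum>Y\<in>Pow (A - {e}). (-1) ^ card Y * int (\<nu> Y))"
    by (simp add: distrib_left sum.distrib)
  then show ?thesis
    using beta_split[OF assms(1,2), of \<nu> "\<lambda>Y. int (\<nu> Y) + 1"] assms(4) by simp
qed

text \<open>Passing to \<open>A - {e}\<close> lowers the exponent of the leading sign by two for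
  \<open>\<nu>\<close> but only by one for \<open>\<nu>'\<close>; this sign change absorbs the minus
  in \<open>beta_split\<close>.\<close>

lemma beta_deletion_contraction:
  assumes "finite A" "e \<in> A" "\<nu> A = Suc (\<nu> (A - {e}))" "\<And>Y. Y \<subseteq> A - {e} \<Longrightarrow> \<nu> (insert e Y) = \<nu>' Y"
  shows "beta \<nu> A = beta \<nu> (A - {e}) + beta \<nu>' (A - {e})"
proof -
  have "\<nu>' (A - {e}) = \<nu> A"
    using assms(2) assms(4)[of "A - {e}"] by (simp add: insert_absorb)
  moreover have "card A = Suc (card (A - {e}))"
    by (rule card.remove[OF assms(1,2)])
  ultimately show ?thesis
    using beta_split[OF assms(1,2), of \<nu> "\<lambda>Y. int (\<nu>' Y)"] assms(3,4)
    by (simp add: beta_def algebra_simps)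
qed

subsection \<open>Multiplicity spaces of a configuration\<close>

context symmetric_algebra
begin

text \<open>One factor is chosen from each intersection along a chain of T-flats, and nullity 1
  stands for level 0. Building the chain from the bottom replaces lists of flats, and letting the
  chain vary makes the span of these products the sum over all chains.\<close>

inductive chain_prod :: "('e \<Rightarrow> 'v) \<Rightarrow> 'e set \<Rightarrow> 's \<Rightarrow> bool" for x where
  base: "cyclic x A \<Longrightarrow> finite A \<Longrightarrow> nullity x A = 1 \<Longrightarrow> chain_prod x A \<one>\<^bsub>S\<^esub>"
| step: "chain_prod x I f \<Longrightarrow> cyclic x A \<Longrightarrow> finite A \<Longrightarrow> I \<subset> A \<Longrightarrow> nullity x A = Suc (nullity x I)
    \<Longrightarrow> w \<in> span (x ` (A - I)) \<Longrightarrow> w \<in> span (x ` I) \<Longrightarrow> chain_prod x A (inc w \<otimes>\<^bsub>S\<^esub> f)"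

definition mult_sp :: "('e \<Rightarrow> 'v) \<Rightarrow> 'e set \<Rightarrow> 's set" where
  "mult_sp x A = S.span {f. chain_prod x A f}"

text \<open>The description of the multiplicity space by vanishing conditions.\<close>

definition van_sp :: "('e \<Rightarrow> 'v) \<Rightarrow> 'e set \<Rightarrow> 's set" where
  "van_sp x A = (if nullity x A = 0 then {\<zero>\<^bsub>S\<^esub>}
     else {f \<in> carrier S. \<forall>Y. Y \<subset> A \<longrightarrow> f \<in> van (span (x ` Y)) (nullity x Y) (nullity x A - 1)})"

lemma van_sp_trivial:
  assumes "Y \<subset> A" "van (span (x ` Y)) (nullity x Y) (nullity x A - 1) = {\<zero>\<^bsub>S\<^esub>}"
  shows "van_sp x A \<subseteq> {\<zero>\<^bsub>S\<^esub>}"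
proof
  fix f assume "f \<in> van_sp x A"
  then have "nullity x A = 0 \<and> f = \<zero>\<^bsub>S\<^esub> \<or> f \<in> van (span (x ` Y)) (nullity x Y) (nullity x A - 1)"
    using assms(1) by (simp add: van_sp_def split: if_splits)
  then show "f \<in> {\<zero>\<^bsub>S\<^esub>}"
    using assms(2) by blast
qed

lemma chain_prod_cyclic: "chain_prod x A f \<Longrightarrow> cyclic x A" "chain_prod x A f \<Longrightarrow> finite A"
  by (auto elim: chain_prod.cases)

context
  fixes x :: "'e \<Rightarrow> 'v"
  assumes x: "\<And>a. x a \<in> carrier V"
begin

lemma chain_prod_closed: "chain_prod x A f \<Longrightarrow> f \<in> carrier S"
proof (induction rule: chain_prod.induct)
  case (step I f A w)
  then have "w \<in> carrier V"
    using span_x_closed[where x = x, OF x] by blast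
  then show ?case
    using step by simp
qed simp

lemma mult_sp_subspace: "subspace K (mult_sp x A) S"
  unfolding mult_sp_def using chain_prod_closed by (intro S.span_subspace) auto

lemma chain_prod_mult_sp: "chain_prod x A f \<Longrightarrow> f \<in> mult_sp x A"
  unfolding mult_sp_def using chain_prod_closed by (intro S.span_mem) auto

lemma van_sp_subspace: "subspace K (van_sp x A) S"
proof (cases "nullity x A = 0")
  case True
  then show ?thesis
    using S.subspace_zero by (simp add: van_sp_def)
next
  case False
  have N: "subspace K (van (span (x ` Y)) k n) S" for Y k n
    by (rule van_subspace[OF span_x_closed[where x = x, OF x]])
  have "subspace K {f \<in> carrier S. \<forall>Y. Y \<subset> A \<longrightarrow>
      f \<in> van (span (x ` Y)) (nullity x Y) (nullity x A - 1)} S"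
    by (rule S.subspaceI) (auto intro: S.subspaceD(2-4)[OF N])
  then show ?thesis
    using False by (simp add: van_sp_def)
qed

lemma nullity_psubset_cyclic:
  assumes "cyclic x A" "finite A" "a \<in> A" "Y \<subseteq> A - {a}"
  shows "nullity x Y \<le> nullity x A - 1"
  using nullity_mono[where x = x, OF x _ assms(4)] cyclic_remove[where x = x, OF x assms(1-3)] assms(2) by simp

text \<open>The factor of a step from \<open>I\<close> to \<open>A\<close> lies in the span of \<open>Y\<close> if \<open>Y\<close> contains \<open>I\<close> or
  \<open>A - I\<close>. Only in the latter case does the nullity of the intersection with \<open>Y\<close> grow, and if
  \<open>Y\<close> contains the first circuit but not \<open>A\<close>, the first step leaving \<open>Y\<close> yields one further
  factor in the span of \<open>Y\<close>.\<close>

lemma chain_prod_van: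
  assumes "chain_prod x A f" "finite Y"
  shows "f \<in> van (span (x ` Y)) (if A \<subseteq> Y then nullity x A - 1 else nullity x (Y \<inter> A)) (nullity x A - 1)"
  using assms(1)
proof (induction rule: chain_prod.induct)
  case (base A)
  have "nullity x (Y \<inter> A) = 0" if not: "\<not> A \<subseteq> Y"
  proof -
    obtain a where "a \<in> A" "a \<notin> Y"
      using not by blast
    then show ?thesis
      using nullity_psubset_cyclic[OF base(1,2), of a "Y \<inter> A"] base(3) by auto
  qed
  then show ?case
    using prods_van[OF prods.one span_x_closed[where x = x, OF x]] base(3) by simp
next
  case (step I f A w)
  let ?U = "span (x ` Y)"
  have Uc: "?U \<subseteq> carrier V"
    by (rule span_x_closed[where x = x, OF x])
  have wc: "w \<in> carrier V"
    using step(7) span_x_closed[where x = x, OF x] by blast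
  obtain n where n: "nullity x I = Suc n"
    using cyclic_pos[where x = x, OF x chain_prod_cyclic[OF step(1)]] by (auto simp: gr0_conv_Suc)
  have IA: "I \<subseteq> A" "finite I"
    using step(3,4) finite_subset by auto
  note IH = step.IH[unfolded n diff_Suc_1]
  have deg: "nullity x A - 1 = Suc n"
    using step(5) n by simp
  show ?case
  \<comment> \<open>If \<open>I\<close> is contained in \<open>Y\<close>, the earlier factors and
    \<open>w\<close> all lie in the span of \<open>Y\<close>. The order is then the full degree,
    which the nullity of a proper subset of the cyclic set \<open>A\<close> cannot exceed.\<close>
  proof (cases "I \<subseteq> Y")
    case True
    then have "w \<in> ?U"
      using step(7) span_x_mono[where x = x, OF x True] by blast
    then have f: "inc w \<otimes>\<^bsub>S\<^esub> f \<in> van ?U (Suc n) (Suc n)"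
      using IH True van_mult_in[OF Uc] by simp
    have "nullity x (Y \<inter> A) \<le> Suc n" if not: "\<not> A \<subseteq> Y"
    proof -
      obtain a where "a \<in> A" "a \<notin> Y"
        using not by blast
      then show ?thesis
        using nullity_psubset_cyclic[OF step(2,3), of a "Y \<inter> A"] deg by auto
    qed
    then show ?thesis
      using f van_le[OF Uc] deg by auto
  next
    case False
    then have f: "f \<in> van ?U (nullity x (Y \<inter> I)) n" and nA: "\<not> A \<subseteq> Y"
      using IH IA(1) by auto
    show ?thesis
    proof (cases "A - I \<subseteq> Y")
      case True
      then have "w \<in> ?U"
        using step(6) span_x_mono[where x = x, OF x True] by blast
      then have g: "inc w \<otimes>\<^bsub>S\<^esub> f \<in> van ?U (Suc (nullity x (Y \<inter> I))) (Suc n)"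
        using f van_mult_in[OF Uc] by simp
      \<comment> \<open>Supermodularity: inserting \<open>A - I\<close> raises the nullity over
        \<open>Y \<inter> I\<close> by no more than over \<open>I\<close>, that is, by at most one,
        and the new factor pays for it.\<close>
      have "nullity x ((Y \<inter> I) \<union> (A - I)) + nullity x I \<le> nullity x (I \<union> (A - I)) + nullity x (Y \<inter> I)"
        using IA step(3) by (intro nullity_supermodular[where x = x, OF x]) auto
      moreover have "(Y \<inter> I) \<union> (A - I) = Y \<inter> A" "I \<union> (A - I) = A"
        using True IA(1) by auto
      ultimately have "nullity x (Y \<inter> A) \<le> Suc (nullity x (Y \<inter> I))"
        using step(5) by simp
      then show ?thesis
        using g van_le[OF Uc] deg nA by auto
    next
      case out: False
      then obtain a where a: "a \<in> A" "a \<notin> I" "a \<notin> Y"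
        by blast
      have g: "inc w \<otimes>\<^bsub>S\<^esub> f \<in> van ?U (nullity x (Y \<inter> I)) (Suc n)"
        using f van_mult_any[OF Uc wc] by simp
      let ?D = "Y \<inter> (A - I)"
      \<comment> \<open>The set \<open>A - {a}\<close> has the same nullity as \<open>I\<close>, so
        \<open>?D\<close> adds nothing to the nullity of \<open>I\<close>; by supermodularity it
        adds nothing over \<open>Y \<inter> I\<close> either.\<close>
      have "nullity x ((Y \<inter> I) \<union> ?D) + nullity x I \<le> nullity x (I \<union> ?D) + nullity x (Y \<inter> I)"
        using IA step(3) by (intro nullity_supermodular[where x = x, OF x]) auto
      moreover have "(Y \<inter> I) \<union> ?D = Y \<inter> A"
        using IA(1) by auto
      moreover have "nullity x (I \<union> ?D) \<le> Suc n"
        using nullity_psubset_cyclic[OF step(2,3) a(1), of "I \<union> ?D"] a IA(1) deg by auto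
      ultimately have "nullity x (Y \<inter> A) \<le> nullity x (Y \<inter> I)"
        using n by simp
      then show ?thesis
        using g van_le[OF Uc] deg nA by auto
    qed
  qed
qed

lemma mult_sp_subset_van_sp: "mult_sp x A \<subseteq> van_sp x A"
proof -
  have "f \<in> van_sp x A" if f: "chain_prod x A f" for f
  proof -
    have "nullity x A \<noteq> 0"
      using cyclic_pos[where x = x, OF x chain_prod_cyclic[OF f]] by simp
    moreover have "f \<in> van (span (x ` Y)) (nullity x Y) (nullity x A - 1)" if "Y \<subset> A" for Y
    proof -
      have "finite Y" "\<not> A \<subseteq> Y" "Y \<inter> A = Y"
        using that chain_prod_cyclic(2)[OF f] finite_subset by auto
      then show ?thesis
        using chain_prod_van[OF f, of Y] by simp
    qed
    ultimately show ?thesis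
      using chain_prod_closed[OF f] by (simp add: van_sp_def)
  qed
  then show ?thesis
    unfolding mult_sp_def by (intro S.span_minimal van_sp_subspace) auto
qed

text \<open>Going from \<open>A - {e}\<close> to \<open>A\<close> is itself a step of a chain: the
  difference is \<open>{e}\<close>, and \<open>x e\<close> lies in the span of the rest, so
  \<open>x e\<close> is an admissible factor.\<close>

lemma chain_prod_deletion:
  assumes "chain_prod x (A - {e}) f" "e \<in> A" "finite A" "x e \<in> span (x ` (A - {e}))"
  shows "chain_prod x A (inc (x e) \<otimes>\<^bsub>S\<^esub> f)"
proof (rule chain_prod.step[OF assms(1)])
  have cyc: "cyclic x (A - {e})"
    by (rule chain_prod_cyclic(1)[OF assms(1)])
  have "x a \<in> span (x ` (A - {a}))" if "a \<in> A" for a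
  proof (cases "a = e")
    case False
    then have "x a \<in> span (x ` (A - {e} - {a}))"
      using cyc that by (auto simp: cyclic_def)
    moreover have "A - {e} - {a} \<subseteq> A - {a}"
      by blast
    ultimately show ?thesis
      using span_x_mono[where x = x, OF x] by blast
  qed (use assms(4) in simp)
  then show "cyclic x A"
    using assms(2) by (auto simp: cyclic_def)
  show "nullity x A = Suc (nullity x (A - {e}))"
    using nullity_remove[where x = x, OF x assms(3,2)] assms(4) by simp
  have "A - (A - {e}) = {e}"
    using assms(2) by blast
  then show "x e \<in> span (x ` (A - (A - {e})))"
    using in_span_x[where x = x, OF x, of e "{e}"] by simp
qed (use assms in auto)

lemma mult_sp_deletion:
  assumes "g \<in> mult_sp x (A - {e})" "e \<in> A" "finite A" "x e \<in> span (x ` (A - {e}))"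
  shows "inc (x e) \<otimes>\<^bsub>S\<^esub> g \<in> mult_sp x A"
proof -
  interpret m: linear_map K S S "\<lambda>f. inc (x e) \<otimes>\<^bsub>S\<^esub> f"
    using x by (intro mult_linear) auto
  have "{f. chain_prod x (A - {e}) f} \<subseteq> {f \<in> carrier S. inc (x e) \<otimes>\<^bsub>S\<^esub> f \<in> mult_sp x A}"
    using chain_prod_deletion[OF _ assms(2-4)] chain_prod_mult_sp chain_prod_closed by blast
  then have "mult_sp x (A - {e}) \<subseteq> {f \<in> carrier S. inc (x e) \<otimes>\<^bsub>S\<^esub> f \<in> mult_sp x A}"
    unfolding mult_sp_def[of x "A - {e}"] by (intro S.span_minimal m.preimage_subspace mult_sp_subspace)
  then show ?thesis
    using assms(1) by blast
qed

end

section \<open>Contraction along a nonzero vector\<close>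

lemma contraction_exists:
  assumes v: "v \<in> carrier V" "v \<noteq> \<zero>\<^bsub>V\<^esub>"
  shows "\<exists>h. linear_map K V V h \<and> h v = \<zero>\<^bsub>V\<^esub> \<and>
    (\<forall>w\<in>carrier V. \<exists>c\<in>carrier K. w = h w \<oplus>\<^bsub>V\<^esub> c \<odot>\<^bsub>V\<^esub> v)"
proof -
  obtain B where B: "basis B" "v \<in> B"
    using adapted_basis[OF subspace_zero, of v] v by metis
  interpret C: linear_map K V "free_vs K B" "coords B"
    by (rule coords_linear(1)[OF B(1)])
  let ?l = "\<lambda>w. coords B w v"
  have l: "?l w \<in> carrier K" if "w \<in> carrier V" for w
    using that B(2) by (intro free_vs_apply_closed[OF C.T_im])
  have ladd: "?l (u \<oplus>\<^bsub>V\<^esub> w) = ?l u \<oplus>\<^bsub>K\<^esub> ?l w" if "u \<in> carrier V" "w \<in> carrier V" for u w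
    using that B(2) by (simp add: free_vs_add)
  have lsm: "?l (c \<odot>\<^bsub>V\<^esub> w) = c \<otimes>\<^bsub>K\<^esub> ?l w" if "c \<in> carrier K" "w \<in> carrier V" for c w
    using that B(2) by (simp add: free_vs_smult)
  have lv: "?l v = \<one>\<^bsub>K\<^esub>"
    using coords_linear(3)[OF B(1,2)] B(2) by (simp add: basis_vec_apply)
  \<comment> \<open>The projection along \<open>v\<close>, subtracting the
    \<open>v\<close>-coordinate in a basis that contains \<open>v\<close>. It models the quotient by
    \<open>v\<close> inside \<open>V\<close>.\<close>
  define h where "h w = w \<ominus>\<^bsub>V\<^esub> ?l w \<odot>\<^bsub>V\<^esub> v" for w
  have "linear_map K V V h"
  proof (rule linear_mapI)
    show "h w \<in> carrier V" if "w \<in> carrier V" for w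
      using that l v(1) by (simp add: h_def)
    show "h (u \<oplus>\<^bsub>V\<^esub> w) = h u \<oplus>\<^bsub>V\<^esub> h w" if uw: "u \<in> carrier V" "w \<in> carrier V" for u w
    proof -
      let ?a = "?l u \<odot>\<^bsub>V\<^esub> v" and ?b = "?l w \<odot>\<^bsub>V\<^esub> v"
      have ab: "?a \<in> carrier V" "?b \<in> carrier V"
        using l uw v(1) by auto
      have "h (u \<oplus>\<^bsub>V\<^esub> w) = (u \<oplus>\<^bsub>V\<^esub> w) \<ominus>\<^bsub>V\<^esub> (?a \<oplus>\<^bsub>V\<^esub> ?b)"
        unfolding h_def ladd[OF uw] using l uw v(1) by (simp add: smult_l_distr)
      also have "\<dots> = h u \<oplus>\<^bsub>V\<^esub> h w"
        unfolding h_def a_minus_def using uw ab by (simp add: M.minus_add M.a_ac)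
      finally show ?thesis .
    qed
    show "h (c \<odot>\<^bsub>V\<^esub> w) = c \<odot>\<^bsub>V\<^esub> h w" if cw: "c \<in> carrier K" "w \<in> carrier V" for c w
      unfolding h_def lsm[OF cw] a_minus_def
      using cw l v(1) by (simp add: smult_r_distr smult_r_minus smult_assoc1)
  qed (rule vectorspace_axioms)+
  moreover have "h v = \<zero>\<^bsub>V\<^esub>"
    unfolding h_def lv using v(1) by (simp add: a_minus_def M.r_neg)
  moreover have "w = h w \<oplus>\<^bsub>V\<^esub> ?l w \<odot>\<^bsub>V\<^esub> v" if "w \<in> carrier V" for w
    unfolding h_def a_minus_def using that l v(1) by (simp add: M.a_assoc M.l_neg)
  ultimately show ?thesis
    using l by blast
qed

context
  fixes x :: "'e \<Rightarrow> 'v" and e :: 'e and h :: "'v \<Rightarrow> 'v" and H :: "'s \<Rightarrow> 's"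
  assumes x: "\<And>a. x a \<in> carrier V" and e: "x e \<noteq> \<zero>\<^bsub>V\<^esub>"
    and h: "linear_map K V V h" "h (x e) = \<zero>\<^bsub>V\<^esub>"
      "\<And>w. w \<in> carrier V \<Longrightarrow> \<exists>c\<in>carrier K. w = h w \<oplus>\<^bsub>V\<^esub> c \<odot>\<^bsub>V\<^esub> x e"
    and H: "alg_hom K S S H" "\<And>w. w \<in> carrier V \<Longrightarrow> H (inc w) = inc (h w)"
begin

interpretation h: linear_map K V V h
  by (rule h(1))

interpretation H: alg_hom K S S H
  by (rule H(1))

abbreviation "x' \<equiv> \<lambda>a. h (x a)"

lemma x'_closed: "x' a \<in> carrier V"
  using x by simp

lemma h_mem_iff:
  assumes U: "subspace K U V" "x e \<in> U" and w: "w \<in> carrier V"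
  shows "h w \<in> U \<longleftrightarrow> w \<in> U"
proof -
  note D = subspaceD[OF U(1)]
  obtain c where c: "c \<in> carrier K" "w = h w \<oplus>\<^bsub>V\<^esub> c \<odot>\<^bsub>V\<^esub> x e"
    using h(3)[OF w] by blast
  have cx: "c \<odot>\<^bsub>V\<^esub> x e \<in> U" "c \<odot>\<^bsub>V\<^esub> x e \<in> carrier V"
    using D(4)[OF c(1) U(2)] D(1) by auto
  show ?thesis
  proof
    assume "h w \<in> U"
    then show "w \<in> U"
      using D(3) cx(1) c(2) by metis
  next
    assume "w \<in> U"
    then have "w \<ominus>\<^bsub>V\<^esub> c \<odot>\<^bsub>V\<^esub> x e \<in> U"
      using D(5) cx(1) by blast
    moreover have "w \<ominus>\<^bsub>V\<^esub> c \<odot>\<^bsub>V\<^esub> x e = (h w \<oplus>\<^bsub>V\<^esub> c \<odot>\<^bsub>V\<^esub> x e) \<ominus>\<^bsub>V\<^esub> c \<odot>\<^bsub>V\<^esub> x e"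
      using c(2) by simp
    moreover have "\<dots> = h w"
      using w cx(2) by (simp add: a_minus_def M.a_assoc M.r_neg)
    ultimately show "h w \<in> U"
      by simp
  qed
qed

lemma h_image_span: "h ` span (x ` Y) = span (x' ` Y)"
  using h.image_span[OF x_image[where x = x, OF x], of Y] by (simp add: image_image)

lemma h_image_span_insert: "h ` span (x ` insert e Y) = span (x' ` Y)"
proof -
  have "h ` span (x ` insert e Y) = span (insert \<zero>\<^bsub>V\<^esub> (x' ` Y))"
    using h_image_span[of "insert e Y"] h(2) by simp
  also have "\<dots> = span (x' ` Y)"
    using already_in_span[OF x_image[where x = x', OF x'_closed] span_zero, of Y] by simp
  finally show ?thesis .
qed

text \<open>The kernel of \<open>h\<close> is the line of \<open>x e\<close>, which is contained in
  the span of \<open>insert e Y\<close>; membership can therefore be tested after applying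
  \<open>h\<close>.\<close>

lemma contraction_mem_iff:
  assumes "w \<in> carrier V"
  shows "h w \<in> span (x' ` Y) \<longleftrightarrow> w \<in> span (x ` insert e Y)"
proof
  have U: "subspace K (span (x ` insert e Y)) V" "x e \<in> span (x ` insert e Y)"
    by (rule span_x_subspace[where x = x, OF x], rule in_span_x[where x = x, OF x], simp)
  assume "h w \<in> span (x' ` Y)"
  then obtain y where y: "y \<in> span (x ` insert e Y)" "h w = h y"
    unfolding h_image_span_insert[symmetric] by blast
  moreover have "y \<in> carrier V"
    using y(1) span_x_closed[where x = x, OF x] by blast
  ultimately show "w \<in> span (x ` insert e Y)"
    using h_mem_iff[OF U] assms by metis
next
  assume "w \<in> span (x ` insert e Y)"
  then show "h w \<in> span (x' ` Y)"
    unfolding h_image_span_insert[symmetric] by blast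
qed

text \<open>Both sides start at 0 because \<open>x e\<close> is nonzero, and a further element
  depends on \<open>e\<close> and the earlier elements just when its image depends on the images of
  the latter.\<close>

lemma contraction_nullity:
  assumes "finite Y" "e \<notin> Y"
  shows "nullity x (insert e Y) = nullity x' Y"
  using assms
proof (induction Y)
  case empty
  have "x e \<notin> span (x ` {})"
    using e by (simp add: span_empty)
  then show ?case
    using nullity_insert[where x = x, OF x, of "{}" e] by simp
next
  case (insert a Y)
  have "nullity x (insert a (insert e Y))
      = nullity x (insert e Y) + (if x a \<in> span (x ` insert e Y) then 1 else 0)"
    using insert by (intro nullity_insert[where x = x, OF x]) auto
  also have "\<dots> = nullity x' (insert a Y)"
    using nullity_insert[where x = x', OF x'_closed, of Y a] insert contraction_mem_iff[OF x] by simp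
  finally show ?case
    by (simp add: insert_commute)
qed

text \<open>The cyclic set of \<open>x\<close> above a cyclic set \<open>J\<close> of the
  contraction. Adding \<open>e\<close> is right only if \<open>e\<close> depends on
  \<open>J\<close>; otherwise it would be a coloop of \<open>insert e J\<close>. In both cases the
  nullity is that of \<open>J\<close> in the contraction.\<close>

definition lift_set :: "'e set \<Rightarrow> 'e set" where
  "lift_set J = (if x e \<in> span (x ` J) then insert e J else J)"

lemma lift_set_nullity:
  assumes "finite J" "e \<notin> J"
  shows "nullity x (lift_set J) = nullity x' J"
  using contraction_nullity[OF assms] nullity_insert[where x = x, OF x assms]
  by (auto simp: lift_set_def split: if_splits)

lemma lift_set_cyclic:
  assumes "cyclic x' J" "finite J" "e \<notin> J"
  shows "cyclic x (lift_set J)"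
proof -
  have J: "J \<noteq> {}" "\<And>a. a \<in> J \<Longrightarrow> x a \<in> span (x ` insert e (J - {a}))"
    using assms(1) contraction_mem_iff[OF x] by (auto simp: cyclic_def)
  show ?thesis
  proof (cases "x e \<in> span (x ` J)")
    case True
    have "x a \<in> span (x ` (insert e J - {a}))" if "a \<in> insert e J" for a
    proof (cases "a = e")
      case True
      then show ?thesis
        using \<open>x e \<in> span (x ` J)\<close> assms(3) by simp
    next
      case False
      then show ?thesis
        using J(2)[of a] that by (simp add: insert_Diff_if)
    qed
    then show ?thesis
      using True by (simp add: lift_set_def cyclic_def)
  next
    case False
    \<comment> \<open>By exchange: if \<open>x a\<close> needed \<open>x e\<close> besides
      \<open>J - {a}\<close>, then \<open>x e\<close> would lie in the span of
      \<open>J\<close>.\<close>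
    have "x a \<in> span (x ` (J - {a}))" if a: "a \<in> J" for a
    proof (rule ccontr)
      assume "x a \<notin> span (x ` (J - {a}))"
      then have "x e \<in> span (x ` insert a (J - {a}))"
        by (rule span_exchange[where x = x, OF x _ J(2)[OF a], rotated]) (simp add: assms(2))
      then show False
        using False a by (simp add: insert_absorb)
    qed
    then show ?thesis
      using False J(1) by (simp add: lift_set_def cyclic_def)
  qed
qed

text \<open>The preimages \<open>u\<close> over \<open>A - J\<close> and \<open>y\<close> over
  \<open>J\<close> of \<open>w'\<close> may differ by a multiple of \<open>x e\<close>. If
  \<open>e\<close> depends on \<open>J\<close>, it belongs to \<open>lift_set J\<close> and
  \<open>u\<close> is in both spans. If \<open>e\<close> depends on \<open>A\<close> but not on
  \<open>J\<close>, it joins the difference and \<open>y\<close> is in both. If it does not even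
  depend on \<open>A\<close>, the multiple vanishes and \<open>u = y\<close>.\<close>

lemma lift_factor:
  assumes "J \<subset> A" "e \<notin> A" "w' \<in> span (x' ` (A - J))" "w' \<in> span (x' ` J)"
  shows "\<exists>w. w \<in> span (x ` (lift_set A - lift_set J)) \<and> w \<in> span (x ` lift_set J) \<and> h w = w'"
proof -
  have eJ: "e \<notin> J"
    using assms(1,2) by blast
  obtain u where u: "u \<in> span (x ` (A - J))" "w' = h u"
    using assms(3) unfolding h_image_span[symmetric] by blast
  obtain y where y: "y \<in> span (x ` J)" "w' = h y"
    using assms(4) unfolding h_image_span[symmetric] by blast
  have uc: "u \<in> carrier V" and yc: "y \<in> carrier V"
    using u(1) y(1) span_x_closed[where x = x, OF x] by auto
  show ?thesis
  proof (cases "x e \<in> span (x ` J)")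
    case True
    moreover have "x e \<in> span (x ` A)"
      using True span_x_mono[where x = x, OF x, of J A] assms(1) by blast
    ultimately have "lift_set A - lift_set J = A - J" "lift_set J = insert e J"
      using assms(2) by (auto simp: lift_set_def)
    moreover have "u \<in> span (x ` insert e J)"
      using contraction_mem_iff[OF uc, of J] assms(4) u(2) by simp
    ultimately show ?thesis
      using u by auto
  next
    case nJ: False
    show ?thesis
    proof (cases "x e \<in> span (x ` A)")
      case True
      then have "lift_set A - lift_set J = insert e (A - J)" "lift_set J = J"
        using nJ assms(2) eJ by (auto simp: lift_set_def)
      moreover have "y \<in> span (x ` insert e (A - J))"
        using contraction_mem_iff[OF yc, of "A - J"] assms(3) y(2) by simp
      ultimately show ?thesis
        using y by auto
    next
      case False
      have sub: "subspace K (span (x ` A)) V"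
        by (rule span_x_subspace[where x = x, OF x])
      have uA: "u \<in> span (x ` A)" "y \<in> span (x ` A)"
        using u(1) y(1) span_x_mono[where x = x, OF x, of "A - J" A] span_x_mono[where x = x, OF x, of J A] assms(1) by auto
      let ?d = "u \<ominus>\<^bsub>V\<^esub> y"
      have dc: "?d \<in> carrier V" and dA: "?d \<in> span (x ` A)"
        using uc yc subspaceD(5)[OF sub uA] by auto
      have "h ?d = \<zero>\<^bsub>V\<^esub>"
        using uc yc u(2) y(2) by simp
      then obtain c where c: "c \<in> carrier K" "?d = c \<odot>\<^bsub>V\<^esub> x e"
        using h(3)[OF dc] x[of e] by auto
      have "c = \<zero>\<^bsub>K\<^esub>"
      proof (rule ccontr)
        assume c0: "c \<noteq> \<zero>\<^bsub>K\<^esub>"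
        then have "x e = inv\<^bsub>K\<^esub> c \<odot>\<^bsub>V\<^esub> ?d"
          using mult_inverse[OF c(1) x[of e] c(2)[symmetric]] by simp
        then have "x e \<in> span (x ` A)"
          using subspaceD(4)[OF sub _ dA, of "inv\<^bsub>K\<^esub> c"] inverse_exists[OF c(1) c0] by simp
        then show False
          using False by blast
      qed
      then have "u = y"
        using c(2) uc yc x[of e] by simp
      moreover have "lift_set A = A" "lift_set J = J"
        using False nJ by (auto simp: lift_set_def)
      ultimately show ?thesis
        using u y by auto
    qed
  qed
qed

text \<open>A whole chain is lifted step by step, since \<open>lift_set\<close> respects nullity,
  cyclicity and strict inclusion. This yields surjectivity onto the contraction.\<close>

lemma chain_prod_lift:
  assumes "chain_prod x' A f'" "e \<notin> A"
  shows "\<exists>f. chain_prod x (lift_set A) f \<and> H f = f'"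
  using assms
proof (induction rule: chain_prod.induct)
  case (base A)
  then have "chain_prod x (lift_set A) \<one>\<^bsub>S\<^esub>"
    using lift_set_cyclic[of A] lift_set_nullity[of A] by (intro chain_prod.base) (auto simp: lift_set_def)
  then show ?case
    using H.hom_one by blast
next
  case (step J f' A w')
  then have fin: "finite J" and eJ: "e \<notin> J"
    using finite_subset by auto
  obtain f where f: "chain_prod x (lift_set J) f" "H f = f'"
    using step.IH eJ by blast
  obtain w where w: "w \<in> span (x ` (lift_set A - lift_set J))" "w \<in> span (x ` lift_set J)" "h w = w'"
    using lift_factor[of J A w'] step by blast
  have wc: "w \<in> carrier V"
    using w(1) span_x_closed[where x = x, OF x] by blast
  have sub: "lift_set J \<subset> lift_set A"
    using step(4) span_x_mono[where x = x, OF x, of J A] step.prems by (auto simp: lift_set_def)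
  have "chain_prod x (lift_set A) (inc w \<otimes>\<^bsub>S\<^esub> f)"
  proof (rule chain_prod.step[OF f(1) _ _ sub _ w(1,2)])
    show "cyclic x (lift_set A)"
      using lift_set_cyclic step by blast
    show "finite (lift_set A)"
      using step(3) by (simp add: lift_set_def)
    show "nullity x (lift_set A) = Suc (nullity x (lift_set J))"
      using lift_set_nullity step fin eJ by simp
  qed
  moreover have "H (inc w \<otimes>\<^bsub>S\<^esub> f) = inc w' \<otimes>\<^bsub>S\<^esub> f'"
    using wc chain_prod_closed[where x = x, OF x f(1)] by (simp add: H.hom_mult H(2) w(3) f(2))
  ultimately show ?case
    by blast
qed

section \<open>One step of deletion and contraction\<close>

context
  fixes A :: "'e set"
  assumes A: "finite A" "e \<in> A" "x e \<in> span (x ` (A - {e}))"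
begin

lemma lift_set_remove: "lift_set (A - {e}) = A"
  using A by (auto simp: lift_set_def)

lemma nullity_A: "nullity x A = Suc (nullity x (A - {e}))" "nullity x' (A - {e}) = nullity x A"
  using nullity_remove[where x = x, OF x A(1,2)] A contraction_nullity[of "A - {e}"] by (auto simp: insert_absorb)

lemma mult_sp_contraction: "mult_sp x' (A - {e}) \<subseteq> H ` mult_sp x A"
proof -
  have sub: "{f. chain_prod x A f} \<subseteq> carrier S"
    using chain_prod_closed[where x = x, OF x] by blast
  have "{f. chain_prod x' (A - {e}) f} \<subseteq> H ` {f. chain_prod x A f}"
    using chain_prod_lift[of "A - {e}"] lift_set_remove by auto
  then show ?thesis
    unfolding mult_sp_def H.image_span[OF sub] by (rule S.span_is_monotone)
qed

text \<open>The condition at \<open>Y\<close> comes from the condition on \<open>f\<close> at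
  \<open>insert e Y\<close>, still a proper subset of \<open>A\<close>: \<open>h\<close> maps its
  span onto that of \<open>Y\<close> in the contraction, and the nullities agree.\<close>

lemma van_sp_contraction:
  assumes f: "f \<in> van_sp x A"
  shows "H f \<in> van_sp x' (A - {e})"
proof -
  have f': "f \<in> carrier S" "\<And>Y. Y \<subset> A \<Longrightarrow> f \<in> van (span (x ` Y)) (nullity x Y) (nullity x A - 1)"
    using f nullity_A(1) by (auto simp: van_sp_def)
  have hc: "h \<in> carrier V \<rightarrow> carrier V"
    by auto
  have "H f \<in> van (span (x' ` Y)) (nullity x' Y) (nullity x' (A - {e}) - 1)" if Y: "Y \<subset> A - {e}" for Y
  proof -
    have "insert e Y \<subset> A" "finite Y" "e \<notin> Y"
      using Y A finite_subset by auto
    then have "f \<in> van (span (x ` insert e Y)) (nullity x' Y) (nullity x A - 1)"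
      using f'(2)[of "insert e Y"] contraction_nullity by simp
    then have "H f \<in> van (h ` span (x ` insert e Y)) (nullity x' Y) (nullity x A - 1)"
      by (intro van_hom[OF H(1)] H(2) hc span_x_closed[where x = x, OF x])
    then show ?thesis
      by (simp only: h_image_span_insert nullity_A(2))
  qed
  then show ?thesis
    using f'(1) nullity_A by (simp add: van_sp_def)
qed

text \<open>A form in the kernel is a multiple of \<open>x e\<close>. For the condition on the
  cofactor at \<open>Y\<close>: if \<open>x e\<close> depends on \<open>Y\<close>, the condition at
  \<open>insert e Y\<close> is stronger by one and division costs one; otherwise the condition at
  \<open>Y\<close> itself survives division unchanged.\<close>

lemma van_sp_kernel:
  assumes f: "f \<in> van_sp x A" and Hf: "H f = \<zero>\<^bsub>S\<^esub>"
  shows "\<exists>g\<in>van_sp x (A - {e}). f = inc (x e) \<otimes>\<^bsub>S\<^esub> g"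
proof -
  have f': "f \<in> carrier S" "\<And>Y. Y \<subset> A \<Longrightarrow> f \<in> van (span (x ` Y)) (nullity x Y) (nullity x A - 1)"
    using f nullity_A(1) by (auto simp: van_sp_def)
  have hc: "h \<in> carrier V \<rightarrow> carrier V"
    by auto
  obtain g where g: "g \<in> carrier S" "f = H f \<oplus>\<^bsub>S\<^esub> inc (x e) \<otimes>\<^bsub>S\<^esub> g"
    using hom_complement[OF H hc x[of e] h(3) f'(1)] by blast
  then have fg: "f = inc (x e) \<otimes>\<^bsub>S\<^esub> g"
    using Hf x[of e] by simp
  note sub = span_x_subspace[where x = x, OF x]
  show ?thesis
  proof (cases "nullity x (A - {e})")
    case 0
    \<comment> \<open>Here \<open>f\<close> has degree 0 and can only be the zero multiple of
      \<open>x e\<close>, in accordance with the convention for nullity 0.\<close>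
    have "inc (x e) \<otimes>\<^bsub>S\<^esub> g \<in> van (span (x ` {})) (nullity x {}) 0"
      using f'(2)[of "{}"] A(2) nullity_A(1) 0 fg by auto
    then have "g = \<zero>\<^bsub>S\<^esub>"
      using van_div(1)[OF sub x e g(1)] by blast
    then show ?thesis
      using fg 0 by (auto simp: van_sp_def)
  next
    case (Suc n)
    have "g \<in> van (span (x ` Y)) (nullity x Y) n" if Y: "Y \<subset> A - {e}" for Y
    proof (cases "x e \<in> span (x ` Y)")
      case True
      have Y': "insert e Y \<subset> A" "finite Y" "e \<notin> Y"
        using Y A finite_subset by auto
      have "span (x ` insert e Y) = span (x ` Y)"
        using already_in_span[OF x_image[where x = x, OF x] True] by simp
      moreover have "nullity x (insert e Y) = Suc (nullity x Y)"
        using nullity_insert[where x = x, OF x Y'(2,3)] True by simp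
      ultimately have "inc (x e) \<otimes>\<^bsub>S\<^esub> g \<in> van (span (x ` Y)) (Suc (nullity x Y)) (Suc n)"
        using f'(2)[OF Y'(1)] nullity_A(1) Suc fg by simp
      then show ?thesis
        using van_div(2)[OF sub x e g(1) _ refl True] by fastforce
    next
      case False
      have "Y \<subset> A"
        using Y by blast
      then have "inc (x e) \<otimes>\<^bsub>S\<^esub> g \<in> van (span (x ` Y)) (nullity x Y) (Suc n)"
        using f'(2) nullity_A(1) Suc fg by simp
      then show ?thesis
        using van_div(3)[OF sub x e g(1) _ refl False] by blast
    qed
    then have "g \<in> van_sp x (A - {e})"
      using g(1) Suc by (simp add: van_sp_def)
    then show ?thesis
      using fg by blast
  qed
qed

text \<open>Given \<open>f\<close> with the vanishing conditions, some combination \<open>s\<close>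
  of chain products has the same image in the contraction. The difference of \<open>f\<close> and
  \<open>s\<close> is \<open>x e\<close> times an element of the deletion, hence again a combination
  of chain products. The dimensions add up because multiplication by \<open>x e\<close> is
  injective.\<close>

lemma deletion_contraction:
  assumes del: "mult_sp x (A - {e}) = van_sp x (A - {e})"
      "vectorspace.fin_dim K (S.vs (mult_sp x (A - {e})))"
    and con: "mult_sp x' (A - {e}) = van_sp x' (A - {e})"
      "vectorspace.fin_dim K (S.vs (mult_sp x' (A - {e})))"
  shows "mult_sp x A = van_sp x A" "vectorspace.fin_dim K (S.vs (mult_sp x A))"
    and "vectorspace.dim K (S.vs (mult_sp x A)) =
      vectorspace.dim K (S.vs (mult_sp x (A - {e}))) + vectorspace.dim K (S.vs (mult_sp x' (A - {e})))"
proof -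
  let ?N = "mult_sp x A"
  have N: "subspace K ?N S"
    by (rule mult_sp_subspace[where x = x, OF x])
  have N': "subspace K (van_sp x A) S"
    by (rule van_sp_subspace[where x = x, OF x])
  have "van_sp x A \<subseteq> ?N"
  proof
    fix f assume f: "f \<in> van_sp x A"
    then have "H f \<in> H ` ?N"
      using van_sp_contraction con(1) mult_sp_contraction by blast
    then obtain s where s: "s \<in> ?N" "H f = H s"
      by blast
    have s': "s \<in> van_sp x A"
      using s(1) mult_sp_subset_van_sp[where x = x, OF x] by blast
    have fc: "f \<in> carrier S" and sc: "s \<in> carrier S"
      using f s' S.subspaceD(1)[OF N'] by auto
    have "f \<ominus>\<^bsub>S\<^esub> s \<in> van_sp x A"
      by (rule S.subspaceD(5)[OF N' f s'])
    moreover have "H (f \<ominus>\<^bsub>S\<^esub> s) = \<zero>\<^bsub>S\<^esub>"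
      using fc sc s(2) by simp
    ultimately obtain g where "g \<in> van_sp x (A - {e})" "f \<ominus>\<^bsub>S\<^esub> s = inc (x e) \<otimes>\<^bsub>S\<^esub> g"
      using van_sp_kernel by blast
    then have "f \<ominus>\<^bsub>S\<^esub> s \<in> ?N"
      using mult_sp_deletion[where x = x, OF x _ A(2,1,3)] del(1) by simp
    then have "(f \<ominus>\<^bsub>S\<^esub> s) \<oplus>\<^bsub>S\<^esub> s \<in> ?N"
      using S.subspaceD(3)[OF N] s(1) by blast
    then show "f \<in> ?N"
      using fc sc by (simp add: a_minus_def S.a_assoc S.l_neg)
  qed
  then show eq: "?N = van_sp x A"
    using mult_sp_subset_van_sp[where x = x, OF x] by blast
  have im: "H ` ?N = mult_sp x' (A - {e})"
    using mult_sp_contraction van_sp_contraction eq con(1) by auto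
  let ?m = "\<lambda>g. inc (x e) \<otimes>\<^bsub>S\<^esub> g"
  have xe: "inc (x e) \<in> carrier S"
    using x by simp
  interpret m: linear_map K S S ?m
    by (rule mult_linear[OF xe])
  have D: "subspace K (mult_sp x (A - {e})) S"
    by (rule mult_sp_subspace[where x = x, OF x])
  have ker: "{f \<in> ?N. H f = \<zero>\<^bsub>S\<^esub>} = ?m ` mult_sp x (A - {e})"
  proof
    show "{f \<in> ?N. H f = \<zero>\<^bsub>S\<^esub>} \<subseteq> ?m ` mult_sp x (A - {e})"
      using van_sp_kernel eq del(1) by auto
    show "?m ` mult_sp x (A - {e}) \<subseteq> {f \<in> ?N. H f = \<zero>\<^bsub>S\<^esub>}"
    proof
      fix f assume "f \<in> ?m ` mult_sp x (A - {e})"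
      then obtain g where g: "g \<in> mult_sp x (A - {e})" "f = ?m g"
        by blast
      then have "g \<in> carrier S"
        using S.subspaceD(1)[OF D] by blast
      then have "H f = \<zero>\<^bsub>S\<^esub>"
        using g(2) xe x[of e] by (simp add: H.hom_mult H(2) h(2))
      then show "f \<in> {f \<in> ?N. H f = \<zero>\<^bsub>S\<^esub>}"
        using mult_sp_deletion[where x = x, OF x g(1) A(2,1,3)] g(2) by simp
    qed
  qed
  have inj: "inj_on ?m (carrier S)"
    using mult_cancel_zero[OF x e] by (intro m.inj_onI_kernel) auto
  interpret N: linear_map K "S.vs ?N" S H
    using S.subspaceD(1)[OF N]
    by (intro linear_mapI S.subspace_is_vs[OF N] S.vectorspace_axioms) (auto simp: subset_iff)
  note kd = m.subspace_image_dim[OF inj D del(2)]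
  have "vectorspace.fin_dim K (S.vs {f \<in> ?N. H f = \<zero>\<^bsub>S\<^esub>})"
    using kd(1) by (simp add: ker)
  moreover have "vectorspace.fin_dim K (S.vs (H ` ?N))"
    using con(2) im by simp
  ultimately show "N.V.fin_dim" "N.V.dim = vectorspace.dim K (S.vs (mult_sp x (A - {e}))) +
      vectorspace.dim K (S.vs (mult_sp x' (A - {e})))"
    using N.dim_extension kd(2) by (simp_all add: ker im)
qed

end

end

text \<open>The one nonzero base case. The only chain consists of \<open>{e}\<close> itself, and the
  only proper subset is empty, with a condition that leaves the scalars.\<close>

lemma mult_sp_single_loop:
  assumes x: "\<And>a. x a \<in> carrier V" and e: "x e = \<zero>\<^bsub>V\<^esub>"
  shows "mult_sp x {e} = S.span {\<one>\<^bsub>S\<^esub>}" "van_sp x {e} = S.span {\<one>\<^bsub>S\<^esub>}"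
proof -
  have n: "nullity x {e} = 1"
    using nullity_insert[where x = x, OF x, of "{}" e] e by (simp add: span_empty)
  have "cyclic x {e}"
    using e by (simp add: cyclic_def span_empty)
  then have "chain_prod x {e} \<one>\<^bsub>S\<^esub>"
    using n by (intro chain_prod.base) auto
  moreover have "f = \<one>\<^bsub>S\<^esub>" if "chain_prod x {e} f" for f
    using that
  proof (cases rule: chain_prod.cases)
    case (step I f' w)
    then have "I = {}"
      by blast
    then show ?thesis
      using chain_prod_cyclic(1)[OF step(2)] by (simp add: cyclic_def)
  qed
  ultimately have "{f. chain_prod x {e} f} = {\<one>\<^bsub>S\<^esub>}"
    by blast
  then show "mult_sp x {e} = S.span {\<one>\<^bsub>S\<^esub>}"
    by (simp add: mult_sp_def)
  have "Y \<subset> {e} \<longleftrightarrow> Y = {}" for Y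
    by blast
  moreover have "van (span {}) 0 0 \<subseteq> carrier S"
    by (rule S.subspaceD(1)[OF van_subspace[OF span_is_subset2]]) simp
  ultimately show "van_sp x {e} = S.span {\<one>\<^bsub>S\<^esub>}"
    using n van_0_0[of "span {}"] by (auto simp: van_sp_def)
qed

text \<open>The vectors are generalised along with \<open>A\<close>, since contraction replaces
  them. Coloops, the empty set and loops are settled directly; otherwise every element of
  \<open>A\<close> is fit for deletion and contraction.\<close>

theorem mult_sp_dim:
  assumes "finite A" "\<And>a. x a \<in> carrier V"
  shows "mult_sp x A = van_sp x A \<and> vectorspace.fin_dim K (S.vs (mult_sp x A)) \<and>
    int (vectorspace.dim K (S.vs (mult_sp x A))) = beta (nullity x) A"
  using assms
proof (induction "card A" arbitrary: A x rule: less_induct)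
  case less
  note A = less.prems(1) and x = less.prems(2)
  \<comment> \<open>If the vanishing conditions force zero, so do the chains; only a vanishing beta
    invariant has to be matched.\<close>
  have zero: ?case if "van_sp x A \<subseteq> {\<zero>\<^bsub>S\<^esub>}" "beta (nullity x) A = 0"
  proof -
    have "mult_sp x A = {\<zero>\<^bsub>S\<^esub>}" "van_sp x A = {\<zero>\<^bsub>S\<^esub>}"
      using that mult_sp_subset_van_sp[where x = x, OF x, of A] S.subspaceD(2)[OF mult_sp_subspace[where x = x, OF x]] by blast+
    moreover have "vectorspace.dim K (S.vs (S.span {})) = 0" "vectorspace.fin_dim K (S.vs (S.span {}))"
      using S.fin_dim_span[of "{}"] by auto
    ultimately show ?thesis
      using that(2) by (simp add: S.span_empty)
  qed
  show ?case
  proof (cases "\<exists>e\<in>A. x e \<notin> span (x ` (A - {e}))")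
    case True
    then obtain e where e: "e \<in> A" "x e \<notin> span (x ` (A - {e}))"
      by blast
    have n: "nullity x (insert e Y) = nullity x Y" if Y: "Y \<subseteq> A - {e}" for Y
    proof -
      have "x e \<notin> span (x ` Y)"
        using e(2) span_x_mono[where x = x, OF x Y] by blast
      moreover have "finite Y" "e \<notin> Y"
        using Y A finite_subset by auto
      ultimately show ?thesis
        using nullity_insert[where x = x, OF x] by simp
    qed
    have "van_sp x A \<subseteq> {\<zero>\<^bsub>S\<^esub>}"
    proof (cases "nullity x A = 0")
      case False
      have "nullity x (A - {e}) = nullity x A"
        using n[of "A - {e}"] e(1) by (simp add: insert_absorb)
      \<comment> \<open>The order demanded at \<open>A - {e}\<close> is the full nullity of
        \<open>A\<close>, one more than the degree.\<close>
      then have "van (span (x ` (A - {e}))) (nullity x (A - {e})) (nullity x A - 1) = {\<zero>\<^bsub>S\<^esub>}"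
        using False by (intro van_gt) simp
      moreover have "A - {e} \<subset> A"
        using e(1) by blast
      ultimately show ?thesis
        by (rule van_sp_trivial[rotated])
    qed (simp add: van_sp_def)
    then show ?thesis
      using beta_coloop[OF A e(1), of "nullity x"] n by (intro zero) auto
  next
    case ncl: False
    show ?thesis
    proof (cases "A = {}")
      case True
      then show ?thesis
        by (intro zero) (auto simp: van_sp_def beta_def)
    next
      case ne: False
      show ?thesis
      proof (cases "\<exists>e\<in>A. x e = \<zero>\<^bsub>V\<^esub>")
        case True
        then obtain e where e: "e \<in> A" "x e = \<zero>\<^bsub>V\<^esub>"
          by blast
        have n: "nullity x (insert e Y) = Suc (nullity x Y)" if Y: "Y \<subseteq> A - {e}" for Y
        proof -
          have "finite Y" "e \<notin> Y"
            using Y A finite_subset by auto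
          then show ?thesis
            using nullity_insert[where x = x, OF x] e(2) span_zero by simp
        qed
        show ?thesis
        proof (cases "A = {e}")
          case True
          have "int (vectorspace.dim K (S.vs (S.span {\<one>\<^bsub>S\<^esub>}))) = 1"
            using S.span_dim_insert[of "{}" "\<one>\<^bsub>S\<^esub>"] one_nonzero S.fin_dim_span(2)[of "{}"]
            by (simp add: S.span_empty)
          moreover have "beta (nullity x) {e} = 1"
            using n[of "{}"] by (simp add: beta_def Pow_insert)
          moreover have "vectorspace.fin_dim K (S.vs (S.span {\<one>\<^bsub>S\<^esub>}))"
            by (rule S.fin_dim_span) auto
          ultimately show ?thesis
            using mult_sp_single_loop[where x = x, OF x e(2)] True by simp
        next
          case False
          \<comment> \<open>A loop spans the zero space, along which positive order forces the form
            itself to be zero.\<close>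
          have "van (span (x ` {e})) (nullity x {e}) (nullity x A - 1) = {\<zero>\<^bsub>S\<^esub>}"
          proof (rule van_zero)
            show "span (x ` {e}) \<subseteq> {\<zero>\<^bsub>V\<^esub>}"
              using span_minimal[OF subspace_zero] e(2) by simp
            show "0 < nullity x {e}"
              using n[of "{}"] by simp
          qed
          moreover have "{e} \<subset> A"
            using e(1) False by blast
          ultimately have "van_sp x A \<subseteq> {\<zero>\<^bsub>S\<^esub>}"
            by (rule van_sp_trivial[rotated])
          then show ?thesis
            using beta_loop[OF A e(1) False, of "nullity x"] n by (intro zero) auto
        qed
      next
        case False
        obtain e where e: "e \<in> A"
          using ne by blast
        then have e': "x e \<noteq> \<zero>\<^bsub>V\<^esub>" "x e \<in> span (x ` (A - {e}))"
          using False ncl by auto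
        obtain h where h: "linear_map K V V h" "h (x e) = \<zero>\<^bsub>V\<^esub>"
            "\<And>w. w \<in> carrier V \<Longrightarrow> \<exists>c\<in>carrier K. w = h w \<oplus>\<^bsub>V\<^esub> c \<odot>\<^bsub>V\<^esub> x e"
          using contraction_exists[OF x e'(1)] by metis
        obtain H where H: "alg_hom K S S H" "\<And>w. w \<in> carrier V \<Longrightarrow> H (inc w) = inc (h w)"
          using lift[OF h(1)] by metis
        let ?x' = "\<lambda>a. h (x a)"
        have x': "?x' a \<in> carrier V" for a
          using x linear_map.T_im[OF h(1)] by simp
        have card: "card (A - {e}) < card A" "finite (A - {e})"
          using card_Diff1_less[OF A e] A by simp_all
        note del = less.hyps[OF card, of x, OF x]
        note con = less.hyps[OF card, of ?x', OF x']
        have d: "mult_sp x (A - {e}) = van_sp x (A - {e})"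
            "vectorspace.fin_dim K (S.vs (mult_sp x (A - {e})))"
          and c: "mult_sp ?x' (A - {e}) = van_sp ?x' (A - {e})"
            "vectorspace.fin_dim K (S.vs (mult_sp ?x' (A - {e})))"
          by (rule conjunct1[OF del] conjunct1[OF conjunct2[OF del]]
              conjunct1[OF con] conjunct1[OF conjunct2[OF con]])+
        note dc = deletion_contraction[where x = x, OF x e'(1) h H A e e'(2) d c]
        have "beta (nullity x) A = beta (nullity x) (A - {e}) + beta (nullity ?x') (A - {e})"
        proof (rule beta_deletion_contraction[OF A e])
          show "nullity x A = Suc (nullity x (A - {e}))"
            using nullity_remove[where x = x, OF x A e] e'(2) by simp
          show "nullity x (insert e Y) = nullity ?x' Y" if "Y \<subseteq> A - {e}" for Y
            using that A finite_subset by (intro contraction_nullity[where x = x, OF x e'(1) h H]) auto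
        qed
        then show ?thesis
          using dc conjunct2[OF conjunct2[OF del]] conjunct2[OF conjunct2[OF con]] by simp
      qed
    qed
  qed
qed

end

section \<open>Matroids\<close>

lemma matroid_rank_image:
  assumes f: "inj_on f A" "\<And>X. X \<subseteq> A \<Longrightarrow> indep M X \<longleftrightarrow> indep M' (f ` X)" and X: "X \<subseteq> A"
  shows "matroid_rank M' (f ` X) = matroid_rank M X"
proof -
  have "{Y. Y \<subseteq> f ` X \<and> indep M' Y} = (\<lambda>Y. f ` Y) ` {Y. Y \<subseteq> X \<and> indep M Y}"
    using f(2) X by (fastforce simp: subset_image_iff)
  moreover have "card (f ` Y) = card Y" if "Y \<subseteq> X" for Y
    using that X f(1) by (meson card_image inj_on_subset)
  ultimately have "card ` {Y. Y \<subseteq> f ` X \<and> indep M' Y} = card ` {Y. Y \<subseteq> X \<and> indep M Y}"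
    by (force simp: image_image)
  then show ?thesis
    by (simp add: matroid_rank_def)
qed

lemma beta_image:
  assumes f: "inj_on f A" "\<And>X. X \<subseteq> A \<Longrightarrow> \<nu>' (f ` X) = \<nu> X"
  shows "beta \<nu>' (f ` A) = beta \<nu> A"
proof -
  have inj: "inj_on (\<lambda>X. f ` X) (Pow A)"
    using f(1) by (rule inj_on_image_Pow)
  have card: "card (f ` X) = card X" if "X \<subseteq> A" for X
    using that f(1) by (meson card_image inj_on_subset)
  have "(\<Sum>Y\<in>Pow (f ` A). (-1) ^ card Y * int (\<nu>' Y)) = (\<Sum>Y\<in>Pow A. (-1) ^ card (f ` Y) * int (\<nu>' (f ` Y)))"
    unfolding image_Pow_surj[OF refl, of f A, symmetric] by (simp add: sum.reindex[OF inj])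
  also have "\<dots> = (\<Sum>Y\<in>Pow A. (-1) ^ card Y * int (\<nu> Y))"
    using f(2) card by (intro sum.cong) auto
  finally show ?thesis
    using f(2)[of A] card[of A] by (simp add: beta_def)
qed

locale matroid =
  fixes M :: "'s matroid"
  assumes matroid: "is_matroid M"
begin

abbreviation "E \<equiv> ground M"
abbreviation "rk \<equiv> matroid_rank M"

lemma finite_ground: "finite E"
  and indep_ground: "indep M X \<Longrightarrow> X \<subseteq> E"
  and indep_empty: "indep M {}"
  and indep_subset: "indep M Y \<Longrightarrow> X \<subseteq> Y \<Longrightarrow> indep M X"
  and indep_augment: "indep M X \<Longrightarrow> indep M Y \<Longrightarrow> card X < card Y \<Longrightarrow> \<exists>y\<in>Y - X. indep M (insert y X)"
  using matroid unfolding is_matroid_def by blast+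

lemma finite_indep: "indep M X \<Longrightarrow> finite X"
  using indep_ground finite_ground finite_subset by blast

lemma finite_indeps: "finite {X. X \<subseteq> A \<and> indep M X}"
  by (rule finite_subset[of _ "Pow E"]) (auto simp: finite_ground dest: indep_ground)

lemma card_le_rk: "indep M X \<Longrightarrow> X \<subseteq> A \<Longrightarrow> card X \<le> rk A"
  unfolding matroid_rank_def using finite_indeps by (intro Max_ge) auto

lemma rk_witness: "\<exists>X\<subseteq>A. indep M X \<and> card X = rk A"
proof -
  have "rk A \<in> card ` {X. X \<subseteq> A \<and> indep M X}"
    unfolding matroid_rank_def using finite_indeps indep_empty by (intro Max_in) auto
  then show ?thesis
    by auto
qed

lemma rk_mono:
  assumes "A \<subseteq> B"
  shows "rk A \<le> rk B"
proof -
  obtain X where "X \<subseteq> A" "indep M X" "card X = rk A"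
    using rk_witness by blast
  then show ?thesis
    using card_le_rk[of X B] assms by auto
qed

lemma indep_extend:
  assumes "indep M X" "X \<subseteq> A"
  shows "\<exists>I. X \<subseteq> I \<and> I \<subseteq> A \<and> indep M I \<and> card I = rk A"
  using assms
proof (induction "rk A - card X" arbitrary: X rule: less_induct)
  case less
  show ?case
  proof (cases "card X = rk A")
    case False
    then have lt: "card X < rk A"
      using card_le_rk[OF less.prems] by simp
    obtain Y where Y: "Y \<subseteq> A" "indep M Y" "card Y = rk A"
      using rk_witness by blast
    then obtain y where y: "y \<in> Y - X" "indep M (insert y X)"
      using indep_augment[OF less.prems(1) Y(2)] lt by auto
    have "card (insert y X) = Suc (card X)"
      using y(1) finite_indep[OF less.prems(1)] by simp
    then have "\<exists>I. insert y X \<subseteq> I \<and> I \<subseteq> A \<and> indep M I \<and> card I = rk A"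
      using lt y Y(1) less.prems(2) by (intro less.hyps) auto
    then show ?thesis
      by blast
  qed (use less.prems in blast)
qed

lemma base_iff: "matroid_base M B \<longleftrightarrow> indep M B \<and> card B = rk E"
proof
  assume B: "matroid_base M B"
  then have "indep M B" "B \<subseteq> E"
    using indep_ground by (auto simp: matroid_base_def)
  then obtain I where "B \<subseteq> I" "indep M I" "card I = rk E"
    using indep_extend[of B E] by blast
  then show "indep M B \<and> card B = rk E"
    using B by (auto simp: matroid_base_def)
next
  assume B: "indep M B \<and> card B = rk E"
  have "X = B" if "indep M X" "B \<subseteq> X" for X
    using card_seteq[OF finite_indep[OF that(1)] that(2)] card_le_rk[OF that(1) indep_ground[OF that(1)]] B by simp
  then show "matroid_base M B"
    using B by (auto simp: matroid_base_def)
qed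

text \<open>The formula for the dual rank, written additively to avoid truncated differences. A base
  disjoint from a dual independent set splits along \<open>F\<close>, which gives the upper bound; a
  maximal independent subset of \<open>E - F\<close>, extended to a base \<open>B\<close>, makes
  \<open>F - B\<close> attain it.\<close>

lemma dual_rank:
  assumes F: "F \<subseteq> E"
  shows "matroid_rank (dual_matroid M) F + rk E = card F + rk (E - F)"
proof -
  let ?X = "{X. X \<subseteq> F \<and> indep (dual_matroid M) X}"
  have finF: "finite F"
    using F finite_ground finite_subset by blast
  have le: "card X + rk E \<le> card F + rk (E - F)" if X: "X \<in> ?X" for X
  proof -
    obtain B where B: "indep M B" "card B = rk E" "X \<inter> B = {}"
      using X by (auto simp: dual_matroid_def base_iff)
    have finB: "finite B"
      by (rule finite_indep[OF B(1)])
    have "card B = card (B \<inter> F) + card (B - F)"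
      using finB by (metis card_Diff_subset_Int card_mono finite_Int inf_le1 le_add_diff_inverse)
    moreover have "card (B - F) \<le> rk (E - F)"
      using indep_subset[OF B(1), of "B - F"] indep_ground[OF B(1)] by (intro card_le_rk) auto
    moreover have "card X + card (B \<inter> F) \<le> card F"
    proof -
      have "card (X \<union> (B \<inter> F)) = card X + card (B \<inter> F)"
        using X B(3) finF finite_subset by (intro card_Un_disjoint) auto
      moreover have "card (X \<union> (B \<inter> F)) \<le> card F"
        using X by (intro card_mono finF) auto
      ultimately show ?thesis
        by simp
    qed
    ultimately show ?thesis
      using B(2) by simp
  qed
  obtain I where I: "I \<subseteq> E - F" "indep M I" "card I = rk (E - F)"
    using rk_witness by blast
  then obtain B where B: "I \<subseteq> B" "indep M B" "card B = rk E"
    using indep_extend[of I E] by blast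
  have finB: "finite B"
    by (rule finite_indep[OF B(2)])
  have "B - F = I"
  proof (rule card_seteq[symmetric])
    show "finite (B - F)" "I \<subseteq> B - F"
      using finB I(1) B(1) by auto
    show "card (B - F) \<le> card I"
      unfolding I(3) using indep_subset[OF B(2), of "B - F"] indep_ground[OF B(2)] by (intro card_le_rk) auto
  qed
  then have "card (B \<inter> F) + rk (E - F) = rk E"
    using finB B(3) I(3) by (metis card_Diff_subset_Int card_mono finite_Int inf_le1 le_add_diff_inverse)
  moreover have "card (F - B) + card (B \<inter> F) = card F"
    using finF by (metis Int_commute card_Diff_subset_Int card_mono finite_Int inf_le1 le_add_diff_inverse2)
  ultimately have eq: "card (F - B) + rk E = card F + rk (E - F)"
    by simp
  have FB: "F - B \<in> ?X"
    using F B(2,3) by (auto simp: dual_matroid_def base_iff)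
  have "finite ?X"
    by (rule finite_subset[of _ "Pow F"]) (use finF in auto)
  then have "Max (card ` ?X) = card (F - B)"
  proof (intro Max_eqI)
    show "n \<le> card (F - B)" if n: "n \<in> card ` ?X" for n
    proof -
      obtain X where "X \<in> ?X" "n = card X"
        using n by (rule imageE)
      then show ?thesis
        using le[of X] eq by simp
    qed
    show "card (F - B) \<in> card ` ?X"
      using FB by (rule imageI)
  qed simp
  then show ?thesis
    using eq by (simp add: matroid_rank_def)
qed

text \<open>By \<open>dual_rank\<close>, adding \<open>a\<close> to \<open>E - A\<close> raises the
  dual rank just when removing \<open>a\<close> from \<open>A\<close> keeps the rank. Flatness of
  the complement thus says that \<open>A\<close> has no coloops, and properness that
  \<open>A\<close> is nonempty.\<close>

lemma T_flat_iff: "T_flat M A \<longleftrightarrow> A \<noteq> {} \<and> A \<subseteq> E \<and> (\<forall>a\<in>A. rk (A - {a}) = rk A)"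
proof (cases "A \<subseteq> E")
  case True
  let ?r = "matroid_rank (dual_matroid M)"
  have "?r (E - A) < ?r (insert a (E - A)) \<longleftrightarrow> rk (A - {a}) = rk A" if a: "a \<in> A" for a
  proof -
    have "?r (E - A) + rk E = card (E - A) + rk (E - (E - A))"
      by (intro dual_rank) auto
    moreover have "?r (insert a (E - A)) + rk E = card (insert a (E - A)) + rk (E - insert a (E - A))"
      using a True by (intro dual_rank) auto
    moreover have "E - (E - A) = A" "E - insert a (E - A) = A - {a}"
      using True by auto
    moreover have "card (insert a (E - A)) = Suc (card (E - A))"
      using a finite_ground by simp
    moreover have "rk (A - {a}) \<le> rk A"
      by (rule rk_mono) blast
    ultimately show ?thesis
      by auto
  qed
  moreover have "E - (E - A) = A"
    using True by blast
  moreover have "ground (dual_matroid M) = E"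
    by (simp add: dual_matroid_def)
  moreover have "E - A \<noteq> E \<longleftrightarrow> A \<noteq> {}"
    using True by auto
  ultimately show ?thesis
    using True by (auto simp: T_flat_def matroid_flat_def)
qed (auto simp: T_flat_def)

lemma finite_T_flats: "finite (T_flats M n)"
  by (rule finite_subset[of _ "Pow E"]) (auto simp: finite_ground T_flats_def T_flat_iff)

end

lemma T_flats_image:
  assumes "is_matroid M" "is_matroid M'" and f: "bij_betw f (ground M) (ground M')"
    and ind: "\<And>X. X \<subseteq> ground M \<Longrightarrow> indep M X \<longleftrightarrow> indep M' (f ` X)"
  shows "T_flats M' n = (\<lambda>A. f ` A) ` T_flats M n"
proof -
  interpret M: matroid M
    by unfold_locales fact
  interpret M': matroid M'
    by unfold_locales fact
  have inj: "inj_on f (ground M)" and im: "f ` ground M = ground M'"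
    using f by (auto simp: bij_betw_def)
  have rk: "matroid_rank M' (f ` X) = matroid_rank M X" if "X \<subseteq> ground M" for X
    by (rule matroid_rank_image[OF inj ind that])
  have "T_flat M' (f ` A) \<and> level M' (f ` A) = int n \<longleftrightarrow> T_flat M A \<and> level M A = int n"
    if A: "A \<subseteq> ground M" for A
  proof -
    have "f ` (A - {a}) = f ` A - {f a}" if "a \<in> A" for a
      using inj A that by (auto simp: inj_on_def)
    then have "matroid_rank M' (f ` A - {f a}) = matroid_rank M (A - {a})" if "a \<in> A" for a
      using rk[of "A - {a}"] A that by auto
    moreover have "card (f ` A) = card A"
      using A inj by (meson card_image inj_on_subset)
    ultimately show ?thesis
      using A rk[OF A] im by (auto simp: M.T_flat_iff M'.T_flat_iff level_def)
  qed
  note iff = this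
  show ?thesis
  proof (intro equalityI subsetI)
    fix B assume B: "B \<in> T_flats M' n"
    then have "B \<subseteq> f ` ground M"
      by (auto simp: im T_flats_def M'.T_flat_iff)
    then obtain A where A: "A \<subseteq> ground M" "B = f ` A"
      by (meson subset_image_iff)
    then show "B \<in> (\<lambda>A. f ` A) ` T_flats M n"
      using B iff[OF A(1)] by (auto simp: T_flats_def)
  next
    fix B assume "B \<in> (\<lambda>A. f ` A) ` T_flats M n"
    then obtain A where A: "A \<in> T_flats M n" "B = f ` A"
      by blast
    then show "B \<in> T_flats M' n"
      using iff[of A] by (auto simp: T_flats_def M.T_flat_iff)
  qed
qed

section \<open>Representations\<close>

context symmetric_algebra
begin

abbreviation list_prod :: "'s list \<Rightarrow> 's" where
  "list_prod ys \<equiv> foldr (\<lambda>y z. y \<otimes>\<^bsub>S\<^esub> z) ys \<one>\<^bsub>S\<^esub>"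

lemma list_prod_closed: "set ys \<subseteq> carrier S \<Longrightarrow> list_prod ys \<in> carrier S"
  by (induction ys) auto

text \<open>Chains of T-flats grow at the end of the list, whereas \<open>chain_prod\<close>
  multiplies the newest factor from the left; commutativity reconciles the two.\<close>

lemma list_prod_snoc:
  assumes "set ys \<subseteq> carrier S" "y \<in> carrier S"
  shows "list_prod (ys @ [y]) = y \<otimes>\<^bsub>S\<^esub> list_prod ys"
  using assms
proof (induction ys)
  case (Cons z ys)
  then show ?case
    using list_prod_closed[of ys] by (simp add: S.m_lcomm)
qed simp

lemma list_all2_closed:
  assumes "list_all2 (\<lambda>y Y. y \<in> Y) ys Ys" "\<And>Y. Y \<in> set Ys \<Longrightarrow> Y \<subseteq> carrier S"
  shows "set ys \<subseteq> carrier S"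
  using assms by (induction rule: list_all2_induct) auto

text \<open>Products of subspaces are spans nested inside spans. Multiplication by a fixed element
  is linear, so a single span over choices of one element from each subspace gives the same
  space.\<close>

lemma subspace_prod_list_eq:
  assumes "\<And>Y. Y \<in> set Ys \<Longrightarrow> Y \<subseteq> carrier S"
  shows "subspace_prod_list K S Ys = S.span {list_prod ys | ys. list_all2 (\<lambda>y Y. y \<in> Y) ys Ys}"
  using assms
proof (induction Ys)
  case Nil
  then show ?case
    by (simp add: subspace_prod_list_def)
next
  case (Cons Y Ys)
  let ?G = "{list_prod ys | ys. list_all2 (\<lambda>y Y. y \<in> Y) ys Ys}"
  let ?G' = "{list_prod ys | ys. list_all2 (\<lambda>y Y. y \<in> Y) ys (Y # Ys)}"
  let ?P = "{y \<otimes>\<^bsub>S\<^esub> z | y z. y \<in> Y \<and> z \<in> S.span ?G}"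
  have Gc: "?G \<subseteq> carrier S"
    using list_all2_closed[of _ Ys] list_prod_closed Cons.prems by auto
  have G'c: "?G' \<subseteq> carrier S"
    using list_all2_closed[of _ "Y # Ys"] list_prod_closed Cons.prems by blast
  have Yc: "Y \<subseteq> carrier S"
    using Cons.prems by simp
  have Pc: "?P \<subseteq> carrier S"
    using Yc S.span_is_subset2[OF Gc] by auto
  have "?P \<subseteq> S.span ?G'"
  proof
    fix p assume "p \<in> ?P"
    then obtain y z where yz: "y \<in> Y" "z \<in> S.span ?G" "p = y \<otimes>\<^bsub>S\<^esub> z"
      by blast
    have yc: "y \<in> carrier S"
      using yz(1) Yc by blast
    interpret m: linear_map K S S "\<lambda>z. y \<otimes>\<^bsub>S\<^esub> z"
      by (rule mult_linear[OF yc])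
    have "y \<otimes>\<^bsub>S\<^esub> g \<in> ?G'" if g: "g \<in> ?G" for g
    proof -
      obtain ys where "list_all2 (\<lambda>y Y. y \<in> Y) ys Ys" "g = list_prod ys"
        using g by blast
      then show ?thesis
        using yz(1) by (intro CollectI exI[of _ "y # ys"]) simp
    qed
    then have "?G \<subseteq> {z \<in> carrier S. y \<otimes>\<^bsub>S\<^esub> z \<in> S.span ?G'}"
      using Gc S.in_own_span[OF G'c] by blast
    then show "p \<in> S.span ?G'"
      using S.span_minimal[OF m.preimage_subspace[OF S.span_subspace[OF G'c]]] yz(2,3) by blast
  qed
  moreover have "?G' \<subseteq> S.span ?P"
  proof
    fix g assume "g \<in> ?G'"
    then obtain y ys where ys: "y \<in> Y" "list_all2 (\<lambda>y Y. y \<in> Y) ys Ys" "g = y \<otimes>\<^bsub>S\<^esub> list_prod ys"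
      by (auto simp: list_all2_Cons2)
    then have "list_prod ys \<in> S.span ?G"
      using S.in_own_span[OF Gc] by blast
    then have "g \<in> ?P"
      using ys by blast
    then show "g \<in> S.span ?P"
      using S.in_own_span[OF Pc] by blast
  qed
  ultimately have "S.span ?P = S.span ?G'"
    by (intro S.span_least_eq Pc G'c)
  moreover have "subspace_prod_list K S (Y # Ys) = S.span ?P"
    using Cons by (simp add: subspace_prod_list_def subspace_prod_def)
  ultimately show ?case
    by simp
qed

end

lemma (in vectorspace) dim_eq_0_iff:
  assumes "fin_dim"
  shows "dim = 0 \<longleftrightarrow> carrier V = {\<zero>\<^bsub>V\<^esub>}"
proof
  obtain B where B: "finite B" "basis B"
    using finite_basis_exists[OF assms] by blast
  assume "dim = 0"
  then have "B = {}"
    using dim_basis[OF B] B(1) by simp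
  then show "carrier V = {\<zero>\<^bsub>V\<^esub>}"
    using B(2) span_empty by (simp add: basis_def)
next
  assume "carrier V = {\<zero>\<^bsub>V\<^esub>}"
  then have "basis {}"
    using span_empty by (auto simp: basis_def lin_dep_def)
  then show "dim = 0"
    using dim_basis[of "{}"] by simp
qed

locale matroid_representation = W: vectorspace K W + matroid M +
  phi: linear_map K "free_vs K (ground M)" W \<phi>
  for K :: "('k, 'm) ring_scheme" and W :: "('k, 'w, 'n) module_scheme"
    and M :: "'s matroid" and \<phi> :: "('s \<Rightarrow> 'k) \<Rightarrow> 'w" +
  assumes indep_iff: "A \<subseteq> ground M \<Longrightarrow>
    indep M A \<longleftrightarrow> vectorspace.dim K (W\<lparr>carrier := V_space K M \<phi> A\<rparr>) = card A"

lemma representation_locale: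
  assumes "representation K W M \<phi>"
  shows "matroid_representation K W M \<phi>"
proof -
  have "is_matroid M" "linear_map K (free_vs K (ground M)) W \<phi>"
    using assms by (auto simp: representation_def)
  moreover from this(2) have "vectorspace K W"
    by (simp add: linear_map_def)
  ultimately show ?thesis
    using assms
    by (intro matroid_representation.intro matroid.intro matroid_representation_axioms.intro)
      (auto simp: representation_def)
qed

context matroid_representation
begin

sublocale Sym: symmetric_algebra K W "sym_alg K W" "sym_incl K W"
  by (rule W.sym_alg_symmetric_algebra)

text \<open>The configuration attached to the representation. The value zero outside the ground set
  makes every \<open>vec s\<close> a vector, as the results on configurations assume.\<close>

definition vec :: "'s \<Rightarrow> 'w" where
  "vec s = (if s \<in> E then \<phi> (basis_vec K E s) else \<zero>\<^bsub>W\<^esub>)"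

lemma vec_closed: "vec s \<in> carrier W"
  using W.basis_vec_closed[of s E] by (simp add: vec_def)

lemma V_space_eq:
  assumes "A \<subseteq> E"
  shows "V_space K M \<phi> A = W.span (vec ` A)"
proof -
  have "basis_vec K E ` A \<subseteq> carrier (free_vs K E)"
    using assms by (auto intro!: W.basis_vec_closed)
  then have "V_space K M \<phi> A = W.span (\<phi> ` basis_vec K E ` A)"
    unfolding V_space_def U_space_def by (rule phi.image_span)
  moreover have "\<phi> ` basis_vec K E ` A = vec ` A"
    using assms by (auto simp: vec_def image_image intro!: image_cong)
  ultimately show ?thesis
    by simp
qed

text \<open>A representation only records which sets are independent. A largest independent subset
  bounds the rank by the dimension. In the other direction, a subset of \<open>A\<close> with the
  same span as \<open>A\<close> and as many elements as its dimension is independent.\<close>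

lemma rk_eq:
  assumes A: "A \<subseteq> E"
  shows "rk A = vectorspace.dim K (W.vs (W.span (vec ` A)))"
proof (rule antisym)
  let ?d = "\<lambda>A. vectorspace.dim K (W.vs (W.span (vec ` A)))"
  have fin: "finite A"
    using A finite_ground finite_subset by blast
  have dim: "indep M X \<longleftrightarrow> ?d X = card X" if "X \<subseteq> E" for X
    using indep_iff[OF that] V_space_eq[OF that] by simp
  obtain X where X: "X \<subseteq> A" "indep M X" "card X = rk A"
    using rk_witness by blast
  have "?d X \<le> ?d A"
  proof (rule W.subspace_dim_le(2))
    show "W.span (vec ` X) \<subseteq> W.span (vec ` A)"
      by (rule W.span_x_mono[where x = vec, OF vec_closed X(1)])
    show "vectorspace.fin_dim K (W.vs (W.span (vec ` A)))"
      using fin W.x_image[where x = vec, OF vec_closed] by (intro W.fin_dim_span) auto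
  qed (rule W.span_x_subspace[where x = vec, OF vec_closed])+
  then show "rk A \<le> ?d A"
    using X dim[of X] A by auto
  \<comment> \<open>Such a subset is found greedily, keeping an element only if its vector enlarges
    the span.\<close>
  have "\<exists>X\<subseteq>A. card X = ?d X \<and> W.span (vec ` X) = W.span (vec ` A)"
    using fin
  proof (induction A)
    case empty
    have "?d {} = 0"
      using W.rank_le_card[where x = vec, OF vec_closed, of "{}"] by simp
    then show ?case
      by simp
  next
    case (insert a A)
    then obtain X where X: "X \<subseteq> A" "card X = ?d X" "W.span (vec ` X) = W.span (vec ` A)"
      by blast
    have finX: "finite X"
      using X(1) insert.hyps(1) finite_subset by blast
    have im: "vec ` Y \<subseteq> carrier W" for Y
      by (rule W.x_image[where x = vec, OF vec_closed])
    have ins: "W.span (vec ` insert a X) = W.span (vec ` insert a A)"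
      using W.span_insert_eq[OF im im vec_closed X(3)] by simp
    show ?case
    proof (cases "vec a \<in> W.span (vec ` X)")
      case True
      then have "W.span (vec ` insert a X) = W.span (vec ` X)"
        using W.already_in_span[OF im] by simp
      then show ?thesis
        using X ins by (intro exI[of _ X]) auto
    next
      case False
      then have "?d (insert a X) = Suc (card X)"
        using W.span_dim_insert[OF _ im vec_closed, of X a] X(2) finX by simp
      moreover have "a \<notin> X"
        using X(1) insert.hyps(2) by blast
      ultimately show ?thesis
        using X(1) ins finX by (intro exI[of _ "insert a X"]) auto
    qed
  qed
  then obtain Y where Y: "Y \<subseteq> A" "card Y = ?d Y" "W.span (vec ` Y) = W.span (vec ` A)"
    by blast
  then have "indep M Y"
    using dim[of Y] A by simp
  then have "card Y \<le> rk A"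
    using Y(1) by (rule card_le_rk)
  then show "?d A \<le> rk A"
    using Y by simp
qed

lemma nullity_eq: "A \<subseteq> E \<Longrightarrow> W.nullity vec A = card A - rk A"
  by (simp add: W.nullity_def rk_eq)

lemma level_eq:
  assumes A: "A \<subseteq> E"
  shows "level M A = int (W.nullity vec A) - 1"
proof -
  have "finite A"
    using A finite_ground finite_subset by blast
  then have "rk A \<le> card A"
    using W.rank_le_card[where x = vec, OF vec_closed, of A] rk_eq[OF A] by simp
  then show ?thesis
    by (simp add: level_def nullity_eq[OF A])
qed

text \<open>Removing \<open>a\<close> keeps the rank just when \<open>vec a\<close> lies in the span
  of the rest; T-flats of the matroid thereby become cyclic sets of the configuration.\<close>

lemma T_flat_cyclic: "T_flat M A \<longleftrightarrow> A \<subseteq> E \<and> W.cyclic vec A"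
proof (cases "A \<subseteq> E")
  case True
  have fin: "finite A"
    using True finite_ground finite_subset by blast
  have "rk (A - {a}) = rk A \<longleftrightarrow> vec a \<in> W.span (vec ` (A - {a}))" if a: "a \<in> A" for a
  proof -
    have "vec ` A = insert (vec a) (vec ` (A - {a}))"
      using a by blast
    then have "rk A = rk (A - {a}) + (if vec a \<in> W.span (vec ` (A - {a})) then 0 else 1)"
      using W.span_dim_insert[OF _ W.x_image[where x = vec, OF vec_closed] vec_closed, of "A - {a}" a]
        fin rk_eq[OF True] rk_eq[of "A - {a}"] subset_trans[OF Diff_subset True] by auto
    then show ?thesis
      by simp
  qed
  then show ?thesis
    using True by (auto simp: T_flat_iff W.cyclic_def)
qed (simp add: T_flat_iff)

lemma T_flats_iff: "A \<in> T_flats M n \<longleftrightarrow> A \<subseteq> E \<and> W.cyclic vec A \<and> W.nullity vec A = Suc n"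
  by (auto simp: T_flats_def T_flat_cyclic level_eq)

section \<open>Chains of T-flats and chain products\<close>

abbreviation "facs Is \<equiv> map (\<lambda>i. sym_incl K W `
  (V_space K M \<phi> (Is ! i - Is ! (i - 1)) \<inter> V_space K M \<phi> (Is ! (i - 1)))) [1..<length Is]"

lemma facs_snoc:
  assumes "Is \<noteq> []"
  shows "facs (Is @ [A]) = facs Is @
    [sym_incl K W ` (V_space K M \<phi> (A - last Is) \<inter> V_space K M \<phi> (last Is))]"
proof -
  have "[1..<length (Is @ [A])] = [1..<length Is] @ [length Is]"
    using assms by (simp add: Suc_le_eq)
  moreover have "(Is @ [A]) ! (length Is - 1) = last Is"
    using assms by (simp add: nth_append last_conv_nth)
  ultimately show ?thesis
    by (auto simp: nth_append)
qed

text \<open>Peels off the top flat, matching the direction in which \<open>chain_prod\<close> is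
  built.\<close>

lemma T_chains_snoc:
  assumes "length Is = Suc n"
  shows "Is @ [A] \<in> T_chains M (Suc n) A \<longleftrightarrow>
    Is \<in> T_chains M n (last Is) \<and> A \<in> T_flats M (Suc n) \<and> last Is \<subset> A"
proof -
  have l: "last Is = Is ! n"
    using assms by (cases Is) (auto simp: last_conv_nth)
  have nth: "\<And>i. i \<le> n \<Longrightarrow> (Is @ [A]) ! i = Is ! i" "(Is @ [A]) ! Suc n = A"
    using assms by (auto simp: nth_append)
  have "(\<forall>i\<le>Suc n. (Is @ [A]) ! i \<in> T_flats M i) \<longleftrightarrow>
      (Is @ [A]) ! Suc n \<in> T_flats M (Suc n) \<and> (\<forall>i\<le>n. (Is @ [A]) ! i \<in> T_flats M i)"
    unfolding less_Suc_eq_le[symmetric] by (rule All_less_Suc)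
  moreover have "(\<forall>i<Suc n. (Is @ [A]) ! i \<subset> (Is @ [A]) ! Suc i) \<longleftrightarrow>
      (Is @ [A]) ! n \<subset> (Is @ [A]) ! Suc n \<and> (\<forall>i<n. (Is @ [A]) ! i \<subset> (Is @ [A]) ! Suc i)"
    by (rule All_less_Suc)
  ultimately show ?thesis
    unfolding T_chains_def l using assms nth by (simp cong: conj_cong) blast
qed

lemma T_chains_nonempty: "Is \<in> T_chains M n A \<Longrightarrow> length Is = Suc n \<and> last Is = A"
  by (cases Is) (auto simp: T_chains_def last_conv_nth)

lemma T_chains_ground: "Is \<in> T_chains M n A \<Longrightarrow> i < length Is \<Longrightarrow> Is ! i \<subseteq> E"
  by (auto simp: T_chains_def T_flats_iff)

lemma facs_closed:
  assumes "Is \<in> T_chains M n A" "Y \<in> set (facs Is)"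
  shows "Y \<subseteq> carrier (sym_alg K W)"
proof -
  obtain i where i: "i < length Is" "Y = sym_incl K W `
      (V_space K M \<phi> (Is ! i - Is ! (i - 1)) \<inter> V_space K M \<phi> (Is ! (i - 1)))"
    using assms(2) by auto
  have "Is ! (i - 1) \<subseteq> E"
    using T_chains_ground[OF assms(1), of "i - 1"] i(1) by simp
  then have "V_space K M \<phi> (Is ! (i - 1)) \<subseteq> carrier W"
    using V_space_eq W.span_x_closed[where x = vec, OF vec_closed] by simp
  then show ?thesis
    unfolding i(2) using Sym.inc.T_im by blast
qed

lemma chain_prod_of_T_chain:
  assumes "Is \<in> T_chains M n A" "list_all2 (\<lambda>y Y. y \<in> Y) ys (facs Is)"
  shows "Sym.chain_prod vec A (Sym.list_prod ys)"
  using assms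
proof (induction n arbitrary: Is A ys)
  case 0
  then have "length Is = 1" "A \<in> T_flats M 0"
    by (auto simp: T_chains_def)
  \<comment> \<open>A chain with a single flat contributes no factors, whence the unit as empty
    product.\<close>
  then have "ys = []" "A \<subseteq> E" "W.cyclic vec A" "W.nullity vec A = 1"
    using 0(2) by (auto simp: T_flats_iff)
  moreover from this(2) have "finite A"
    using finite_ground finite_subset by blast
  ultimately show ?case
    by (simp add: Sym.chain_prod.base)
next
  case (Suc n)
  have len: "length Is = Suc (Suc n)" "last Is = A"
    using T_chains_nonempty[OF Suc.prems(1)] by auto
  define Is' where "Is' = butlast Is"
  have ne0: "Is \<noteq> []" and len': "length Is' = Suc n"
    using len by (auto simp: Is'_def)
  have Is: "Is = Is' @ [A]"
    unfolding Is'_def len(2)[symmetric] by (rule append_butlast_last_id[OF ne0, symmetric])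
  have ne: "Is' \<noteq> []"
    using len' by auto
  let ?I = "last Is'"
  have chain: "Is' \<in> T_chains M n ?I" "A \<in> T_flats M (Suc n)" "?I \<subset> A"
    using Suc.prems(1) T_chains_snoc[OF len', of A] Is by auto
  obtain ys' y where ys: "ys = ys' @ [y]" "list_all2 (\<lambda>y Y. y \<in> Y) ys' (facs Is')"
    "y \<in> sym_incl K W ` (V_space K M \<phi> (A - ?I) \<inter> V_space K M \<phi> ?I)"
    using Suc.prems(2) unfolding Is facs_snoc[OF ne] by (auto simp: list_all2_append2 list_all2_Cons2)
  have A: "A \<subseteq> E" "W.cyclic vec A" "W.nullity vec A = Suc (Suc n)"
    using chain(2) by (auto simp: T_flats_iff)
  have "?I \<in> T_flats M n"
    using chain(1) by (auto simp: T_chains_def)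
  then have I: "?I \<subseteq> E" "W.nullity vec ?I = Suc n"
    by (auto simp: T_flats_iff)
  have AI: "A - ?I \<subseteq> E"
    using A(1) by blast
  obtain w where w: "w \<in> W.span (vec ` (A - ?I))" "w \<in> W.span (vec ` ?I)" "y = sym_incl K W w"
    using ys(3) unfolding V_space_eq[OF AI] V_space_eq[OF I(1)] by blast
  have "set ys' \<subseteq> carrier (sym_alg K W)"
    by (rule Sym.list_all2_closed[OF ys(2) facs_closed[OF chain(1)]])
  moreover have "y \<in> carrier (sym_alg K W)"
    using w W.span_x_closed[where x = vec, OF vec_closed] by auto
  ultimately have "Sym.list_prod ys = sym_incl K W w \<otimes>\<^bsub>sym_alg K W\<^esub> Sym.list_prod ys'"
    using Sym.list_prod_snoc[of ys' y] ys(1) w(3) by simp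
  moreover have "finite A"
    using A(1) finite_ground finite_subset by blast
  ultimately show ?case
    using Sym.chain_prod.step[OF Suc.IH[OF chain(1) ys(2)] A(2) _ chain(3) _ w(1,2)] A(3) I(2) by simp
qed

lemma T_chain_of_chain_prod:
  assumes "Sym.chain_prod vec A f" "A \<subseteq> E"
  shows "\<exists>Is ys. Is \<in> T_chains M (W.nullity vec A - 1) A \<and>
    list_all2 (\<lambda>y Y. y \<in> Y) ys (facs Is) \<and> f = Sym.list_prod ys"
  using assms
proof (induction rule: Sym.chain_prod.induct)
  case (base A)
  then have "[A] \<in> T_chains M (W.nullity vec A - 1) A"
    by (auto simp: T_chains_def T_flats_iff)
  then show ?case
    by (intro exI[of _ "[A]"] exI[of _ "[]"]) simp
next
  case (step I f A w)
  have IE: "I \<subseteq> E" "A - I \<subseteq> E"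
    using step(4) step.prems by auto
  obtain n where n: "W.nullity vec I = Suc n"
    using W.cyclic_pos[where x = vec, OF vec_closed Sym.chain_prod_cyclic[OF step(1)]] by (auto simp: gr0_conv_Suc)
  obtain Is ys where Is: "Is \<in> T_chains M n I" "list_all2 (\<lambda>y Y. y \<in> Y) ys (facs Is)" "f = Sym.list_prod ys"
    using step.IH[OF IE(1)] n by auto
  have len: "length Is = Suc n" "last Is = I"
    using T_chains_nonempty[OF Is(1)] by auto
  then have ne: "Is \<noteq> []"
    by auto
  have "A \<in> T_flats M (Suc n)"
    using step n by (auto simp: T_flats_iff)
  then have "Is @ [A] \<in> T_chains M (Suc n) A"
    using T_chains_snoc[OF len(1), of A] Is(1) len(2) step(4) by simp
  moreover have "list_all2 (\<lambda>y Y. y \<in> Y) (ys @ [sym_incl K W w]) (facs (Is @ [A]))"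
    unfolding facs_snoc[OF ne] len(2) V_space_eq[OF IE(1)] V_space_eq[OF IE(2)]
    using Is(2) step(6,7) by (intro list_all2_appendI) auto
  moreover have "set ys \<subseteq> carrier (sym_alg K W)"
    using Sym.list_all2_closed[OF Is(2)] facs_closed[OF Is(1)] by blast
  then have "sym_incl K W w \<otimes>\<^bsub>sym_alg K W\<^esub> f = Sym.list_prod (ys @ [sym_incl K W w])"
    using Is(3) step(6) W.span_x_closed[where x = vec, OF vec_closed]
    by (subst Sym.list_prod_snoc) auto
  ultimately show ?case
    using step(5) n by (intro exI[of _ "Is @ [A]"] exI[of _ "ys @ [sym_incl K W w]"]) simp
qed

text \<open>The products generating the chain spaces and the chain products are the same elements.
  If \<open>A\<close> is not a T-flat, no chain product belongs to it, and the empty span agrees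
  with the zero space of the definition.\<close>

lemma mult_space_eq:
  assumes A: "A \<subseteq> E"
  shows "mult_space K W M \<phi> A = Sym.mult_sp vec A"
proof (cases "T_flat M A")
  case True
  let ?S = "sym_alg K W"
  let ?n = "nat (level M A)"
  \<comment> \<open>Level -1 is cut off by \<open>nat\<close> just as nullity 0 is by the truncated
    difference.\<close>
  have n: "?n = W.nullity vec A - 1"
    using level_eq[OF A] by simp
  have cs: "chain_space K W M \<phi> Is = Sym.S.span {Sym.list_prod ys | ys. list_all2 (\<lambda>y Y. y \<in> Y) ys (facs Is)}"
    if "Is \<in> T_chains M ?n A" for Is
    unfolding chain_space_def using facs_closed[OF that]
    by (rule Sym.subspace_prod_list_eq)
  have N: "subspace K (Sym.mult_sp vec A) ?S"
    by (rule Sym.mult_sp_subspace[where x = vec, OF vec_closed])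
  have sub: "chain_space K W M \<phi> Is \<subseteq> Sym.mult_sp vec A" if Is: "Is \<in> T_chains M ?n A" for Is
    unfolding cs[OF Is]
  proof (rule Sym.S.span_minimal[OF N], rule subsetI)
    fix f assume "f \<in> {Sym.list_prod ys | ys. list_all2 (\<lambda>y Y. y \<in> Y) ys (facs Is)}"
    then obtain ys where "list_all2 (\<lambda>y Y. y \<in> Y) ys (facs Is)" "f = Sym.list_prod ys"
      by blast
    then show "f \<in> Sym.mult_sp vec A"
      using Sym.chain_prod_mult_sp[where x = vec, OF vec_closed chain_prod_of_T_chain[OF Is]] by blast
  qed
  let ?C = "\<Union>Is\<in>T_chains M ?n A. chain_space K W M \<phi> Is"
  have C: "?C \<subseteq> Sym.mult_sp vec A"
    using sub by blast
  have Cc: "?C \<subseteq> carrier ?S"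
    using C Sym.S.subspaceD(1)[OF N] by blast
  have "{f. Sym.chain_prod vec A f} \<subseteq> Sym.S.span ?C"
  proof
    fix f assume "f \<in> {f. Sym.chain_prod vec A f}"
    then have "Sym.chain_prod vec A f"
      by simp
    then obtain Is ys where Is: "Is \<in> T_chains M ?n A" "list_all2 (\<lambda>y Y. y \<in> Y) ys (facs Is)" "f = Sym.list_prod ys"
      using T_chain_of_chain_prod[OF _ A] unfolding n by blast
    have "{Sym.list_prod ys | ys. list_all2 (\<lambda>y Y. y \<in> Y) ys (facs Is)} \<subseteq> carrier ?S"
      using Sym.list_all2_closed[OF _ facs_closed[OF Is(1)]] Sym.list_prod_closed by blast
    then have "f \<in> chain_space K W M \<phi> Is"
      unfolding cs[OF Is(1)] using Sym.S.in_own_span Is(2,3) by blast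
    then have "f \<in> ?C"
      using Is(1) by blast
    then show "f \<in> Sym.S.span ?C"
      using Sym.S.in_own_span[OF Cc] by blast
  qed
  then have "Sym.mult_sp vec A \<subseteq> Sym.S.span ?C"
    unfolding Sym.mult_sp_def by (rule Sym.S.span_minimal[OF Sym.S.span_subspace[OF Cc]])
  moreover have "Sym.S.span ?C \<subseteq> Sym.mult_sp vec A"
    by (rule Sym.S.span_minimal[OF N C])
  ultimately show ?thesis
    using True by (simp add: mult_space_def)
next
  case False
  then have "\<not> W.cyclic vec A"
    using A T_flat_cyclic by blast
  then have "{f. Sym.chain_prod vec A f} = {}"
    using Sym.chain_prod_cyclic(1) by blast
  then show ?thesis
    using False by (simp add: mult_space_def Sym.mult_sp_def Sym.S.span_empty)
qed

section \<open>Dimensions of the multiplicity spaces and of the T-complex\<close>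

lemma mult_vs_dim:
  assumes A: "A \<subseteq> E"
  shows "vectorspace K (mult_vs K W M \<phi> A)" "vectorspace.fin_dim K (mult_vs K W M \<phi> A)"
    and "int (vectorspace.dim K (mult_vs K W M \<phi> A)) = beta (W.nullity vec) A"
proof -
  have fin: "finite A"
    using A finite_ground finite_subset by blast
  note d = Sym.mult_sp_dim[of A vec, OF fin vec_closed]
  show "vectorspace.fin_dim K (mult_vs K W M \<phi> A)"
    "int (vectorspace.dim K (mult_vs K W M \<phi> A)) = beta (W.nullity vec) A"
    unfolding mult_vs_def mult_space_eq[OF A]
    by (rule conjunct1[OF conjunct2[OF d]] conjunct2[OF conjunct2[OF d]])+
  show "vectorspace K (mult_vs K W M \<phi> A)"
    unfolding mult_vs_def mult_space_eq[OF A]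
    by (rule Sym.S.subspace_is_vs[OF Sym.mult_sp_subspace[where x = vec, OF vec_closed]])
qed

text \<open>Both exterior powers are top powers: \<open>U_space K E I\<close> has dimension
  \<open>card I\<close>, and the dual of \<open>V_space K M \<phi> I\<close> has dimension
  \<open>rk I\<close>. Tensoring with these two lines leaves the dimension of the dual of the
  multiplicity space.\<close>

lemma T_component_at_dim:
  assumes I: "I \<in> T_flats M n"
  shows "vectorspace K (T_component_at K W M \<phi> I)" "vectorspace.fin_dim K (T_component_at K W M \<phi> I)"
    and "vectorspace.dim K (T_component_at K W M \<phi> I) = vectorspace.dim K (mult_vs K W M \<phi> I)"
proof -
  have IE: "I \<subseteq> E"
    using I by (simp add: T_flats_iff)
  have fin: "finite I"
    using IE finite_ground finite_subset by blast
  interpret Mu: vectorspace K "mult_vs K W M \<phi> I"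
    by (rule mult_vs_dim(1)[OF IE])
  note Mu_dual = Mu.dual_vectorspace Mu.dual_dim[OF mult_vs_dim(2)[OF IE]]
  have U: "vectorspace K ((free_vs K E)\<lparr>carrier := U_space K E I\<rparr>)"
    unfolding U_space_def using IE
    by (intro phi.V.subspace_is_vs phi.V.span_subspace) (auto intro!: W.basis_vec_closed)
  note U_dim = W.free_vs_span_dim[OF IE fin, folded U_space_def]
  note ext_U = ext_power_dim[OF U U_dim(2,1)]
  have V: "subspace K (V_space K M \<phi> I) W"
    unfolding V_space_eq[OF IE] by (rule W.span_x_subspace[where x = vec, OF vec_closed])
  interpret V: vectorspace K "W\<lparr>carrier := V_space K M \<phi> I\<rparr>"
    by (rule W.subspace_is_vs[OF V])
  have V_fin: "V.fin_dim"
    unfolding V_space_eq[OF IE] using fin vec_closed by (intro W.fin_dim_span) auto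
  have V_dim: "V.dim = rk I"
    unfolding V_space_eq[OF IE] rk_eq[OF IE] ..
  note V_dual = V.dual_vectorspace V.dual_dim[OF V_fin]
  have ext_V: "vectorspace K (ext_power K (rk I) (dual_vs K (W\<lparr>carrier := V_space K M \<phi> I\<rparr>)))"
      "vectorspace.fin_dim K (ext_power K (rk I) (dual_vs K (W\<lparr>carrier := V_space K M \<phi> I\<rparr>)))"
      "vectorspace.dim K (ext_power K (rk I) (dual_vs K (W\<lparr>carrier := V_space K M \<phi> I\<rparr>))) = 1"
    using ext_power_dim[OF V_dual(1,2)] V_dual(3) V_dim by auto
  note t1 = tensor_line_dim[OF Mu_dual(1,2) ext_U]
  note t2 = tensor_line_dim[OF t1(1,2) ext_V]
  show "vectorspace K (T_component_at K W M \<phi> I)" "vectorspace.fin_dim K (T_component_at K W M \<phi> I)"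
    "vectorspace.dim K (T_component_at K W M \<phi> I) = vectorspace.dim K (mult_vs K W M \<phi> I)"
    unfolding T_component_at_def using t2 t1(3) Mu_dual(3) by simp_all
qed

lemma T_component_dim:
  "vectorspace K (T_component K W M \<phi> n)" "vectorspace.fin_dim K (T_component K W M \<phi> n)"
  "vectorspace.dim K (T_component K W M \<phi> n) = (\<Sum>I\<in>T_flats M n. vectorspace.dim K (mult_vs K W M \<phi> I))"
proof -
  show "vectorspace K (T_component K W M \<phi> n)"
    unfolding T_component_def
    by (rule direct_sum_vectorspace[OF W.field_axioms T_component_at_dim(1) finite_T_flats])
  show "vectorspace.fin_dim K (T_component K W M \<phi> n)"
    unfolding T_component_def
    by (rule direct_sum_dim(1)[OF W.field_axioms T_component_at_dim(1,2) finite_T_flats])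
  have "vectorspace.dim K (T_component K W M \<phi> n)
      = (\<Sum>I\<in>T_flats M n. vectorspace.dim K (T_component_at K W M \<phi> I))"
    unfolding T_component_def
    by (rule direct_sum_dim(2)[OF W.field_axioms T_component_at_dim(1,2) finite_T_flats])
  also have "\<dots> = (\<Sum>I\<in>T_flats M n. vectorspace.dim K (mult_vs K W M \<phi> I))"
    by (intro sum.cong refl T_component_at_dim(3))
  finally show "vectorspace.dim K (T_component K W M \<phi> n)
      = (\<Sum>I\<in>T_flats M n. vectorspace.dim K (mult_vs K W M \<phi> I))" .
qed

text \<open>Makes the length a function of the dimensions of the components.\<close>

lemma T_component_zero_iff:
  "carrier (T_component K W M \<phi> n) = {\<zero>\<^bsub>T_component K W M \<phi> n\<^esub>} \<longleftrightarrow>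
    vectorspace.dim K (T_component K W M \<phi> n) = 0"
  using vectorspace.dim_eq_0_iff[OF T_component_dim(1,2)] by simp

end

text \<open>Both dimensions are beta invariants of nullity functions, and \<open>f\<close> carries
  one nullity function to the other because cardinality and independent sets determine it.\<close>

lemma mult_vs_dim_invariant:
  assumes "representation K W M \<phi>" "representation K' W' M' \<phi>'"
    and A: "A \<subseteq> ground M" and f: "inj_on f A" "f ` A \<subseteq> ground M'"
    and ind: "\<And>X. X \<subseteq> A \<Longrightarrow> indep M X \<longleftrightarrow> indep M' (f ` X)"
  shows "vectorspace.dim K (mult_vs K W M \<phi> A) = vectorspace.dim K' (mult_vs K' W' M' \<phi>' (f ` A))"
proof -
  interpret R: matroid_representation K W M \<phi>
    by (rule representation_locale) fact
  interpret R': matroid_representation K' W' M' \<phi>'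
    by (rule representation_locale) fact
  have "R'.W.nullity R'.vec (f ` X) = R.W.nullity R.vec X" if X: "X \<subseteq> A" for X
  proof -
    have "X \<subseteq> ground M" "f ` X \<subseteq> ground M'"
      using X A f(2) by auto
    moreover have "card (f ` X) = card X"
      using X f(1) by (meson card_image inj_on_subset)
    ultimately show ?thesis
      by (simp add: R.nullity_eq R'.nullity_eq matroid_rank_image[OF f(1) ind X])
  qed
  then have "beta (R'.W.nullity R'.vec) (f ` A) = beta (R.W.nullity R.vec) A"
    by (intro beta_image[OF f(1)])
  then have "int (vectorspace.dim K (mult_vs K W M \<phi> A)) = int (vectorspace.dim K' (mult_vs K' W' M' \<phi>' (f ` A)))"
    using R.mult_vs_dim(3)[OF A] R'.mult_vs_dim(3)[OF f(2)] by simp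
  then show ?thesis
    by simp
qed

theorem theorem6p6:
  fixes K :: "('k, 'm) ring_scheme" and K' :: "('l, 'p) ring_scheme"
    and W :: "('k, 'w, 'n) module_scheme" and W' :: "('l, 'v, 'q) module_scheme"
    and M :: "'s matroid" and M' :: "'t matroid"
    and \<phi> :: "('s \<Rightarrow> 'k) \<Rightarrow> 'w" and \<phi>' :: "('t \<Rightarrow> 'l) \<Rightarrow> 'v"
  assumes "representation K W M \<phi>"
    and "representation K' W' M' \<phi>'"
  shows "(\<forall>A A'. A \<subseteq> ground M \<and> A' \<subseteq> ground M' \<and>
            matroid_isomorphic (restrict_matroid M A) (restrict_matroid M' A') \<longrightarrow>
            vectorspace.dim K (mult_vs K W M \<phi> A) = vectorspace.dim K' (mult_vs K' W' M' \<phi>' A'))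
       \<and> (matroid_isomorphic M M' \<longrightarrow>
            T_length K W M \<phi> = T_length K' W' M' \<phi>' \<and>
            (\<forall>n. vectorspace.dim K (T_component K W M \<phi> n)
               = vectorspace.dim K' (T_component K' W' M' \<phi>' n)))"
proof (intro conjI impI allI)
  fix A A'
  assume h: "A \<subseteq> ground M \<and> A' \<subseteq> ground M' \<and>
    matroid_isomorphic (restrict_matroid M A) (restrict_matroid M' A')"
  \<comment> \<open>Independence in the restriction to \<open>A'\<close> includes containment in
    \<open>A'\<close>, which is automatic for images under a bijection onto
    \<open>A'\<close>.\<close>
  then obtain f where f: "bij_betw f A A'"
    "\<And>X. X \<subseteq> A \<Longrightarrow> indep M X \<longleftrightarrow> f ` X \<subseteq> A' \<and> indep M' (f ` X)"
    by (auto simp: matroid_isomorphic_def restrict_matroid_def)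
  then have "inj_on f A" "f ` A = A'"
    by (auto simp: bij_betw_def)
  then show "vectorspace.dim K (mult_vs K W M \<phi> A) = vectorspace.dim K' (mult_vs K' W' M' \<phi>' A')"
    using mult_vs_dim_invariant[OF assms, of A f] h f(2) by blast
next
  interpret R: matroid_representation K W M \<phi>
    by (rule representation_locale) fact
  interpret R': matroid_representation K' W' M' \<phi>'
    by (rule representation_locale) fact
  assume "matroid_isomorphic M M'"
  then obtain f where f: "bij_betw f (ground M) (ground M')"
    and ind: "\<And>X. X \<subseteq> ground M \<Longrightarrow> indep M X \<longleftrightarrow> indep M' (f ` X)"
    by (auto simp: matroid_isomorphic_def)
  have inj: "inj_on f (ground M)" and im: "f ` ground M = ground M'"
    using f by (auto simp: bij_betw_def)
  show dim: "vectorspace.dim K (T_component K W M \<phi> n) = vectorspace.dim K' (T_component K' W' M' \<phi>' n)" for n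
  proof -
    have sub: "I \<subseteq> ground M" if "I \<in> T_flats M n" for I
      using that by (simp add: R.T_flats_iff)
    have injT: "inj_on (\<lambda>I. f ` I) (T_flats M n)"
      by (rule inj_on_subset[OF inj_on_image_Pow[OF inj]]) (use sub in blast)
    have "vectorspace.dim K (mult_vs K W M \<phi> I) = vectorspace.dim K' (mult_vs K' W' M' \<phi>' (f ` I))"
      if I: "I \<in> T_flats M n" for I
    proof (rule mult_vs_dim_invariant[OF assms sub[OF I]])
      show "inj_on f I" "f ` I \<subseteq> ground M'"
        using sub[OF I] inj im inj_on_subset by blast+
      show "indep M X \<longleftrightarrow> indep M' (f ` X)" if "X \<subseteq> I" for X
        using ind[of X] sub[OF I] that by blast
    qed
    moreover have T': "T_flats M' n = (\<lambda>I. f ` I) ` T_flats M n"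
      by (rule T_flats_image[OF R.matroid R'.matroid f ind])
    ultimately show ?thesis
      unfolding R.T_component_dim(3) R'.T_component_dim(3) T' sum.reindex[OF injT]
      by (intro sum.cong) auto
  qed
  show "T_length K W M \<phi> = T_length K' W' M' \<phi>'"
    \<comment> \<open>The degrees with a nonzero component are the same on both sides, so emptiness
      and maximum of this set agree.\<close>
    unfolding T_length_def R.T_component_zero_iff R'.T_component_zero_iff dim ..
qed

end
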